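(* For $t\in\mathbb{C}$ let $X_t=\{(x,y,z)\in\mathbb{C}^3 \mid x^5+z^{15}+y^7z+txy^6=0\}$. Then for every $t\neq 0$ the germs $(X_0,0)$ and $(X_t,0)$ are not bi-Lipschitz homeomorphic with respect to the inner metric; that is, there is no germ of homeomorphism $(X_0,0)\to(X_t,0)$ which is bi-Lipschitz when $X_0$ and $X_t$ carry their inner metrics.
   Context: The inner metric on a connected subset $X\subset\mathbb{R}^n$ (here $\mathbb{C}^3=\mathbb{R}^6$), with $X$ semialgebraic, is $d_X(p,q)=\inf$ of the lengths of rectifiable arcs in $X$ joining $p$ to $q$. A map between metric spaces is bi-Lipschitz if it is a homeomorphism which is Lipschitz with Lipschitz inverse. A bi-Lipschitz homeomorphism of germs $(X,p)\to(Z,q)$ is given by a bi-Lipschitz homeomorphism from a neighborhood of $p$ in $X$ to a neighborhood of $q$ in $Z$ sending $p$ to $q$. *)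

theory Defs
  imports "HOL-Analysis.Analysis"
begin

section \<open>Length of paths\<close>

definition partition_sums :: "(real \<Rightarrow> 'a::metric_space) \<Rightarrow> real set" where
  "partition_sums g =
     {(\<Sum>i<n. dist (g (t i)) (g (t (Suc i)))) | (n::nat) (t::nat \<Rightarrow> real).
        t 0 = 0 \<and> t n = 1 \<and> mono_on {..n} t}"

definition rectifiable_path :: "(real \<Rightarrow> 'a::metric_space) \<Rightarrow> bool" where
  "rectifiable_path g \<longleftrightarrow> path g \<and> bdd_above (partition_sums g)"

definition path_length :: "(real \<Rightarrow> 'a::metric_space) \<Rightarrow> real" where
  "path_length g = Sup (partition_sums g)"

lemma partition_sumsI:
  "t 0 = 0 \<Longrightarrow> t n = 1 \<Longrightarrow> mono_on {..n} t \<Longrightarrow>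
     (\<Sum>i<n. dist (g (t i)) (g (t (Suc i)))) \<in> partition_sums g"
  unfolding partition_sums_def by blast

lemma partition_sumsE:
  assumes "s \<in> partition_sums g"
  obtains n t where "s = (\<Sum>i<n. dist (g (t i)) (g (t (Suc i))))"
    "t 0 = 0" "t n = 1" "mono_on {..n} t"
  using assms unfolding partition_sums_def by blast

lemma dist_endpoints_in_partition_sums: "dist (g 0) (g 1) \<in> partition_sums g"
  using partition_sumsI[of real 1 g] by (simp add: mono_on_def)

lemma partition_point:
  fixes t :: "nat \<Rightarrow> real"
  assumes "t 0 = 0" "t n = 1" "mono_on {..n} t" "i \<le> n"
  shows "0 \<le> t i" "t i \<le> 1"
  using mono_onD[OF assms(3), of 0 i] mono_onD[OF assms(3), of i n] assms by auto

lemma partition_sum_le_length: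
  "rectifiable_path g \<Longrightarrow> s \<in> partition_sums g \<Longrightarrow> s \<le> path_length g"
  unfolding rectifiable_path_def path_length_def by (auto intro: cSup_upper)

lemma dist_le_path_length: "rectifiable_path g \<Longrightarrow> dist (g 0) (g 1) \<le> path_length g"
  by (rule partition_sum_le_length[OF _ dist_endpoints_in_partition_sums])

lemma path_length_le:
  "(\<And>s. s \<in> partition_sums g \<Longrightarrow> s \<le> B) \<Longrightarrow> path_length g \<le> B"
  unfolding path_length_def using dist_endpoints_in_partition_sums by (blast intro: cSup_least)

lemma partition_sums_reversepath: "partition_sums (reversepath g) \<subseteq> partition_sums g"
proof
  fix s assume "s \<in> partition_sums (reversepath g)"
  then obtain n t where s: "s = (\<Sum>i<n. dist (reversepath g (t i)) (reversepath g (t (Suc i))))"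
    and t: "t 0 = 0" "t n = 1" "mono_on {..n} t"
    by (elim partition_sumsE)
  define u where "u i = 1 - t (n - i)" for i
  have "mono_on {..n} u"
    by (rule mono_onI) (use t(3) in \<open>auto simp: u_def intro!: mono_onD[of "{..n}" t]\<close>)
  moreover have "u 0 = 0" "u n = 1"
    by (simp_all add: u_def t(1,2))
  ultimately have "(\<Sum>i<n. dist (g (u i)) (g (u (Suc i)))) \<in> partition_sums g"
    by (intro partition_sumsI)
  also have "(\<Sum>i<n. dist (g (u i)) (g (u (Suc i)))) =
      (\<Sum>i<n. dist (g (u (n - Suc i))) (g (u (Suc (n - Suc i)))))"
    by (rule sum.nat_diff_reindex[symmetric])
  also have "\<dots> = s"
    unfolding s
    by (intro sum.cong refl) (auto simp: u_def reversepath_def dist_commute Suc_diff_Suc)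
  finally show "s \<in> partition_sums g" .
qed

lemma rectifiable_path_reversepath: "rectifiable_path g \<Longrightarrow> rectifiable_path (reversepath g)"
  unfolding rectifiable_path_def using bdd_above_mono[OF _ partition_sums_reversepath] by auto

lemma path_length_reversepath: "path_length (reversepath g) = path_length g"
proof -
  have "partition_sums (reversepath g) = partition_sums g"
    using partition_sums_reversepath[of g] partition_sums_reversepath[of "reversepath g"] by auto
  then show ?thesis
    by (simp add: path_length_def)
qed

lemma partition_sum_joinpaths_le:
  assumes g: "rectifiable_path g" and h: "rectifiable_path h" and "pathfinish g = pathstart h"
    and "s \<in> partition_sums (g +++ h)"
  shows "s \<le> path_length g + path_length h"
proof -
  have gh: "g 1 = h 0"
    using assms(3) by (simp add: pathfinish_def pathstart_def)
  obtain n t where s: "s = (\<Sum>i<n. dist ((g +++ h) (t i)) ((g +++ h) (t (Suc i))))"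
    and t: "t 0 = 0" "t n = 1" "mono_on {..n} t"
    using assms(4) by (elim partition_sumsE)
  define a where "a i = min 1 (2 * t i)" for i
  define b where "b i = max 0 (2 * t i - 1)" for i
  have mono: "mono_on {..n} a" "mono_on {..n} b"
    using t(3) by (fastforce simp: a_def b_def mono_on_def)+
  have step: "dist ((g +++ h) (t i)) ((g +++ h) (t (Suc i)))
      \<le> dist (g (a i)) (g (a (Suc i))) + dist (h (b i)) (h (b (Suc i)))" if "i < n" for i
  proof -
    have "t i \<le> t (Suc i)"
      using that by (intro mono_onD[OF t(3)]) auto
    then consider "t (Suc i) \<le> 1/2" "t i \<le> 1/2" | "t i > 1/2" "t (Suc i) > 1/2"
      | "t i \<le> 1/2" "t (Suc i) > 1/2"
      by linarith
    then show ?thesis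
    proof cases
      case 3
      then show ?thesis
        using dist_triangle[of "g (2 * t i)" "h (2 * t (Suc i) - 1)" "h 0"] gh
        by (simp add: a_def b_def joinpaths_def)
    qed (simp_all add: a_def b_def joinpaths_def)
  qed
  have "s \<le> (\<Sum>i<n. dist (g (a i)) (g (a (Suc i)))) + (\<Sum>i<n. dist (h (b i)) (h (b (Suc i))))"
    unfolding s sum.distrib[symmetric] by (rule sum_mono) (use step in auto)
  also have "\<dots> \<le> path_length g + path_length h"
    by (intro add_mono partition_sum_le_length g h partition_sumsI mono)
       (auto simp: a_def b_def t)
  finally show ?thesis .
qed

lemma rectifiable_path_joinpaths:
  assumes "rectifiable_path g" "rectifiable_path h" "pathfinish g = pathstart h"
  shows "rectifiable_path (g +++ h)"
    and "path_length (g +++ h) \<le> path_length g + path_length h"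
  using assms partition_sum_joinpaths_le[OF assms]
  by (auto simp: rectifiable_path_def intro!: bdd_aboveI path_length_le)

lemma partition_sum_lipschitz_le:
  assumes "L-lipschitz_on {0..1} g" "s \<in> partition_sums g"
  shows "s \<le> L"
proof -
  obtain n t where s: "s = (\<Sum>i<n. dist (g (t i)) (g (t (Suc i))))"
    and t: "t 0 = 0" "t n = 1" "mono_on {..n} t"
    using assms(2) by (elim partition_sumsE)
  have "s \<le> (\<Sum>i<n. L * (t (Suc i) - t i))"
    unfolding s
  proof (rule sum_mono)
    fix i assume "i \<in> {..<n}"
    then have i: "t i \<in> {0..1}" "t (Suc i) \<in> {0..1}" "t i \<le> t (Suc i)"
      using partition_point[OF t] by (auto intro!: mono_onD[OF t(3)])
    show "dist (g (t i)) (g (t (Suc i))) \<le> L * (t (Suc i) - t i)"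
      using lipschitz_onD[OF assms(1) i(1,2)] i(3) by (simp add: dist_real_def)
  qed
  also have "\<dots> = L"
    using t by (simp add: sum_distrib_left[symmetric] sum_lessThan_telescope)
  finally show ?thesis .
qed

lemma rectifiable_path_lipschitz:
  assumes "L-lipschitz_on {0..1} g"
  shows "rectifiable_path g"
  using assms partition_sum_lipschitz_le[OF assms] lipschitz_on_continuous_on[OF assms]
  by (auto simp: rectifiable_path_def path_def intro!: bdd_aboveI)


section \<open>The inner metric\<close>

definition rectifiable_paths_in :: "'a::metric_space set \<Rightarrow> 'a \<Rightarrow> 'a \<Rightarrow> (real \<Rightarrow> 'a) set" where
  "rectifiable_paths_in X p q =
     {g. rectifiable_path g \<and> path_image g \<subseteq> X \<and> pathstart g = p \<and> pathfinish g = q}"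

text \<open>
  The value 0 off \<open>X\<close> only serves the convention of \<^locale>\<open>Metric_space\<close> that the
  distance function is nonnegative on the whole type.
\<close>

definition inner_dist :: "'a::metric_space set \<Rightarrow> 'a \<Rightarrow> 'a \<Rightarrow> real" where
  "inner_dist X p q =
     (if p \<in> X \<and> q \<in> X then (INF g\<in>rectifiable_paths_in X p q. path_length g) else 0)"

text \<open>
  This is meaningful when any two points of \<open>X\<close> are joined by a rectifiable path in \<open>X\<close>
  (always the case for connected semialgebraic \<open>X\<close>); see \<open>Metric_space_inner_dist\<close>.
\<close>

definition inner_metric :: "'a::metric_space set \<Rightarrow> 'a metric" where
  "inner_metric X = metric (X, inner_dist X)"

lemma reversepath_in_paths:
  "g \<in> rectifiable_paths_in X p q \<Longrightarrow> reversepath g \<in> rectifiable_paths_in X q p"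
  by (auto simp: rectifiable_paths_in_def rectifiable_path_reversepath)

lemma joinpaths_in_paths:
  "g \<in> rectifiable_paths_in X p q \<Longrightarrow> h \<in> rectifiable_paths_in X q r \<Longrightarrow>
     g +++ h \<in> rectifiable_paths_in X p r"
  by (auto simp: rectifiable_paths_in_def rectifiable_path_joinpaths path_image_join)

lemma dist_le_length_in_paths:
  "g \<in> rectifiable_paths_in X p q \<Longrightarrow> dist p q \<le> path_length g"
  using dist_le_path_length by (fastforce simp: rectifiable_paths_in_def pathstart_def pathfinish_def)

lemma bdd_below_lengths: "bdd_below (path_length ` rectifiable_paths_in X p q)"
  using dist_le_length_in_paths by (fastforce intro: bdd_belowI)

lemma Metric_space_inner_dist:
  fixes X :: "'a::metric_space set"
  assumes conn: "\<And>p q. p \<in> X \<Longrightarrow> q \<in> X \<Longrightarrow> rectifiable_paths_in X p q \<noteq> {}"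
  shows "Metric_space X (inner_dist X)"
proof -
  have dist_le: "dist p q \<le> inner_dist X p q" if "p \<in> X" "q \<in> X" for p q
    using that conn[OF that] dist_le_length_in_paths
    by (auto simp: inner_dist_def intro!: cINF_greatest)
  have le_length: "inner_dist X p q \<le> path_length g" if "g \<in> rectifiable_paths_in X p q"
    "p \<in> X" "q \<in> X" for p q g
    using that by (auto simp: inner_dist_def intro!: cINF_lower bdd_below_lengths)
  have le: "inner_dist X q p \<le> inner_dist X p q" if "p \<in> X" "q \<in> X" for p q
  proof -
    have "inner_dist X q p \<le> path_length g" if "g \<in> rectifiable_paths_in X p q" for g
      using le_length[OF reversepath_in_paths[OF that]] \<open>p \<in> X\<close> \<open>q \<in> X\<close>
      by (simp add: path_length_reversepath)
    then have "inner_dist X q p \<le> (INF g\<in>rectifiable_paths_in X p q. path_length g)"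
      by (intro cINF_greatest conn that)
    then show ?thesis
      using that by (simp add: inner_dist_def)
  qed
  have refl: "inner_dist X p p \<le> 0" if "p \<in> X" for p
  proof -
    have "0-lipschitz_on {0..1} (\<lambda>_::real. p)"
      by (simp add: lipschitz_on_def)
    then have "rectifiable_path (\<lambda>_. p)" "path_length (\<lambda>_. p) \<le> 0"
      by (auto intro: rectifiable_path_lipschitz path_length_le partition_sum_lipschitz_le)
    moreover from this have "(\<lambda>_. p) \<in> rectifiable_paths_in X p p"
      using that by (auto simp: rectifiable_paths_in_def path_image_def pathstart_def pathfinish_def)
    ultimately show ?thesis
      using le_length[of "\<lambda>_. p" p p] that by simp
  qed
  show ?thesis
  proof
    fix x y
    show "0 \<le> inner_dist X x y"
    proof (cases "x \<in> X \<and> y \<in> X")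
      case True
      then show ?thesis
        using dist_le[of x y] order_trans[OF zero_le_dist] by blast
    qed (auto simp: inner_dist_def)
    show "inner_dist X x y = inner_dist X y x"
      using le[of x y] le[of y x]
      by (cases "x \<in> X \<and> y \<in> X") (auto simp: inner_dist_def)
  next
    fix x y assume "x \<in> X" "y \<in> X"
    then show "inner_dist X x y = 0 \<longleftrightarrow> x = y"
      using dist_le[of x y] dist_le[of x x] refl[of x] by auto
  next
    fix x y z assume X: "x \<in> X" "y \<in> X" "z \<in> X"
    have "inner_dist X x z \<le> path_length g + path_length h"
      if g: "g \<in> rectifiable_paths_in X x y" and h: "h \<in> rectifiable_paths_in X y z" for g h
    proof -
      have "path_length (g +++ h) \<le> path_length g + path_length h"
        using g h by (intro rectifiable_path_joinpaths) (auto simp: rectifiable_paths_in_def)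
      then show ?thesis
        using le_length[OF joinpaths_in_paths[OF g h]] X by linarith
    qed
    then have "inner_dist X x z - path_length g \<le> path_length h"
      if "g \<in> rectifiable_paths_in X x y" "h \<in> rectifiable_paths_in X y z" for g h
      using that by (simp add: diff_le_eq add.commute)
    then have "inner_dist X x z - path_length g \<le> inner_dist X y z"
      if "g \<in> rectifiable_paths_in X x y" for g
      using X conn[of y z] that by (subst (2) inner_dist_def) (auto intro!: cINF_greatest)
    then have "inner_dist X x z - inner_dist X y z \<le> path_length g"
      if "g \<in> rectifiable_paths_in X x y" for g
      using that by (simp add: diff_le_eq add.commute)
    then have "inner_dist X x z - inner_dist X y z \<le> inner_dist X x y"
      using X conn[of x y] by (subst (3) inner_dist_def) (auto intro!: cINF_greatest)
    then show "inner_dist X x z \<le> inner_dist X x y + inner_dist X y z"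
      by simp
  qed
qed


section \<open>Bi-Lipschitz homeomorphisms of germs\<close>

definition bilipschitz_homeomorphism :: "'a metric \<Rightarrow> 'b metric \<Rightarrow> ('a \<Rightarrow> 'b) \<Rightarrow> bool" where
  "bilipschitz_homeomorphism m m' f \<longleftrightarrow>
     (\<exists>g. homeomorphic_maps (mtopology_of m) (mtopology_of m') f g \<and>
          Lipschitz_continuous_map m m' f \<and> Lipschitz_continuous_map m' m g)"

definition neighborhood_in :: "'a metric \<Rightarrow> 'a \<Rightarrow> 'a set \<Rightarrow> bool" where
  "neighborhood_in m p U \<longleftrightarrow>
     U \<subseteq> mspace m \<and> (\<exists>W. openin (mtopology_of m) W \<and> p \<in> W \<and> W \<subseteq> U)"

definition bilipschitz_homeomorphic_germs :: "'a metric \<Rightarrow> 'a \<Rightarrow> 'b metric \<Rightarrow> 'b \<Rightarrow> bool" where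
  "bilipschitz_homeomorphic_germs m p m' q \<longleftrightarrow>
     (\<exists>U V f. neighborhood_in m p U \<and> neighborhood_in m' q V \<and>
        bilipschitz_homeomorphism (submetric m U) (submetric m' V) f \<and> f p = q)"


section \<open>The family of surfaces\<close>

text \<open>
  The product metric on \<^typ>\<open>complex \<times> complex \<times> complex\<close> is the Euclidean one of
  real dimension 6.
\<close>

definition surface :: "complex \<Rightarrow> (complex \<times> complex \<times> complex) set" where
  "surface t = {(x, y, z). x^5 + z^15 + y^7 * z + t * x * y^6 = 0}"

text \<open>
  The defining polynomial is weighted homogeneous with weights (3, 2, 1), so every point of a
  surface is joined to the origin by a rectifiable path; the inner metric is therefore a genuine
  metric on the surface.
\<close>

lemma origin_path_in_surface:
  assumes "p \<in> surface t"
  shows "rectifiable_paths_in (surface t) 0 p \<noteq> {}"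
proof -
  obtain x y z where p: "p = (x, y, z)" by (cases p)
  define g :: "real \<Rightarrow> complex \<times> complex \<times> complex" where
    "g s = (of_real s ^ 3 * x, of_real s ^ 2 * y, of_real s * z)" for s
  have eq: "x^5 + z^15 + y^7 * z + t * x * y^6 = 0"
    using assms by (simp add: surface_def p)
  have "g s \<in> surface t" for s
  proof -
    have "(of_real s ^ 3 * x)^5 + (of_real s * z)^15 + (of_real s ^ 2 * y)^7 * (of_real s * z)
        + t * (of_real s ^ 3 * x) * (of_real s ^ 2 * y)^6
        = of_real s ^ 15 * (x^5 + z^15 + y^7 * z + t * x * y^6)"
      by algebra
    then show ?thesis
      by (simp add: eq surface_def g_def)
  qed
  moreover have "\<exists>L. L-lipschitz_on {0..1} g"
  proof -
    define g' where "g' s = (3 * of_real s ^ 2 * x, 2 * of_real s * y, z)" for s :: real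
    have deriv: "(g has_vector_derivative g' s) (at s within {0..1})" for s
      unfolding g_def g'_def
      by (intro has_vector_derivative_Pair; rule has_vector_derivative_real_field)
         (auto intro!: derivative_eq_intros)
    have "compact (g' ` {0..1})"
      unfolding g'_def by (intro compact_continuous_image continuous_intros) auto
    then obtain B where B: "\<forall>v\<in>g' ` {0..1}. norm v \<le> B"
      by (meson bounded_iff compact_imp_bounded)
    have "B \<ge> 0"
      using B norm_ge_zero[of "g' 0"] by (meson atLeastAtMost_iff imageI order.trans order_refl zero_le_one)
    have "B-lipschitz_on {0..1} g"
    proof (rule bounded_derivative_imp_lipschitz)
      show "(g has_derivative (\<lambda>h. h *\<^sub>R g' s)) (at s within {0..1})" for s
        using deriv by (simp add: has_vector_derivative_def)
      show "onorm (\<lambda>h. h *\<^sub>R g' s) \<le> B" if "s \<in> {0..1}" for s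
      proof (rule onorm_le)
        fix h :: real
        have "norm (g' s) \<le> B"
          using B that by blast
        then show "norm (h *\<^sub>R g' s) \<le> B * norm h"
          by (simp add: mult.commute[of B] mult_left_mono)
      qed
    qed (use \<open>B \<ge> 0\<close> in auto)
    then show ?thesis by blast
  qed
  then have "rectifiable_path g"
    using rectifiable_path_lipschitz by blast
  moreover have "pathstart g = 0" "pathfinish g = p"
    by (simp_all add: pathstart_def pathfinish_def g_def p zero_prod_def)
  ultimately have "g \<in> rectifiable_paths_in (surface t) 0 p"
    by (auto simp: rectifiable_paths_in_def path_image_def)
  then show ?thesis by blast
qed

lemma Metric_space_inner_dist_surface: "Metric_space (surface t) (inner_dist (surface t))"
proof (rule Metric_space_inner_dist)
  fix p q assume "p \<in> surface t" "q \<in> surface t"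
  then obtain g h where "g \<in> rectifiable_paths_in (surface t) 0 p"
    "h \<in> rectifiable_paths_in (surface t) 0 q"
    using origin_path_in_surface by blast
  then show "rectifiable_paths_in (surface t) p q \<noteq> {}"
    using joinpaths_in_paths reversepath_in_paths by blast
qed

lemma inner_metric_surface [simp]:
  "mspace (inner_metric (surface t)) = surface t"
  "mdist (inner_metric (surface t)) = inner_dist (surface t)"
  using Metric_space_inner_dist_surface
  by (simp_all add: inner_metric_def Metric_space.mspace_metric Metric_space.mdist_metric)

end

theory Submission
  imports Defs
begin

text \<open>
  For \<open>t \<noteq> 0\<close> the curve \<open>{z = 0}\<close> of the surface has several branches, and near one of them, where
  \<open>x\<close> is the small root of \<open>x\<^sup>5 + t x y\<^sup>6 + (z\<^sup>1\<^sup>5 + y\<^sup>7 z) = 0\<close>, the surface is a graph over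
  \<open>{|z|\<^sup>2 \<le> \<rho>\<^sup>2 |y|}\<close>. The boundary \<open>{|z|\<^sup>2 = \<rho>\<^sup>2 |y|}\<close> of this graph separates the points
  \<open>(0, r, 0)\<close> and \<open>(a r\<^sup>3\<^sup>/\<^sup>2, r, 0)\<close>, \<open>a\<^sup>4 = - t\<close>, stays at distance of order \<open>r\<close> from both, and
  is thin: as \<open>|y|\<close> is of order \<open>r\<^sup>2\<close> on it, at scale \<open>r\<close> it is covered by about \<open>\<epsilon>\<^sup>-\<^sup>2\<close> inner balls
  of radius \<open>\<epsilon> r\<close>.

  For \<open>t = 0\<close> the part of the surface at scale \<open>r\<close> away from the axes is parametrised, with
  constants independent of \<open>r\<close> after rescaling, by a box in logarithmic coordinates of real
  dimension 4, and every point at scale \<open>r\<close> is within a small multiple of \<open>r\<close> of that part. So the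
  preimages of the two points under a bi-Lipschitz map are joined by about \<open>\<epsilon>\<^sup>-\<^sup>3\<close> parallel segments
  at distance of order \<open>\<epsilon> r\<close> from each other. The images of all of them must cross the wall, and
  for small \<open>\<epsilon>\<close> two of them cross it in the same inner ball.
\<close>

section \<open>Inner distance estimates\<close>

text \<open>For y and z of order r there are five values of x. If t = 0, they are close to the fifth
  roots of - y^7 z, and turning z once around 0 permutes them cyclically: all sheets lie in one
  connected chart of fixed size. If t \<noteq> 0, the term t x y^6 dominates y^7 z: four roots have
  order r^(3/2), one has order r^2, and the small one stays isolated until z / y^(1/2) is of order
  1, that is, until |y| has dropped to order r^2. That is where the wall stands. All these values of
  x vanish faster than r, so Euclidean distances at scale r do not tell the sheets apart; what
  differs is how the sheets are connected. This is turned into a count. The wall has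
  \<open>z\<close> and one angle as coordinates, but the angle costs only a length of order r^2,
  which leaves two real dimensions, while a segment in a box of dimension 4 can be shifted in three
  directions. The count fixes \<epsilon> from constants that do not involve r; r is taken small
  afterwards, so that the errors of order r^2 are below \<epsilon> r.\<close>

lemma inner_dist_le_length:
  assumes "g \<in> rectifiable_paths_in X p q" "p \<in> X" "q \<in> X"
  shows "inner_dist X p q \<le> path_length g"
  using assms by (auto simp: inner_dist_def intro!: cINF_lower bdd_below_lengths)

lemma inner_dist_le_lipschitz:
  fixes g :: "real \<Rightarrow> 'a::metric_space"
  assumes "L-lipschitz_on {0..1} g" "\<And>s. s \<in> {0..1} \<Longrightarrow> g s \<in> X"
  shows "inner_dist X (g 0) (g 1) \<le> L"
proof -
  have "g \<in> rectifiable_paths_in X (g 0) (g 1)"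
    using assms rectifiable_path_lipschitz[OF assms(1)]
    by (auto simp: rectifiable_paths_in_def path_image_def pathstart_def pathfinish_def)
  moreover have "path_length g \<le> L"
    by (intro path_length_le partition_sum_lipschitz_le[OF assms(1)])
  ultimately show ?thesis
    using inner_dist_le_length[of g X "g 0" "g 1"] assms(2) by fastforce
qed

lemma norm_triple_le: "norm (x, y, z) \<le> norm x + norm y + norm z"
  using norm_Pair_le[of x "(y, z)"] norm_Pair_le[of y z] by linarith

lemma norm_triple_ge:
  "norm x \<le> norm (x, y, z)" "norm y \<le> norm (x, y, z)" "norm z \<le> norm (x, y, z)"
proof -
  show "norm x \<le> norm (x, y, z)" using norm_fst_le[of x "(y, z)"] by simp
  have "norm (y, z) \<le> norm (x, y, z)" using norm_snd_le[of "(y, z)" x] by simp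
  then show "norm y \<le> norm (x, y, z)" "norm z \<le> norm (x, y, z)"
    using norm_fst_le[of y z] norm_snd_le[of z y] by auto
qed

lemma lipschitz_on_triple:
  fixes a :: "real \<Rightarrow> 'a::real_normed_vector" and b :: "real \<Rightarrow> 'b::real_normed_vector"
    and c :: "real \<Rightarrow> 'c::real_normed_vector"
  assumes "A-lipschitz_on S a" "B-lipschitz_on S b" "C-lipschitz_on S c"
  shows "(A + B + C)-lipschitz_on S (\<lambda>s. (a s, b s, c s))"
proof (rule lipschitz_onI)
  fix s s' assume s: "s \<in> S" "s' \<in> S"
  have "dist (a s, b s, c s) (a s', b s', c s') \<le> dist (a s) (a s') + dist (b s) (b s') + dist (c s) (c s')"
    using norm_triple_le[of "a s - a s'" "b s - b s'" "c s - c s'"] by (simp add: dist_norm)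
  also have "\<dots> \<le> A * dist s s' + B * dist s s' + C * dist s s'"
    using assms s by (intro add_mono lipschitz_onD) auto
  finally show "dist (a s, b s, c s) (a s', b s', c s') \<le> (A + B + C) * dist s s'"
    by (simp add: algebra_simps)
qed (use assms in \<open>auto simp: lipschitz_on_def\<close>)

text \<open>Every explicit curve below is measured by this, coordinate by coordinate; a constant
  coordinate contributes 0.\<close>

lemma inner_dist_le_lipschitz_interval:
  fixes x y z :: "real \<Rightarrow> complex"
  assumes "A-lipschitz_on {l..h} x" "B-lipschitz_on {l..h} y" "C-lipschitz_on {l..h} z"
    and X: "\<And>s. s \<in> {l..h} \<Longrightarrow> (x s, y s, z s) \<in> X" and "l \<le> h"
  shows "inner_dist X (x l, y l, z l) (x h, y h, z h) \<le> (A + B + C) * (h - l)"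
proof -
  let ?c = "\<lambda>s. l + s * (h - l)"
  let ?g = "\<lambda>s. (x s, y s, z s)"
  have c: "?c s \<in> {l..h}" if "s \<in> {0..1}" for s
    using that assms(5) mult_left_le_one_le[of "h - l" s] by auto
  have "(A + B + C)-lipschitz_on {l..h} ?g"
    by (intro lipschitz_on_triple assms)
  then have 1: "(A + B + C)-lipschitz_on (?c ` {0..1}) ?g"
    by (rule lipschitz_on_subset) (use c in auto)
  have 2: "(h - l)-lipschitz_on {0..1} ?c"
    by (rule lipschitz_onI)
       (use assms(5) in \<open>auto simp: dist_real_def left_diff_distrib[symmetric] abs_mult mult.commute\<close>)
  have "((A + B + C) * (h - l))-lipschitz_on {0..1} (?g \<circ> ?c)"
    by (rule lipschitz_on_compose[OF 2 1])
  then have "inner_dist X ((?g \<circ> ?c) 0) ((?g \<circ> ?c) 1) \<le> (A + B + C) * (h - l)"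
    by (rule inner_dist_le_lipschitz) (use X c in auto)
  then show ?thesis by simp
qed

lemma lipschitz_on_vector_derivative_bound:
  fixes f :: "real \<Rightarrow> 'a::real_normed_vector"
  assumes "\<And>s. s \<in> {l..h} \<Longrightarrow> (f has_vector_derivative f' s) (at s within {l..h})"
    and "\<And>s. s \<in> {l..h} \<Longrightarrow> norm (f' s) \<le> B" and "0 \<le> B"
  shows "B-lipschitz_on {l..h} f"
proof (rule bounded_derivative_imp_lipschitz)
  show "(f has_derivative (\<lambda>k. k *\<^sub>R f' s)) (at s within {l..h})" if "s \<in> {l..h}" for s
    using assms(1)[OF that] by (simp add: has_vector_derivative_def)
  show "onorm (\<lambda>k. k *\<^sub>R f' s) \<le> B" if "s \<in> {l..h}" for s
  proof (rule onorm_le)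
    fix k :: real
    show "norm (k *\<^sub>R f' s) \<le> B * norm k"
      using assms(2)[OF that] by (simp add: mult.commute[of B] mult_left_mono)
  qed
qed (use assms in auto)

context
  fixes t :: complex
begin

interpretation M: Metric_space "surface t" "inner_dist (surface t)"
  by (rule Metric_space_inner_dist_surface)

lemmas inner_dist_surface_triangle = M.triangle

lemma short_path_in_surface:
  assumes "p \<in> surface t" "q \<in> surface t" "inner_dist (surface t) p q < e"
  obtains g where "g \<in> rectifiable_paths_in (surface t) p q" "path_length g < e"
proof -
  have "rectifiable_paths_in (surface t) p q \<noteq> {}"
    using origin_path_in_surface[OF assms(1)] origin_path_in_surface[OF assms(2)]
      joinpaths_in_paths reversepath_in_paths by blast
  then show ?thesis
    using assms that
    by (auto simp: inner_dist_def cINF_less_iff bdd_below_lengths)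
qed

lemma dist_le_inner_dist:
  assumes "p \<in> surface t" "q \<in> surface t"
  shows "dist p q \<le> inner_dist (surface t) p q"
proof (rule ccontr)
  assume "\<not> ?thesis"
  then obtain g where "g \<in> rectifiable_paths_in (surface t) p q" "path_length g < dist p q"
    using short_path_in_surface[OF assms, of "dist p q"] by auto
  then show False using dist_le_length_in_paths by fastforce
qed

end

text \<open>Refine the trivial partition by \<open>s\<close>. A path of length below
  \<open>r / 2\<close> thus stays in a Euclidean ball around its start.\<close>

lemma dist_path_le_length:
  assumes "rectifiable_path g" "s \<in> {0..1}"
  shows "dist (g 0) (g s) \<le> path_length g" "dist (g s) (g 1) \<le> path_length g"
proof -
  let ?t = "\<lambda>i::nat. if i = 0 then 0 else if i = 1 then s else (1::real)"
  have "(\<Sum>i<2. dist (g (?t i)) (g (?t (Suc i)))) \<in> partition_sums g"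
    using assms(2) by (intro partition_sumsI) (auto simp: mono_on_def)
  then have "(\<Sum>i<2. dist (g (?t i)) (g (?t (Suc i)))) \<le> path_length g"
    by (rule partition_sum_le_length[OF assms(1)])
  then have "dist (g 0) (g s) + dist (g s) (g 1) \<le> path_length g"
    by (simp add: numeral_2_eq_2)
  then show "dist (g 0) (g s) \<le> path_length g" "dist (g s) (g 1) \<le> path_length g"
    using zero_le_dist[of "g 0" "g s"] zero_le_dist[of "g s" "g 1"] by linarith+
qed

lemma zero_in_surface [simp]: "0 \<in> surface t"
  by (simp add: surface_def zero_prod_def)

lemma weighted_scaling_in_surface:
  assumes "(x, y, z) \<in> surface t"
  shows "(c ^ 3 * x, c ^ 2 * y, c * z) \<in> surface t"
proof -
  have "(c ^ 3 * x)^5 + (c * z)^15 + (c ^ 2 * y)^7 * (c * z) + t * (c ^ 3 * x) * (c ^ 2 * y)^6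
      = c ^ 15 * (x^5 + z^15 + y^7 * z + t * x * y^6)"
    by algebra
  then show ?thesis using assms by (simp add: surface_def)
qed

lemma lipschitz_on_power_scaled:
  assumes "0 \<le> m"
  shows "(of_nat k * m ^ (k - 1) * norm c)-lipschitz_on {0..m} (\<lambda>s. of_real s ^ k * (c::complex))"
proof (rule lipschitz_on_vector_derivative_bound[where f' = "\<lambda>s. of_nat k * of_real s ^ (k - 1) * c"])
  fix s assume s: "s \<in> {0..m}"
  show "((\<lambda>s. complex_of_real s ^ k * c) has_vector_derivative of_nat k * of_real s ^ (k - 1) * c)
      (at s within {0..m})"
    by (rule has_vector_derivative_real_field) (auto intro!: derivative_eq_intros)
  show "norm (of_nat k * complex_of_real s ^ (k - 1) * c) \<le> of_nat k * m ^ (k - 1) * norm c"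
    using s by (auto simp: norm_mult norm_power intro!: mult_right_mono mult_left_mono power_mono)
qed (use assms in auto)

text \<open>The curve is the weighted dilation \<open>(s^3 * x, s^2 * y, s * z)\<close>, with s from
  0 to 1; the factors 3, 2, 1 are the weights.\<close>

lemma inner_dist_origin_le:
  assumes "(x, y, z) \<in> surface t"
  shows "inner_dist (surface t) 0 (x, y, z) \<le> 3 * norm x + 2 * norm y + norm z"
proof -
  have "inner_dist (surface t) (of_real 0 ^ 3 * x, of_real 0 ^ 2 * y, of_real 0 ^ 1 * z)
      (of_real 1 ^ 3 * x, of_real 1 ^ 2 * y, of_real 1 ^ 1 * z)
    \<le> (of_nat 3 * 1 ^ (3 - 1) * norm x + of_nat 2 * 1 ^ (2 - 1) * norm y
        + of_nat 1 * 1 ^ (1 - 1) * norm z) * (1 - 0)"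
    by (intro inner_dist_le_lipschitz_interval lipschitz_on_power_scaled)
       (use weighted_scaling_in_surface[OF assms] in auto)
  then show ?thesis by (simp add: zero_prod_def)
qed

section \<open>Parallel segments and the pigeonhole principle\<close>

lemma floor_eq_imp_close:
  fixes x y c :: real
  assumes "\<lfloor>x / c\<rfloor> = \<lfloor>y / c\<rfloor>" "c > 0"
  shows "\<bar>x - y\<bar> \<le> c"
proof -
  have "\<bar>x / c - y / c\<bar> \<le> 1" using assms(1) by linarith
  then have "\<bar>(x - y) / c\<bar> \<le> 1" by (simp add: diff_divide_distrib)
  then show ?thesis using assms(2) by (simp add: abs_divide)
qed

text \<open>
  A set of complex numbers of size \<open>Z\<close> needs only about \<open>(Z / \<epsilon>)\<^sup>2\<close> cells of size \<open>\<epsilon>\<close>, whereas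
  there are about \<open>(\<eta> / \<epsilon>)\<^sup>3\<close> parallel segments in the tube that are \<open>\<epsilon>\<close> apart from each other.
\<close>

lemma parallel_segments_pigeonhole:
  fixes L Z \<eta> D :: real
  assumes pos: "L > 0" "Z > 0" "\<eta> > 0" "D > 0"
  obtains \<epsilon> where "\<epsilon> > 0"
    "\<And>(a::real^4) b (s::real^4 \<Rightarrow> real) (\<zeta>::real^4 \<Rightarrow> complex).
       \<lbrakk>\<And>i. \<bar>a $ i\<bar> \<le> L; \<And>i. \<bar>b $ i\<bar> \<le> L;
        \<And>w. (\<And>i. \<bar>w $ i\<bar> \<le> \<eta>) \<Longrightarrow> s w \<in> {0..1} \<and> norm (\<zeta> w) \<le> Z\<rbrakk> \<Longrightarrow>
       \<exists>w w'. (\<forall>i. \<bar>w $ i\<bar> \<le> \<eta>) \<and> (\<forall>i. \<bar>w' $ i\<bar> \<le> \<eta>) \<and> norm (\<zeta> w - \<zeta> w') \<le> \<epsilon> \<and>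
         (\<forall>i. \<bar>(a + w + s w *\<^sub>R (b - a)) $ i - (a + w' + s w' *\<^sub>R (b - a)) $ i\<bar> \<le> 1/8) \<and>
         (\<exists>i. \<bar>(a + w + s w *\<^sub>R (b - a)) $ i - (a + w' + s w' *\<^sub>R (b - a)) $ i\<bar> > D * \<epsilon>)"
proof -
  obtain P :: nat where P: "6 * Z * D / \<eta> + 2 \<le> real P" using real_arch_simple by blast
  then have P1: "P \<ge> 1" using pos by (smt (verit, best) divide_nonneg_nonneg mult_nonneg_nonneg of_nat_le_iff of_nat_1)
  obtain N :: nat where N: "8 * (L + \<eta>) + 1 \<le> real N" using real_arch_simple by blast
  \<comment> \<open>Three directions with \<open>n\<close> shifts each give \<open>n^3\<close>
    segments, against at most \<open>(3 * n * P)^2 * (2 * N + 1)^4 = n^2 * (n - 1)\<close> cells.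
    The choice of \<epsilon> makes \<open>3 * D * \<epsilon>\<close> the grid spacing
    \<open>\<eta> / n\<close>.\<close>
  define n where "n = 9 * P\<^sup>2 * (2 * N + 1) ^ 4 + 1"
  define \<epsilon> where "\<epsilon> = \<eta> / (3 * real n * D)"
  have n: "n > 0" by (simp add: n_def)
  have \<epsilon>: "\<epsilon> > 0" using pos n by (simp add: \<epsilon>_def)
  have D\<epsilon>: "3 * (D * \<epsilon>) = \<eta> / n" using pos n by (simp add: \<epsilon>_def field_simps)
  have bound: "2 * Z / \<epsilon> + 1 \<le> real (n * P)"
  proof -
    have "2 * Z / \<epsilon> + 1 \<le> real n * (6 * Z * D / \<eta>) + real n * 2"
      using pos n by (simp add: \<epsilon>_def field_simps)
    also have "\<dots> \<le> real n * real P" using mult_left_mono[OF P, of "real n"] by (simp add: distrib_left)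
    finally show ?thesis by simp
  qed
  show ?thesis
  proof (rule that[OF \<epsilon>])
    fix a b :: "real^4" and s :: "real^4 \<Rightarrow> real" and \<zeta> :: "real^4 \<Rightarrow> complex"
    assume a: "\<And>i. \<bar>a $ i\<bar> \<le> L" and b: "\<And>i. \<bar>b $ i\<bar> \<le> L"
      and s: "\<And>w. (\<And>i. \<bar>w $ i\<bar> \<le> \<eta>) \<Longrightarrow> s w \<in> {0..1} \<and> norm (\<zeta> w) \<le> Z"
    define c where "c w = a + w + s w *\<^sub>R (b - a)" for w
    \<comment> \<open>Shifts are made only in the coordinates other than the one where
      \<open>b - a\<close> is largest: a shift along the segment could be undone by the choice of
      \<open>s\<close>.\<close>
    obtain i0 where i0: "\<And>i. \<bar>(b - a) $ i\<bar> \<le> \<bar>(b - a) $ i0\<bar>"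
    proof -
      let ?M = "Max (range (\<lambda>i. \<bar>(b - a) $ i\<bar>))"
      have "?M \<in> range (\<lambda>i. \<bar>(b - a) $ i\<bar>)" by (rule Max_in) auto
      then obtain i0 where "?M = \<bar>(b - a) $ i0\<bar>" by (rule rangeE)
      moreover have "\<bar>(b - a) $ i\<bar> \<le> ?M" for i by (rule Max_ge) auto
      ultimately show ?thesis using that[of i0] by simp
    qed
    define K where "K = PiE (UNIV - {i0}) (\<lambda>_. {..<n})"
    define w where "w k = (\<chi> i. if i = i0 then 0 else \<eta> * real (k i) / real n)" for k :: "4 \<Rightarrow> nat"
    have w_small: "\<bar>w k $ i\<bar> \<le> \<eta>" if "k \<in> K" for k i
    proof (cases "i = i0")
      case False
      then have "k i < n" using that by (auto simp: K_def)
      then show ?thesis using pos n False by (simp add: w_def field_simps)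
    qed (use pos in \<open>simp add: w_def\<close>)
    have w_inj: "k = k'" if "k \<in> K" "k' \<in> K" "\<And>i. \<bar>w k $ i - w k' $ i\<bar> < \<eta> / n" for k k'
    proof (rule PiE_ext[OF that(1,2)[unfolded K_def]])
      fix i assume i: "i \<in> UNIV - {i0}"
      have "w k $ i - w k' $ i = (\<eta> / n) * (real (k i) - real (k' i))"
        using i by (simp add: w_def field_simps diff_divide_distrib)
      then have "(\<eta> / n) * \<bar>real (k i) - real (k' i)\<bar> < (\<eta> / n) * 1"
        using that(3)[of i] pos n by (simp add: abs_mult)
      then have "\<bar>real (k i) - real (k' i)\<bar> < 1"
        by (rule mult_left_less_imp_less) (use pos in auto)
      then show "k i = k' i" by linarith
    qed
    \<comment> \<open>Positions \<zeta> go to squares of side \<open>\<epsilon> / 2\<close>, points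
      of the segments to cubes of side 1/8. The number of cubes does not grow as \<epsilon> shrinks,
      so they leave the exponent alone; they keep a pair within the range where the logarithmic
      chart is injective.\<close>
    define key where "key k = (\<lfloor>Re (\<zeta> (w k)) / (\<epsilon> / 2)\<rfloor>, \<lfloor>Im (\<zeta> (w k)) / (\<epsilon> / 2)\<rfloor>,
      (\<lambda>i::4. \<lfloor>c (w k) $ i / (1/8)\<rfloor>))" for k
    define I where "I = {- int (n * P)..int (n * P)}"
    define J where "J = PiE (UNIV::4 set) (\<lambda>_. {- int N..int N})"
    have "key k \<in> I \<times> I \<times> J" if k: "k \<in> K" for k
    proof -
      have sk: "s (w k) \<in> {0..1}" "norm (\<zeta> (w k)) \<le> Z" using s[of "w k"] w_small[OF k] by auto
      have cI: "\<lfloor>x / (\<epsilon> / 2)\<rfloor> \<in> I" if "\<bar>x\<bar> \<le> Z" for x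
      proof -
        have "\<bar>x / (\<epsilon> / 2)\<bar> \<le> 2 * Z / \<epsilon>" using that \<epsilon> by (simp add: field_simps)
        then show ?thesis using bound unfolding I_def atLeastAtMost_iff by linarith
      qed
      have "\<bar>c (w k) $ i\<bar> \<le> L + \<eta>" for i
      proof -
        have "\<bar>a $ i + s (w k) * (b $ i - a $ i)\<bar> \<le> L"
        proof -
          have "a $ i + s (w k) * (b $ i - a $ i) = (1 - s (w k)) * a $ i + s (w k) * b $ i"
            by (simp add: algebra_simps)
          moreover have "\<bar>\<dots>\<bar> \<le> (1 - s (w k)) * \<bar>a $ i\<bar> + s (w k) * \<bar>b $ i\<bar>"
            using sk by (intro order_trans[OF abs_triangle_ineq]) (simp add: abs_mult)
          moreover have "\<dots> \<le> (1 - s (w k)) * L + s (w k) * L"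
            using sk a b by (intro add_mono mult_left_mono) auto
          ultimately show ?thesis by (simp add: algebra_simps)
        qed
        then show ?thesis using w_small[OF k, of i] by (simp add: c_def)
      qed
      then have "\<lfloor>c (w k) $ i / (1/8)\<rfloor> \<in> {- int N..int N}" for i
        unfolding atLeastAtMost_iff
      proof -
        fix i assume *: "\<And>i. \<bar>c (w k) $ i\<bar> \<le> L + \<eta>"
        have "\<bar>c (w k) $ i / (1/8)\<bar> + 1 \<le> real N" using N *[of i] by simp
        then show "- int N \<le> \<lfloor>c (w k) $ i / (1/8)\<rfloor> \<and> \<lfloor>c (w k) $ i / (1/8)\<rfloor> \<le> int N"
          by linarith
      qed
      then have "(\<lambda>i::4. \<lfloor>c (w k) $ i / (1/8)\<rfloor>) \<in> J"
        by (auto simp: J_def PiE_iff)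
      moreover have "\<bar>Re (\<zeta> (w k))\<bar> \<le> Z" "\<bar>Im (\<zeta> (w k))\<bar> \<le> Z"
        using sk abs_Re_le_cmod abs_Im_le_cmod order_trans by blast+
      ultimately show ?thesis using cI by (auto simp: key_def)
    qed
    then have "key ` K \<subseteq> I \<times> I \<times> J" by (rule image_subsetI)
    moreover have fin: "finite (I \<times> I \<times> J)" unfolding I_def J_def
      by (intro finite_cartesian_product finite_PiE) auto
    ultimately have "card (key ` K) \<le> card (I \<times> I \<times> J)" by (rule card_mono[rotated])
    also have "card (I \<times> I \<times> J) = (2 * n * P + 1)\<^sup>2 * (2 * N + 1) ^ 4"
    proof -
      have card_sym: "card {- int m..int m} = 2 * m + 1" for m by simp
      then have "card I = 2 * n * P + 1" by (simp only: I_def mult.assoc)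
      moreover have "card J = (2 * N + 1) ^ 4"
        by (simp add: J_def card_PiE card_sym del: card_atLeastAtMost_int)
      ultimately show ?thesis by (simp only: card_cartesian_product power2_eq_square mult.assoc)
    qed
    also have "\<dots> \<le> (3 * n * P)\<^sup>2 * (2 * N + 1) ^ 4"
      using n P1 by (intro mult_right_mono power_mono) auto
    also have "\<dots> = n\<^sup>2 * (9 * P\<^sup>2 * (2 * N + 1) ^ 4)" by (simp add: power_mult_distrib)
    also have "9 * P\<^sup>2 * (2 * N + 1) ^ 4 = n - 1" by (simp add: n_def)
    also have "n\<^sup>2 * (n - 1) < n ^ 3" using n by (simp add: power2_eq_square power3_eq_cube)
    also have "n ^ 3 = card K"
    proof -
      have "card (UNIV - {i0}) = (3::nat)" by (simp add: card_Diff_singleton)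
      then show ?thesis by (simp add: K_def card_PiE)
    qed
    finally have "\<not> inj_on key K" using pigeonhole by blast
    then obtain k k' where k: "k \<in> K" "k' \<in> K" "key k = key k'" "k \<noteq> k'"
      by (auto simp: inj_on_def)
    have close: "\<bar>c (w k) $ i - c (w k') $ i\<bar> \<le> 1/8" for i
    proof (rule floor_eq_imp_close)
      show "\<lfloor>c (w k) $ i / (1/8)\<rfloor> = \<lfloor>c (w k') $ i / (1/8)\<rfloor>"
        using k(3) unfolding key_def by (metis prod.inject)
    qed simp
    have "\<bar>Re (\<zeta> (w k)) - Re (\<zeta> (w k'))\<bar> \<le> \<epsilon> / 2" "\<bar>Im (\<zeta> (w k)) - Im (\<zeta> (w k'))\<bar> \<le> \<epsilon> / 2"
      by (rule floor_eq_imp_close; use k(3) \<epsilon> in \<open>simp add: key_def del: divide_divide_eq_right\<close>)+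
    then have z: "norm (\<zeta> (w k) - \<zeta> (w k')) \<le> \<epsilon>"
      using cmod_le[of "\<zeta> (w k) - \<zeta> (w k')"] by simp
    have "\<exists>i. \<bar>c (w k) $ i - c (w k') $ i\<bar> > D * \<epsilon>"
    proof (rule ccontr)
      assume "\<not> ?thesis"
      then have *: "\<bar>c (w k) $ i - c (w k') $ i\<bar> \<le> D * \<epsilon>" for i by (simp add: not_less)
      \<comment> \<open>Coordinate \<open>i0\<close> is unshifted, so its difference is due to
        \<sigma> alone, and by the choice of \<open>i0\<close> the effect of \<sigma> is at most
        \<open>D * \<epsilon>\<close> in every coordinate. The shifts then differ by at most
        \<open>2 * D * \<epsilon>\<close>, less than one grid step.\<close>
      define \<sigma> where "\<sigma> = s (w k) - s (w k')"
      have diff: "c (w k) $ i - c (w k') $ i = (w k $ i - w k' $ i) + \<sigma> * (b - a) $ i" for i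
        by (simp add: c_def \<sigma>_def algebra_simps)
      have "\<bar>\<sigma> * (b - a) $ i0\<bar> \<le> D * \<epsilon>" using *[of i0] diff[of i0] by (simp add: w_def)
      then have \<sigma>: "\<bar>\<sigma> * (b - a) $ i\<bar> \<le> D * \<epsilon>" for i
        using i0[of i] mult_left_mono[of "\<bar>(b - a) $ i\<bar>" "\<bar>(b - a) $ i0\<bar>" "\<bar>\<sigma>\<bar>"]
        by (simp add: abs_mult)
      have "D * \<epsilon> > 0" using pos \<epsilon> by simp
      then have "\<bar>w k $ i - w k' $ i\<bar> < \<eta> / n" for i
        using *[of i] \<sigma>[of i] unfolding D\<epsilon>[symmetric] diff by linarith
      then show False using w_inj[OF k(1,2)] k(4) by blast
    qed
    then show "\<exists>w w'. (\<forall>i. \<bar>w $ i\<bar> \<le> \<eta>) \<and> (\<forall>i. \<bar>w' $ i\<bar> \<le> \<eta>) \<and> norm (\<zeta> w - \<zeta> w') \<le> \<epsilon> \<and>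
         (\<forall>i. \<bar>(a + w + s w *\<^sub>R (b - a)) $ i - (a + w' + s w' *\<^sub>R (b - a)) $ i\<bar> \<le> 1/8) \<and>
         (\<exists>i. \<bar>(a + w + s w *\<^sub>R (b - a)) $ i - (a + w' + s w' *\<^sub>R (b - a)) $ i\<bar> > D * \<epsilon>)"
      using z close w_small k(1,2) unfolding c_def by blast
  qed
qed

section \<open>A thin separating wall in the deformed surface\<close>

text \<open>The bound on \<delta> leaves at least half of \<open>norm t\<close> after five monomials
  of degree 4 on the disc of radius \<delta> are subtracted. The bound on \<rho> makes
  \<open>\<zeta> + \<zeta>^15\<close>, of norm at most \<open>2 * \<rho>\<close>, at most a quarter
  of \<open>\<delta> * norm t\<close>.\<close>

locale thin_wall =
  fixes t :: complex and \<delta> \<rho> :: real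
  assumes \<delta>: "0 < \<delta>" "\<delta> \<le> 1" "10 * \<delta> \<le> norm t"
    and \<rho>: "0 < \<rho>" "\<rho> \<le> 1" "8 * \<rho> \<le> \<delta> * norm t"
begin

text \<open>In the coordinates \<open>\<zeta> = z / y^(1/2)\<close> and
  \<open>\<xi> = x / y^(3/2)\<close> of weight 0 this is \<open>norm \<zeta> < \<rho>\<close> and
  \<open>norm \<xi> < \<delta>\<close>; the squared form avoids the choice of a root. In the wall
  below, \<open>y \<noteq> 0\<close> removes only the origin.\<close>

definition region :: "(complex \<times> complex \<times> complex) set" where
  "region = {(x, y, z) \<in> surface t. norm z ^ 2 < \<rho>\<^sup>2 * norm y \<and> norm x ^ 2 < \<delta>\<^sup>2 * norm y ^ 3}"

definition wall :: "(complex \<times> complex \<times> complex) set" where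
  "wall = {(x, y, z) \<in> surface t. y \<noteq> 0 \<and> norm z ^ 2 = \<rho>\<^sup>2 * norm y \<and> norm x ^ 2 \<le> \<delta>\<^sup>2 * norm y ^ 3}"

section \<open>The small root\<close>

lemma t_pos: "norm t > 0"
  using \<delta> by linarith

lemma \<delta>_power_le: "n > 0 \<Longrightarrow> 10 * \<delta> ^ n \<le> norm t"
  using power_decreasing[of 1 n \<delta>] \<delta> by auto

text \<open>The difference quotient of \<open>\<xi>^5 + t * \<xi>\<close> is \<open>t\<close> plus
  five quartic terms of norm at most \<open>\<delta>^4\<close>. This one estimate gives both the
  uniqueness of the small root and its Lipschitz bound.\<close>

lemma small_root_expansion:
  assumes "norm a \<le> \<delta>" "norm b \<le> \<delta>"
  shows "norm t / 2 * norm (a - b) \<le> norm ((a ^ 5 + t * a) - (b ^ 5 + t * b))"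
proof -
  let ?q = "a^4 + a^3 * b + a^2 * b^2 + a * b^3 + b^4"
  have 1: "norm (a ^ i * b ^ j) \<le> \<delta> ^ 4" if "i + j = 4" for i j
    using assms \<delta> mult_mono[OF power_mono[OF assms(1), of i] power_mono[OF assms(2), of j]]
    by (simp add: norm_mult norm_power power_add[symmetric] that)
  have "norm ?q \<le> \<delta>^4 + \<delta>^4 + \<delta>^4 + \<delta>^4 + \<delta>^4"
    by (intro norm_triangle_le add_mono)
       (use 1[of 4 0] 1[of 3 1] 1[of 2 2] 1[of 1 3] 1[of 0 4] in auto)
  then have "norm ?q \<le> norm t / 2" using \<delta>_power_le[of 4] by simp
  then have "norm t / 2 \<le> norm (t + ?q)"
    using norm_triangle_ineq2[of t "- ?q"] by (simp add: norm_minus_cancel del: minus_add_distrib)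
  then have "norm t / 2 * norm (a - b) \<le> norm (t + ?q) * norm (a - b)"
    by (intro mult_right_mono) auto
  also have "\<dots> = norm ((t + ?q) * (a - b))" by (simp add: norm_mult)
  also have "(t + ?q) * (a - b) = (a ^ 5 + t * a) - (b ^ 5 + t * b)" by algebra
  finally show ?thesis .
qed

lemma norm_add_power15_le:
  fixes \<zeta> :: complex
  assumes "norm \<zeta> \<le> \<rho>"
  shows "norm (\<zeta> + \<zeta> ^ 15) \<le> 2 * \<rho>"
proof -
  have "norm \<zeta> ^ 15 \<le> \<rho> ^ 15" using assms by (intro power_mono) auto
  also have "\<dots> \<le> \<rho> ^ 1" using \<rho> by (intro power_decreasing) auto
  finally show ?thesis using assms norm_triangle_ineq[of \<zeta> "\<zeta>^15"] by (simp add: norm_power)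
qed

text \<open>The equation is that of the surface divided by \<open>y^(15/2)\<close>. Its solutions
  are the fixed points of \<open>f\<close>, and the choice of \<delta> and \<rho> makes
  \<open>f\<close> map the closed disc into itself, so Brouwer's theorem applies.\<close>

lemma small_root_exists:
  assumes "norm \<zeta> \<le> \<rho>"
  shows "\<exists>\<xi>. norm \<xi> \<le> \<delta> \<and> \<xi> ^ 5 + t * \<xi> + \<zeta> + \<zeta> ^ 15 = 0"
proof -
  define f where "f \<xi> = - (\<xi> ^ 5 + (\<zeta> + \<zeta> ^ 15)) / t" for \<xi>
  have "f ` cball 0 \<delta> \<subseteq> cball 0 \<delta>"
  proof clarsimp
    fix \<xi> :: complex assume "norm \<xi> \<le> \<delta>"
    then have "norm \<xi> ^ 5 \<le> \<delta> ^ 5" by (intro power_mono) auto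
    moreover have "\<delta> ^ 5 = \<delta> * \<delta> ^ 4" by algebra
    moreover have "10 * (\<delta> * \<delta> ^ 4) \<le> \<delta> * norm t"
      using mult_left_mono[OF \<delta>_power_le[of 4], of \<delta>] \<delta> by simp
    moreover have "norm (\<xi> ^ 5 + (\<zeta> + \<zeta> ^ 15)) \<le> norm \<xi> ^ 5 + 2 * \<rho>"
      using norm_add_power15_le[OF assms] norm_triangle_ineq[of "\<xi>^5" "\<zeta> + \<zeta> ^ 15"]
      by (simp add: norm_power)
    moreover have "\<delta> * norm t > 0" using \<delta> t_pos by simp
    ultimately have "norm (\<xi> ^ 5 + (\<zeta> + \<zeta> ^ 15)) \<le> \<delta> * norm t"
      using \<rho> by linarith
    then show "norm (f \<xi>) \<le> \<delta>"
      unfolding f_def norm_divide norm_minus_cancel using t_pos by (simp add: pos_divide_le_eq)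
  qed
  moreover have "continuous_on (cball 0 \<delta>) f"
    unfolding f_def using t_pos by (intro continuous_intros) auto
  ultimately obtain \<xi> where "\<xi> \<in> cball 0 \<delta>" "f \<xi> = \<xi>"
    using brouwer_ball[of \<delta> 0 f] \<delta> by blast
  then have "norm \<xi> \<le> \<delta>" "\<xi> * t = - (\<xi> ^ 5 + (\<zeta> + \<zeta> ^ 15))"
    using t_pos by (auto simp: f_def field_simps)
  then show ?thesis by (intro exI[of _ \<xi>]) (auto simp: algebra_simps)
qed

definition small_root :: "complex \<Rightarrow> complex" where
  "small_root \<zeta> = (SOME \<xi>. norm \<xi> \<le> \<delta> \<and> \<xi> ^ 5 + t * \<xi> + \<zeta> + \<zeta> ^ 15 = 0)"

lemma small_root:
  assumes "norm \<zeta> \<le> \<rho>"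
  shows "norm (small_root \<zeta>) \<le> \<delta>"
    and "small_root \<zeta> ^ 5 + t * small_root \<zeta> + \<zeta> + \<zeta> ^ 15 = 0"
  using someI_ex[OF small_root_exists[OF assms]] unfolding small_root_def by auto

lemma small_root_unique:
  assumes "norm \<zeta> \<le> \<rho>" "norm \<xi> \<le> \<delta>" "\<xi> ^ 5 + t * \<xi> + \<zeta> + \<zeta> ^ 15 = 0"
  shows "small_root \<zeta> = \<xi>"
proof -
  have "small_root \<zeta> ^ 5 + t * small_root \<zeta> = \<xi> ^ 5 + t * \<xi>"
    using small_root(2)[OF assms(1)] assms(3) by (metis add.assoc add_right_cancel)
  then have "norm t / 2 * norm (small_root \<zeta> - \<xi>) \<le> 0"
    using small_root_expansion[OF small_root(1)[OF assms(1)] assms(2)] by simp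
  then show ?thesis using t_pos by (simp add: mult_le_0_iff)
qed

text \<open>On the unit disc \<open>\<zeta> + \<zeta>^15\<close> has Lipschitz constant 1 + 15;
  dividing by the expansion factor \<open>norm t / 2\<close> gives
  \<open>32 / norm t\<close>.\<close>

lemma small_root_lipschitz:
  assumes "norm \<zeta> \<le> \<rho>" "norm \<zeta>' \<le> \<rho>"
  shows "norm (small_root \<zeta> - small_root \<zeta>') \<le> 32 / norm t * norm (\<zeta> - \<zeta>')"
proof -
  let ?g = "small_root \<zeta>" and ?g' = "small_root \<zeta>'"
  have "norm (\<zeta>' ^ 15 - \<zeta> ^ 15) \<le> real 15 * norm (\<zeta>' - \<zeta>)"
    using assms \<rho> by (intro norm_power_diff) auto
  then have "norm ((\<zeta>' + \<zeta>' ^ 15) - (\<zeta> + \<zeta> ^ 15)) \<le> 16 * norm (\<zeta>' - \<zeta>)"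
    using norm_triangle_ineq[of "\<zeta>' - \<zeta>" "\<zeta>' ^ 15 - \<zeta> ^ 15"] by (simp add: algebra_simps)
  moreover have "(?g ^ 5 + t * ?g) - (?g' ^ 5 + t * ?g') = (\<zeta>' + \<zeta>' ^ 15) - (\<zeta> + \<zeta> ^ 15)"
    using small_root(2)[OF assms(1)] small_root(2)[OF assms(2)] by algebra
  moreover have "norm t / 2 * norm (?g - ?g') \<le> norm ((?g ^ 5 + t * ?g) - (?g' ^ 5 + t * ?g'))"
    by (rule small_root_expansion) (use small_root assms in auto)
  ultimately have "norm t / 2 * norm (?g - ?g') \<le> 16 * norm (\<zeta> - \<zeta>')"
    by (simp only: norm_minus_commute[of \<zeta>])
  then show ?thesis using t_pos by (simp add: pos_le_divide_eq mult.commute)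
qed

section \<open>Inner distances along the wall\<close>

text \<open>Normalise by a square root \<open>s\<close> of \<open>y\<close>, then eliminate
  \<open>s = z / \<zeta>\<close>. The coordinates left are \<open>z\<close> and the angle of
  \<zeta>, while \<open>x\<close> and \<open>y\<close> are of orders \<open>z^3\<close> and
  \<open>z^2\<close>; this is the thinness of the wall.\<close>

lemma wall_param:
  assumes "(x, y, z) \<in> wall"
  obtains \<zeta> where "norm \<zeta> = \<rho>" "x = z ^ 3 * (small_root \<zeta> / \<zeta> ^ 3)" "y = z\<^sup>2 * (1 / \<zeta>\<^sup>2)" "z \<noteq> 0"
proof -
  from assms have eq: "x^5 + z^15 + y^7 * z + t * x * y^6 = 0" and y: "y \<noteq> 0"
    and nz: "norm z ^ 2 = \<rho>\<^sup>2 * norm y" and nx: "norm x ^ 2 \<le> \<delta>\<^sup>2 * norm y ^ 3"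
    by (auto simp: wall_def surface_def)
  define s where "s = csqrt y"
  have s: "s\<^sup>2 = y" "s \<noteq> 0" using y by (auto simp: s_def)
  define \<zeta> \<xi> where "\<zeta> = z / s" and "\<xi> = x / s ^ 3"
  have z: "z = \<zeta> * s" and x: "x = \<xi> * s ^ 3" using s by (auto simp: \<zeta>_def \<xi>_def)
  have ns: "norm y = norm s ^ 2" by (simp add: s(1)[symmetric] norm_power)
  have "norm \<zeta> ^ 2 * norm s ^ 2 = \<rho>\<^sup>2 * norm s ^ 2"
    using nz by (simp add: ns z norm_mult power_mult_distrib)
  then have "norm \<zeta> ^ 2 = \<rho> ^ 2" using s by simp
  then have n\<zeta>: "norm \<zeta> = \<rho>" using \<rho> by (simp add: power2_eq_iff_nonneg)
  have "norm \<xi> ^ 2 * norm s ^ 6 \<le> \<delta>\<^sup>2 * norm s ^ 6"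
    using nx by (simp add: ns x norm_mult norm_power power_mult_distrib power_mult[symmetric])
  then have "norm \<xi> ^ 2 \<le> \<delta> ^ 2" using s by simp
  then have n\<xi>: "norm \<xi> \<le> \<delta>" using \<delta> by (simp add: power2_le_iff_abs_le)
  have "s ^ 15 * (\<xi> ^ 5 + t * \<xi> + \<zeta> + \<zeta> ^ 15) = 0"
    using eq unfolding z x s(1)[symmetric] by algebra
  then have "small_root \<zeta> = \<xi>"
    using s by (intro small_root_unique) (use n\<zeta> n\<xi> in auto)
  moreover have "\<zeta> \<noteq> 0" using n\<zeta> \<rho> by auto
  ultimately show ?thesis
    using s by (intro that[of \<zeta>] n\<zeta>) (auto simp: z x power_mult_distrib simp flip: s(1))
qed

lemma wall_curve_in_surface:
  assumes "norm \<zeta> = \<rho>"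
  shows "(z ^ 3 * (small_root \<zeta> / \<zeta> ^ 3), z\<^sup>2 * (1 / \<zeta>\<^sup>2), z) \<in> surface t"
proof -
  have "\<zeta> \<noteq> 0" using assms \<rho> by auto
  define s where "s = z / \<zeta>"
  have z: "z = s * \<zeta>" using \<open>\<zeta> \<noteq> 0\<close> by (simp add: s_def)
  have "s ^ 15 * (small_root \<zeta> ^ 5 + t * small_root \<zeta> + \<zeta> + \<zeta> ^ 15) = 0"
    using small_root(2)[of \<zeta>] assms by simp
  then have "(s ^ 3 * small_root \<zeta>) ^ 5 + (s * \<zeta>) ^ 15 + (s\<^sup>2) ^ 7 * (s * \<zeta>)
     + t * (s ^ 3 * small_root \<zeta>) * (s\<^sup>2) ^ 6 = 0"
    by algebra
  moreover have "z ^ 3 * (small_root \<zeta> / \<zeta> ^ 3) = s ^ 3 * small_root \<zeta>" "z\<^sup>2 * (1 / \<zeta>\<^sup>2) = s\<^sup>2"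
    using \<open>\<zeta> \<noteq> 0\<close> by (auto simp: z power_mult_distrib)
  ultimately show ?thesis by (simp add: surface_def z)
qed

text \<open>First leg of a path along the wall: \<zeta> stays fixed and \<open>z\<close> runs along
  a segment in the unit disc, where the powers of \<open>z\<close> are Lipschitz.\<close>

lemma inner_dist_wall_scaling:
  assumes "norm \<zeta> = \<rho>" "norm z \<le> 1" "norm z' \<le> 1"
  shows "inner_dist (surface t) (z ^ 3 * (small_root \<zeta> / \<zeta> ^ 3), z\<^sup>2 * (1 / \<zeta>\<^sup>2), z)
      (z' ^ 3 * (small_root \<zeta> / \<zeta> ^ 3), z'\<^sup>2 * (1 / \<zeta>\<^sup>2), z')
    \<le> (3 / \<rho> ^ 3 + 2 / \<rho>\<^sup>2 + 1) * norm (z - z')"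
proof -
  let ?c = "\<lambda>s::real. z + of_real s * (z' - z)"
  let ?d = "norm (z - z')"
  have le1: "norm (?c s) \<le> 1" if "s \<in> {0..1}" for s
  proof -
    have "?c s = of_real (1 - s) * z + of_real s * z'" by (simp add: algebra_simps)
    also have "norm \<dots> \<le> (1 - s) * norm z + s * norm z'"
      using that norm_triangle_ineq[of "of_real (1 - s) * z" "of_real s * z'"]
      by (simp add: norm_mult del: of_real_diff)
    also have "\<dots> \<le> (1 - s) * 1 + s * 1"
      using that assms by (intro add_mono mult_left_mono) auto
    finally show ?thesis by simp
  qed
  have lip: "(of_nat k * norm c * ?d)-lipschitz_on {0..1} (\<lambda>s. ?c s ^ k * c)" for k c
  proof (rule lipschitz_on_vector_derivative_bound
      [where f' = "\<lambda>s. of_nat k * ?c s ^ (k - 1) * (z' - z) * c"])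
    fix s :: real assume s: "s \<in> {0..1}"
    show "((\<lambda>s. ?c s ^ k * c) has_vector_derivative of_nat k * ?c s ^ (k - 1) * (z' - z) * c)
        (at s within {0..1})"
      by (rule has_vector_derivative_real_field) (auto intro!: derivative_eq_intros)
    have "norm (?c s) ^ (k - 1) \<le> 1" using le1[OF s] by (intro power_le_one) auto
    then have "norm (?c s) ^ (k - 1) * (of_nat k * norm c * ?d) \<le> 1 * (of_nat k * norm c * ?d)"
      by (intro mult_right_mono) auto
    then show "norm (of_nat k * ?c s ^ (k - 1) * (z' - z) * c) \<le> of_nat k * norm c * ?d"
      by (simp add: norm_mult norm_power norm_minus_commute mult_ac)
  qed auto
  have "inner_dist (surface t)
      (?c 0 ^ 3 * (small_root \<zeta> / \<zeta> ^ 3), ?c 0 ^ 2 * (1 / \<zeta>\<^sup>2), ?c 0 ^ 1 * 1)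
      (?c 1 ^ 3 * (small_root \<zeta> / \<zeta> ^ 3), ?c 1 ^ 2 * (1 / \<zeta>\<^sup>2), ?c 1 ^ 1 * 1)
    \<le> (of_nat 3 * norm (small_root \<zeta> / \<zeta> ^ 3) * ?d + of_nat 2 * norm (1 / \<zeta>\<^sup>2) * ?d
       + of_nat 1 * norm (1::complex) * ?d) * (1 - 0)"
    by (rule inner_dist_le_lipschitz_interval[OF lip lip lip])
       (use wall_curve_in_surface[OF assms(1)] in auto)
  also have "\<dots> = (3 * norm (small_root \<zeta>) / \<rho> ^ 3 + 2 / \<rho>\<^sup>2 + 1) * ?d"
    by (simp add: norm_divide norm_power assms(1) distrib_right)
  also have "\<dots> \<le> (3 * 1 / \<rho> ^ 3 + 2 / \<rho>\<^sup>2 + 1) * ?d"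
    using small_root(1)[of \<zeta>] assms(1) \<delta> \<rho>
    by (intro mult_right_mono add_mono divide_right_mono) auto
  finally show ?thesis by simp
qed

text \<open>Second leg: \<open>z\<close> stays fixed and \<zeta> turns on its circle. Only
  \<open>x\<close> and \<open>y\<close> move, with factors \<open>z^3\<close> and
  \<open>z^2\<close>; hence a length quadratic in \<open>norm z\<close>.\<close>

lemma inner_dist_wall_rotation:
  assumes "norm \<zeta> = \<rho>" "norm \<zeta>' = \<rho>"  "norm z \<le> 1"
  shows "inner_dist (surface t) (z ^ 3 * (small_root \<zeta> / \<zeta> ^ 3), z\<^sup>2 * (1 / \<zeta>\<^sup>2), z)
      (z ^ 3 * (small_root \<zeta>' / \<zeta>' ^ 3), z\<^sup>2 * (1 / \<zeta>'\<^sup>2), z)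
    \<le> (32 / norm t + 5) / \<rho> ^ 3 * (4 * pi) * norm z ^ 2"
proof -
  define a where "a = Arg \<zeta>"
  \<comment> \<open>The second argument is lifted past the first, so that the arc is traversed over
    the interval from \<open>a\<close> to \<open>b\<close>.\<close>
  define b where "b = (if Arg \<zeta>' \<ge> a then Arg \<zeta>' else Arg \<zeta>' + 2 * pi)"
  define c where "c s = of_real \<rho> * cis s" for s
  have ca: "c a = \<zeta>" and cb: "c b = \<zeta>'"
    using assms rcis_cmod_Arg[of \<zeta>] rcis_cmod_Arg[of \<zeta>']
    by (auto simp: a_def b_def c_def rcis_def cis_mult[symmetric])
  have ab: "a \<le> b" "b - a \<le> 4 * pi"
    using Arg_bounded[of \<zeta>] Arg_bounded[of \<zeta>'] unfolding a_def b_def by (auto split: if_splits)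
  have nc: "norm (c s) = \<rho>" for s using \<rho> by (simp add: c_def norm_mult)
  have inv: "1 / c s = of_real (1 / \<rho>) * cis (- s)" for s
    by (simp add: c_def divide_inverse cis_inverse)
  have invk: "1 / c s ^ k = of_real (1 / \<rho> ^ k) * cis (- s) ^ k" for s k
    by (metis inv of_real_power power_mult_distrib power_one_over)
  have cis_lip: "norm (cis s - cis s') \<le> norm (s - s')" for s s' :: real
  proof -
    have "1-lipschitz_on {min s s'..max s s'} cis"
    proof (rule lipschitz_on_vector_derivative_bound[where f' = "\<lambda>s. \<i> * cis s"])
      show "(cis has_vector_derivative \<i> * cis u) (at u within {min s s'..max s s'})" for u
        unfolding cis_conv_exp
        by (rule has_vector_derivative_real_field) (auto intro!: derivative_eq_intros)
    qed (auto simp: norm_mult)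
    then show ?thesis using lipschitz_onD[of 1 _ cis s s'] by (simp add: dist_norm)
  qed
  have c_lip: "norm (c s - c s') \<le> \<rho> * norm (s - s')" for s s'
  proof -
    have "c s - c s' = of_real \<rho> * (cis s - cis s')" by (simp add: c_def algebra_simps)
    then show ?thesis using cis_lip[of s s'] \<rho> by (simp add: norm_mult)
  qed
  have pow_lip: "norm (1 / c s ^ k - 1 / c s' ^ k) \<le> real k / \<rho> ^ k * norm (s - s')" for k s s'
  proof -
    have "1 / c s ^ k - 1 / c s' ^ k = of_real (1 / \<rho> ^ k) * (cis (- s) ^ k - cis (- s') ^ k)"
      by (simp only: invk right_diff_distrib)
    also have "norm \<dots> \<le> 1 / \<rho> ^ k * (real k * norm (cis (- s) - cis (- s')))"
      using \<rho> norm_power_diff[of "cis (- s)" "cis (- s')" k]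
      by (simp add: norm_mult norm_divide norm_power divide_right_mono del: Complex.DeMoivre)
    also have "\<dots> \<le> 1 / \<rho> ^ k * (real k * norm (s - s'))"
      using cis_lip[of "-s" "-s'"] \<rho> by (intro mult_left_mono) auto
    finally show ?thesis by simp
  qed
  let ?A = "(32 / norm t + 3) / \<rho> ^ 3"
  have x_lip: "norm (small_root (c s) / c s ^ 3 - small_root (c s') / c s' ^ 3) \<le> ?A * norm (s - s')"
    for s s'
  proof -
    have "small_root (c s) / c s ^ 3 - small_root (c s') / c s' ^ 3
      = (small_root (c s) - small_root (c s')) * (1 / c s ^ 3)
        + small_root (c s') * (1 / c s ^ 3 - 1 / c s' ^ 3)"
      by (simp add: algebra_simps)
    also have "norm \<dots> \<le> norm (small_root (c s) - small_root (c s')) * (1 / \<rho> ^ 3)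
        + norm (small_root (c s')) * norm (1 / c s ^ 3 - 1 / c s' ^ 3)"
      by (intro norm_triangle_le) (simp add: norm_mult norm_divide norm_power nc)
    also have "\<dots> \<le> (32 / norm t * norm (s - s')) * (1 / \<rho> ^ 3) + 1 * (real 3 / \<rho> ^ 3 * norm (s - s'))"
    proof (intro add_mono mult_mono pow_lip)
      have "norm (small_root (c s) - small_root (c s')) \<le> 32 / norm t * norm (c s - c s')"
        by (rule small_root_lipschitz) (auto simp: nc)
      also have "\<dots> \<le> 32 / norm t * (1 * norm (s - s'))"
        using c_lip[of s s'] \<rho> by (intro mult_left_mono order_trans[OF c_lip] mult_right_mono) auto
      finally show "norm (small_root (c s) - small_root (c s')) \<le> 32 / norm t * norm (s - s')" by simp
      show "norm (small_root (c s')) \<le> 1"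
        using small_root(1)[of "c s'"] \<delta> by (simp add: nc)
    qed (use \<rho> in auto)
    also have "\<dots> = ?A * norm (s - s')" using \<rho> by (simp add: field_simps)
    finally show ?thesis .
  qed
  have A: "?A \<ge> 0" using \<rho> by simp
  have "inner_dist (surface t) (z ^ 3 * (small_root (c a) / c a ^ 3), z\<^sup>2 * (1 / (c a)\<^sup>2), z)
      (z ^ 3 * (small_root (c b) / c b ^ 3), z\<^sup>2 * (1 / (c b)\<^sup>2), z)
    \<le> (norm z ^ 3 * ?A + norm z ^ 2 * (real 2 / \<rho>\<^sup>2) + 0) * (b - a)"
  proof (rule inner_dist_le_lipschitz_interval)
    show "(norm z ^ 3 * ?A)-lipschitz_on {a..b} (\<lambda>s. z ^ 3 * (small_root (c s) / c s ^ 3))"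
    proof (rule lipschitz_onI)
      fix s s'
      have "norm (z ^ 3 * (small_root (c s) / c s ^ 3 - small_root (c s') / c s' ^ 3))
          \<le> norm z ^ 3 * (?A * norm (s - s'))"
        unfolding norm_mult[of "z ^ 3"] norm_power by (intro mult_left_mono x_lip) auto
      then show "dist (z ^ 3 * (small_root (c s) / c s ^ 3)) (z ^ 3 * (small_root (c s') / c s' ^ 3))
          \<le> norm z ^ 3 * ?A * dist s s'"
        by (simp only: dist_norm right_diff_distrib mult.assoc)
    qed (use A in \<open>intro mult_nonneg_nonneg, auto\<close>)
    show "(norm z ^ 2 * (real 2 / \<rho>\<^sup>2))-lipschitz_on {a..b} (\<lambda>s. z\<^sup>2 * (1 / (c s)\<^sup>2))"
    proof (rule lipschitz_onI)
      fix s s'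
      have "norm (z\<^sup>2 * (1 / (c s)\<^sup>2 - 1 / (c s')\<^sup>2)) \<le> norm z ^ 2 * (real 2 / \<rho>\<^sup>2 * norm (s - s'))"
        unfolding norm_mult norm_power by (intro mult_left_mono pow_lip) auto
      then show "dist (z\<^sup>2 * (1 / (c s)\<^sup>2)) (z\<^sup>2 * (1 / (c s')\<^sup>2)) \<le> norm z ^ 2 * (real 2 / \<rho>\<^sup>2) * dist s s'"
        by (simp only: dist_norm right_diff_distrib mult.assoc)
    qed (use \<rho> in auto)
    show "0-lipschitz_on {a..b} (\<lambda>_. z)" by (rule lipschitz_onI) auto
  qed (use wall_curve_in_surface nc ab in auto)
  also have "\<dots> \<le> (norm z ^ 2 * ?A + norm z ^ 2 * (2 / \<rho> ^ 3) + 0) * (4 * pi)"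
  proof (intro mult_mono add_mono mult_left_mono)
    show "norm z ^ 3 \<le> norm z ^ 2" using assms(3) by (intro power_decreasing) auto
    have "\<rho> ^ 3 \<le> \<rho>\<^sup>2" using \<rho> by (intro power_decreasing) auto
    then show "real 2 / \<rho>\<^sup>2 \<le> 2 / \<rho> ^ 3" using \<rho> by (simp add: frac_le)
  qed (use A ab \<rho> in auto)
  also have "\<dots> = (32 / norm t + 5) / \<rho> ^ 3 * (4 * pi) * norm z ^ 2"
    using \<rho> by (simp add: field_simps)
  finally show ?thesis by (simp add: ca cb)
qed

text \<open>Scale at fixed \<zeta>, then rotate at fixed \<open>z'\<close>. At scale r the quadratic
  term has order r^2, so up to smaller errors the wall has only the complex coordinate
  \<open>z\<close>.\<close>

lemma inner_dist_wall_le: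
  obtains M where "M > 0"
    "\<And>x y z x' y' z'. \<lbrakk>(x, y, z) \<in> wall; (x', y', z') \<in> wall; norm z \<le> 1; norm z' \<le> 1\<rbrakk> \<Longrightarrow>
       inner_dist (surface t) (x, y, z) (x', y', z') \<le> M * (norm (z - z') + norm z' ^ 2)"
proof -
  define M1 where "M1 = 3 / \<rho> ^ 3 + 2 / \<rho>\<^sup>2 + 1"
  define M2 where "M2 = (32 / norm t + 5) / \<rho> ^ 3 * (4 * pi)"
  have pos: "M1 > 0" "M2 > 0" 
    using \<rho> t_pos by (auto simp: M1_def M2_def intro!: add_nonneg_pos mult_pos_pos divide_pos_pos)
  show ?thesis
  proof (rule that[of "M1 + M2"])
    fix x y z x' y' z'
    assume p: "(x, y, z) \<in> wall" "(x', y', z') \<in> wall" and z: "norm z \<le> 1" "norm z' \<le> 1"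
    obtain \<zeta> where \<zeta>: "norm \<zeta> = \<rho>" "x = z ^ 3 * (small_root \<zeta> / \<zeta> ^ 3)" "y = z\<^sup>2 * (1 / \<zeta>\<^sup>2)"
      using wall_param[OF p(1)] .
    obtain \<zeta>' where \<zeta>': "norm \<zeta>' = \<rho>" "x' = z' ^ 3 * (small_root \<zeta>' / \<zeta>' ^ 3)" "y' = z'\<^sup>2 * (1 / \<zeta>'\<^sup>2)"
      using wall_param[OF p(2)] .
    let ?m = "(z' ^ 3 * (small_root \<zeta> / \<zeta> ^ 3), z'\<^sup>2 * (1 / \<zeta>\<^sup>2), z')"
    have "inner_dist (surface t) (x, y, z) (x', y', z')
      \<le> inner_dist (surface t) (x, y, z) ?m + inner_dist (surface t) ?m (x', y', z')"
      using p by (intro inner_dist_surface_triangle wall_curve_in_surface \<zeta>(1)) (auto simp: wall_def)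
    also have "\<dots> \<le> M1 * norm (z - z') + M2 * norm z' ^ 2"
      unfolding M1_def M2_def \<zeta>(2,3) \<zeta>'(2,3)
      using inner_dist_wall_scaling[OF \<zeta>(1) z] inner_dist_wall_rotation[OF \<zeta>(1) \<zeta>'(1) z(2)]
      by (rule add_mono)
    also have "\<dots> \<le> (M1 + M2) * (norm (z - z') + norm z' ^ 2)"
      using pos by (simp add: algebra_simps)
    finally show "inner_dist (surface t) (x, y, z) (x', y', z') \<le> (M1 + M2) * (norm (z - z') + norm z' ^ 2)" .
  qed (use pos in simp)
qed

section \<open>Separation by the wall\<close>

text \<open>
  On the face \<open>norm x = \<delta> * norm y powr (3/2)\<close> of the region, the terms \<open>x\<^sup>5 + t x y\<^sup>6\<close> dominate
  the other two, so the surface leaves the region only through the wall.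
\<close>

lemma no_escape_through_x_face:
  assumes "(x, y, z) \<in> surface t" "norm x ^ 2 = \<delta>\<^sup>2 * norm y ^ 3" "norm z ^ 2 \<le> \<rho>\<^sup>2 * norm y" 
  shows "y = 0"
proof (rule ccontr)
  assume y: "y \<noteq> 0"
  define m where "m = sqrt (norm y)"
  have m: "m > 0" "norm y = m ^ 2" using y by (auto simp: m_def)
  have "norm x ^ 2 = (\<delta> * m ^ 3) ^ 2" using assms(2) m by (simp add: power_mult_distrib power_mult[symmetric])
  then have nx: "norm x = \<delta> * m ^ 3" using \<delta> m by (simp add: power2_eq_iff_nonneg)
  have "norm z ^ 2 \<le> (\<rho> * m) ^ 2" using assms(3) m by (simp add: power_mult_distrib)
  then have nz: "norm z \<le> \<rho> * m" by (rule power2_le_imp_le) (use \<rho> m in auto)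
  have "x * (x^4 + t * y^6) = - (z^15 + y^7 * z)"
    using assms(1) unfolding surface_def by auto algebra
  then have eq: "norm x * norm (x^4 + t * y^6) = norm (z^15 + y^7 * z)"
    by (metis norm_minus_cancel norm_mult)
  have "norm (t * y ^ 6) - norm (x ^ 4) \<le> norm (x^4 + t * y^6)"
    by (metis add.commute norm_diff_ineq)
  then have "norm t * m ^ 12 - \<delta> ^ 4 * m ^ 12 \<le> norm (x^4 + t * y^6)"
    by (simp add: norm_mult norm_power nx m(2) power_mult_distrib power_mult[symmetric])
  moreover have "10 * (\<delta> ^ 4 * m ^ 12) \<le> norm t * m ^ 12"
    using mult_right_mono[OF \<delta>_power_le[of 4], of "m ^ 12"] m by simp
  moreover have "norm t * m ^ 12 > 0" using t_pos m by simp
  ultimately have "norm t * m ^ 12 / 2 \<le> norm (x^4 + t * y^6)"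
    by linarith
  then have "\<delta> * m ^ 3 * (norm t * m ^ 12 / 2) \<le> norm x * norm (x^4 + t * y^6)"
    unfolding nx using \<delta> m by (intro mult_left_mono) auto
  then have 1: "\<delta> * norm t * m ^ 15 / 2 \<le> norm (z^15 + y^7 * z)"
    unfolding eq by (simp add: power_add[symmetric] mult_ac)
  have "norm (z^15 + y^7 * z) \<le> norm z ^ 15 + norm y ^ 7 * norm z"
    by (rule order_trans[OF norm_triangle_ineq]) (simp add: norm_mult norm_power)
  also have "\<dots> \<le> (\<rho> * m) ^ 15 + (m ^ 2) ^ 7 * (\<rho> * m)"
    using nz m by (intro add_mono power_mono mult_mono) auto
  also have "\<dots> = (\<rho> ^ 15 + \<rho>) * m ^ 15"
    by algebra
  also have "\<dots> \<le> (\<rho> ^ 1 + \<rho>) * m ^ 15"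
    using \<rho> m by (intro mult_right_mono add_mono power_decreasing) auto
  finally have "\<delta> * norm t * m ^ 15 / 2 \<le> 2 * \<rho> * m ^ 15" using 1 by simp
  \<comment> \<open>This contradicts \<open>8 * \<rho> \<le> \<delta> * norm t\<close>, which bounds
    the right-hand side by \<open>\<delta> * norm t / 4\<close>.\<close>
  then have "\<delta> * norm t / 2 \<le> 2 * \<rho>" using m by (simp add: field_simps)
  then show False using \<rho> by linarith
qed

text \<open>Within the surface \<open>F\<close> is negative exactly on the region, so by the
  intermediate value theorem it vanishes somewhere on the path. There \<open>y = 0\<close> would
  force the origin, which the path avoids, and for \<open>y \<noteq> 0\<close> the
  \<open>x\<close>-face is impossible.\<close>

lemma path_crosses_wall:
  assumes "continuous_on {0..1} \<gamma>" "\<And>s. s \<in> {0..1} \<Longrightarrow> \<gamma> s \<in> surface t - {0}"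
    and "\<gamma> 0 \<in> region" "\<gamma> 1 \<notin> region"
  obtains s :: real where "s \<in> {0..1}" "\<gamma> s \<in> wall"
proof -
  define F where "F = (\<lambda>(x, y, z). max (norm (z::complex) ^ 2 - \<rho>\<^sup>2 * norm (y::complex))
    (norm (x::complex) ^ 2 - \<delta>\<^sup>2 * norm y ^ 3))"
  have "F (\<gamma> 0) < 0" using assms(3) by (auto simp: region_def F_def)
  moreover have "F (\<gamma> 1) \<ge> 0" using assms(2)[of 1] assms(4)
    by (auto simp: region_def F_def split: prod.splits)
  moreover have "continuous_on {0..1} (\<lambda>s. F (\<gamma> s))"
    unfolding F_def case_prod_beta by (intro continuous_intros assms(1))
  ultimately obtain s where s: "0 \<le> s" "s \<le> 1" "F (\<gamma> s) = 0"
    using IVT'[of "\<lambda>s. F (\<gamma> s)" 0 0 1] by auto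
  obtain x y z where g: "\<gamma> s = (x, y, z)" by (cases "\<gamma> s")
  have S: "(x, y, z) \<in> surface t" "(x, y, z) \<noteq> 0" using assms(2)[of s] s g by auto
  have le: "norm z ^ 2 \<le> \<rho>\<^sup>2 * norm y" "norm x ^ 2 \<le> \<delta>\<^sup>2 * norm y ^ 3"
    and eq: "norm z ^ 2 = \<rho>\<^sup>2 * norm y \<or> norm x ^ 2 = \<delta>\<^sup>2 * norm y ^ 3"
    using s(3) by (auto simp: g F_def max_def split: if_splits)
  have y: "y \<noteq> 0" using le S(2) by (auto simp: zero_prod_def)
  then have "norm z ^ 2 = \<rho>\<^sup>2 * norm y"
    using no_escape_through_x_face[OF S(1) _ le(1)] eq by blast
  then show ?thesis using s S y le by (intro that[of s]) (auto simp: wall_def g)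
qed

text \<open>Within \<open>r / 2\<close> of the point, \<open>norm z < r / 2\<close> and
  \<open>norm y > r / 2\<close>, whereas on the wall \<open>norm y\<close> is
  \<open>norm z ^ 2 / \<rho>^2\<close>, which has order r^2.\<close>

lemma wall_far:
  assumes "(x, y, z) \<in> wall" "r > 0" "r \<le> 2 * \<rho>\<^sup>2"
  shows "r / 2 \<le> dist (x, y, z) (x0, of_real r, 0)"
proof (rule ccontr)
  assume "\<not> ?thesis"
  then have "norm (x - x0, y - of_real r, z) < r / 2" by (simp add: dist_norm)
  then have d: "norm (y - of_real r) < r / 2" "norm z < r / 2"
    using norm_triple_ge[where x = "x - x0" and y = "y - of_real r" and z = z] by linarith+
  have "norm z ^ 2 < (r / 2) ^ 2" using d(2) by (intro power_strict_mono) auto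
  also have "(r / 2) ^ 2 \<le> \<rho>\<^sup>2 * (r / 2)" using assms(2,3) by (simp add: power2_eq_square)
  finally have "\<rho>\<^sup>2 * norm y < \<rho>\<^sup>2 * (r / 2)" using assms(1) by (auto simp: wall_def)
  then have "norm y < r / 2" using \<rho> by simp
  moreover have "norm (of_real r :: complex) - norm y \<le> norm (y - of_real r)"
    by (metis norm_minus_commute norm_triangle_ineq2)
  ultimately show False using d(1) assms(2) by simp
qed

text \<open>A path shorter than \<open>r / 2\<close> reaches neither the wall nor the origin, so it
  cannot change sides. Since \<open>path_crosses_wall\<close> wants a path starting inside the
  region, one direction uses the reversed path.\<close>

lemma inner_ball_same_side:
  assumes r: "r > 0" "r \<le> 2 * \<rho>\<^sup>2" and p: "(x0, of_real r, 0) \<in> surface t" and q: "q \<in> surface t"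
    and d: "inner_dist (surface t) (x0, of_real r, 0) q < r / 2"
  shows "q \<in> region \<longleftrightarrow> (x0, of_real r, 0) \<in> region"
proof -
  let ?p = "(x0, complex_of_real r, 0::complex)"
  obtain g where g: "g \<in> rectifiable_paths_in (surface t) ?p q" "path_length g < r / 2"
    using short_path_in_surface[OF p q d] .
  then have rect: "rectifiable_path g" and ends: "g 0 = ?p" "g 1 = q"
    and S: "\<And>s. s \<in> {0..1} \<Longrightarrow> g s \<in> surface t"
    by (auto simp: rectifiable_paths_in_def path_image_def pathstart_def pathfinish_def)
  have near: "dist ?p (g s) < r / 2" if "s \<in> {0..1}" for s
    using dist_path_le_length(1)[OF rect that] g(2) ends(1) that by simp
  have "r \<le> dist ?p 0"
    using norm_triple_ge(2)[of "complex_of_real r" x0 "0::complex"] r by simp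
  then have nz: "g s \<noteq> 0" if "s \<in> {0..1}" for s
    using near[OF that] r by auto
  have nw: "g s \<notin> wall" if "s \<in> {0..1}" for s
    using wall_far[OF _ r, of "fst (g s)" "fst (snd (g s))" "snd (snd (g s))" x0] near[OF that]
    by (auto simp: dist_commute)
  have cont: "continuous_on {0..1} g" using rect by (auto simp: rectifiable_path_def path_def)
  have contr: "continuous_on {0..1} (\<lambda>s. g (1 - s))"
    by (rule continuous_on_compose2[OF cont]) (auto intro!: continuous_intros)
  show ?thesis
  proof
    assume "q \<in> region"
    show "?p \<in> region"
    proof (rule ccontr)
      assume "?p \<notin> region"
      with \<open>q \<in> region\<close> obtain s where "s \<in> {0..1}" "g (1 - s) \<in> wall"
        using path_crosses_wall[OF contr] S nz ends by auto
      then show False using nw[of "1 - s"] by auto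
    qed
  next
    assume "?p \<in> region"
    show "q \<in> region"
      using path_crosses_wall[OF cont] S nz nw ends \<open>?p \<in> region\<close> by auto
  qed
qed

end

lemma thin_wall_exists:
  assumes "t \<noteq> 0"
  obtains \<delta> \<rho> where "thin_wall t \<delta> \<rho>"
proof -
  define \<delta> where "\<delta> = min 1 (norm t / 10)"
  define \<rho> where "\<rho> = min 1 (\<delta> * norm t / 8)"
  have "\<delta> > 0" using assms by (simp add: \<delta>_def)
  then have "thin_wall t \<delta> \<rho>"
    using assms by unfold_locales (auto simp: \<delta>_def[symmetric] \<rho>_def, auto simp: \<delta>_def)
  then show ?thesis by (rule that)
qed

section \<open>Moving points on the undeformed surface\<close>

text \<open>Adding nonnegative reals to \<open>a\<close> with \<open>Re a \<ge> 0\<close> keeps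
  clear of the branch cut. Time enters as \<open>s^(n * k)\<close> because a root is not Lipschitz
  at 0: \<open>norm (w s) \<ge> s^(n * k)\<close> bounds the derivative of the root by
  \<open>\<rho> * k * s^(k - 1)\<close>, uniformly in \<open>a\<close>.\<close>

lemma lift_nth_root:
  fixes a c0 u0 :: complex
  assumes n: "n > 0" and k: "k > 0" and a: "Re a \<ge> 0" and u0: "u0 ^ n = c0 * a"
    and c0: "norm c0 = \<rho> ^ n" and "\<rho> \<ge> 0" and "\<tau> \<ge> 0"
  obtains u where "u 0 = u0"
    "\<And>s. s \<ge> 0 \<Longrightarrow> u s ^ n = c0 * (a + of_real s ^ (n * k))"
    "(\<rho> * (real k * \<tau> ^ (k - 1)))-lipschitz_on {0..\<tau>} u"
proof (cases "a = 0")
  case True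
  \<comment> \<open>\<open>Ln a\<close> has no meaning at the branch point; there the root is
    explicit, \<open>s^k\<close> times a constant.\<close>
  obtain c where c: "c0 = c ^ n" using exists_complex_root[of n c0] n by auto
  have "norm c ^ n = \<rho> ^ n" using c0 by (simp add: c norm_power)
  then have nc: "norm c = \<rho>" using n \<open>\<rho> \<ge> 0\<close> by (simp add: power_eq_iff_eq_base)
  show ?thesis
  proof (rule that[of "\<lambda>s. of_real s ^ k * c"])
    show "of_real 0 ^ k * c = u0" using u0 True k n by simp
    show "(\<rho> * (real k * \<tau> ^ (k - 1)))-lipschitz_on {0..\<tau>} (\<lambda>s. of_real s ^ k * c)"
      using lipschitz_on_power_scaled[OF \<open>\<tau> \<ge> 0\<close>, of k c] by (simp add: nc mult_ac)
  qed (simp add: True c power_mult_distrib power_mult[symmetric] mult.commute)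
next
  case False
  define w where "w s = a + complex_of_real s ^ (n * k)" for s
  define u where "u s = u0 * exp ((Ln (w s) - Ln a) / of_nat n)" for s
  have w_ge: "s ^ (n * k) \<le> norm (w s)" and w_nonpos: "w s \<notin> \<real>\<^sub>\<le>\<^sub>0" if "s \<ge> 0" for s
  proof -
    have Re: "Re (w s) = Re a + s ^ (n * k)" "Im (w s) = Im a"
      by (simp_all add: w_def flip: of_real_power)
    then show "s ^ (n * k) \<le> norm (w s)" using a complex_Re_le_cmod[of "w s"] by linarith
    show "w s \<notin> \<real>\<^sub>\<le>\<^sub>0"
    proof
      assume "w s \<in> \<real>\<^sub>\<le>\<^sub>0"
      then have "Re a + s ^ (n * k) \<le> 0" "Im a = 0" using Re by (auto simp: complex_nonpos_Reals_iff)
      moreover have "s ^ (n * k) \<ge> 0" using that by simp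
      ultimately have "a = 0" using a by (auto simp: complex_eq_iff)
      then show False using False by simp
    qed
  qed
  have w_nz: "w s \<noteq> 0" if "s \<ge> 0" for s using w_nonpos[OF that] by auto
  have w0: "w 0 = a" using n k by (simp add: w_def)
  have u_pow: "u s ^ n = c0 * w s" if "s \<ge> 0" for s
  proof -
    have "u s ^ n = u0 ^ n * exp (Ln (w s) - Ln a)"
      using n by (simp add: u_def power_mult_distrib exp_of_nat_mult[symmetric])
    also have "exp (Ln (w s) - Ln a) = w s / a"
      using w_nz[OF that] False by (simp add: exp_diff)
    finally show ?thesis using False by (simp add: u0)
  qed
  show ?thesis
  proof (rule that[of u])
    show "u 0 = u0" by (simp add: u_def w0)
    show "u s ^ n = c0 * (a + of_real s ^ (n * k))" if "s \<ge> 0" for s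
      using u_pow[OF that] by (simp add: w_def)
    show "(\<rho> * (real k * \<tau> ^ (k - 1)))-lipschitz_on {0..\<tau>} u"
    proof (rule lipschitz_on_vector_derivative_bound
        [where f' = "\<lambda>s. u s * (of_nat k * of_real s ^ (n * k - 1) / w s)"])
      fix s assume s: "s \<in> {0..\<tau>}"
      then have "s \<ge> 0" by simp
      define N where "N = n * k"
      have "((\<lambda>z. u0 * exp ((Ln (a + z ^ N) - Ln a) / of_nat n)) has_field_derivative
          u0 * (exp ((Ln (a + z ^ N) - Ln a) / of_nat n)
            * (of_nat N * z ^ (N - 1) / (a + z ^ N) / of_nat n))) (at z)"
        if "a + z ^ N \<notin> \<real>\<^sub>\<le>\<^sub>0" for z
        using that n by (auto intro!: derivative_eq_intros) (simp add: divide_inverse mult_ac)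
      note deriv = this
      have np: "a + of_real s ^ N \<notin> \<real>\<^sub>\<le>\<^sub>0"
        using w_nonpos[OF \<open>s \<ge> 0\<close>] by (simp add: w_def N_def)
      have cancel: "of_nat N * p / q / of_nat n = of_nat k * p / q" for p q :: complex
        using n by (simp add: N_def)
      have "((\<lambda>z. u0 * exp ((Ln (a + z ^ N) - Ln a) / of_nat n)) has_field_derivative
          u0 * (exp ((Ln (a + of_real s ^ N) - Ln a) / of_nat n)
            * (of_nat k * of_real s ^ (N - 1) / (a + of_real s ^ N)))) (at (of_real s))"
        using deriv[OF np] unfolding cancel .
      then show "(u has_vector_derivative u s * (of_nat k * of_real s ^ (n * k - 1) / w s))
          (at s within {0..\<tau>})"
        unfolding u_def[abs_def] w_def[abs_def] N_def mult.assoc[of u0]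
        by (rule has_vector_derivative_real_field)
      \<comment> \<open>The bound \<open>norm (w s) \<ge> s^(n * k)\<close> is needed to the power
        (n - 1)/n; comparing n-th powers avoids fractional exponents.\<close>
      let ?j = "n * k - k"
      have "(norm (u s) * s ^ ?j) ^ n = \<rho> ^ n * norm (w s) * (s ^ (n * k)) ^ (n - 1)"
      proof -
        have "norm (u s) ^ n = \<rho> ^ n * norm (w s)"
          using u_pow[OF \<open>s \<ge> 0\<close>] by (metis c0 norm_mult norm_power)
        moreover have "s ^ (?j * n) = s ^ (n * k * (n - 1))"
          by (simp add: algebra_simps diff_mult_distrib2)
        ultimately show ?thesis by (simp only: power_mult_distrib power_mult[symmetric])
      qed
      also have "\<dots> \<le> \<rho> ^ n * norm (w s) * norm (w s) ^ (n - 1)"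
        using w_ge \<open>s \<ge> 0\<close> \<open>\<rho> \<ge> 0\<close> by (intro mult_left_mono power_mono) auto
      also have "\<dots> = (\<rho> * norm (w s)) ^ n"
        using n by (cases n) (simp_all add: power_mult_distrib)
      finally have 1: "norm (u s) * s ^ ?j \<le> \<rho> * norm (w s)"
        by (rule power_le_imp_le_base[where n = "n - 1", simplified Suc_diff_1[OF n]])
           (use \<open>\<rho> \<ge> 0\<close> in auto)
      have "n * k - 1 = ?j + (k - 1)" using n k by (cases n) auto
      then have "norm (u s * (of_nat k * of_real s ^ (n * k - 1) / w s))
          = (norm (u s) * s ^ ?j) * (real k * s ^ (k - 1)) / norm (w s)"
        using \<open>s \<ge> 0\<close> by (simp add: norm_mult norm_divide norm_power power_add)
      also have "\<dots> \<le> (\<rho> * norm (w s)) * (real k * s ^ (k - 1)) / norm (w s)"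
        using 1 \<open>s \<ge> 0\<close> by (intro divide_right_mono mult_right_mono) auto
      also have "\<dots> = \<rho> * (real k * s ^ (k - 1))" using w_nz[OF \<open>s \<ge> 0\<close>] by simp
      also have "\<dots> \<le> \<rho> * (real k * \<tau> ^ (k - 1))"
        using s \<open>\<rho> \<ge> 0\<close> by (intro mult_left_mono power_mono) auto
      finally show "norm (u s * (of_nat k * of_real s ^ (n * k - 1) / w s)) \<le> \<rho> * (real k * \<tau> ^ (k - 1))" .
    qed (use assms in auto)
  qed
qed

definition fifth_root_near_1 :: "complex \<Rightarrow> complex" where
  "fifth_root_near_1 w = exp (Ln (1 + w) / 5)"

lemma fifth_root_near_1:
  assumes "norm w \<le> 1/2"
  shows "fifth_root_near_1 w ^ 5 = 1 + w" "norm (fifth_root_near_1 w) \<le> 2" "1 + w \<noteq> 0"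
proof -
  have "1 + w \<noteq> 0"
  proof
    assume "1 + w = 0"
    then have "w = - 1" by (simp add: eq_neg_iff_add_eq_0 add.commute)
    then show False using assms by simp
  qed
  then show 1: "fifth_root_near_1 w ^ 5 = 1 + w" "1 + w \<noteq> 0"
    by (simp_all add: fifth_root_near_1_def exp_of_nat_mult[symmetric])
  have "norm (fifth_root_near_1 w) ^ 5 = norm (1 + w)" by (simp add: 1 flip: norm_power)
  also have "\<dots> \<le> 2 ^ 5" using assms norm_triangle_ineq[of 1 w] by simp
  finally show "norm (fifth_root_near_1 w) \<le> 2" by (rule power_le_imp_le_base[of _ 4, simplified]) simp
qed

text \<open>The derivative is \<open>fifth_root_near_1 z / (5 * (1 + z))\<close>, with numerator of
  norm at most 2 and denominator of norm at least 5/2.\<close>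

lemma fifth_root_near_1_lipschitz:
  assumes "norm w \<le> 1/2" "norm w' \<le> 1/2"
  shows "norm (fifth_root_near_1 w - fifth_root_near_1 w') \<le> norm (w - w')"
proof -
  have "norm (fifth_root_near_1 w - fifth_root_near_1 w') \<le> 1 * norm (w - w')"
  proof (rule field_differentiable_bound)
    show "convex (cball (0::complex) (1/2))" by simp
    fix z :: complex assume "z \<in> cball 0 (1/2)"
    then have z: "norm z \<le> 1/2" by simp
    have "Re (1 + z) > 0" using z abs_Re_le_cmod[of z] by simp
    then have np: "1 + z \<notin> \<real>\<^sub>\<le>\<^sub>0" by (auto simp: complex_nonpos_Reals_iff)
    show "(fifth_root_near_1 has_field_derivative fifth_root_near_1 z / (5 * (1 + z)))
        (at z within cball 0 (1/2))"
      unfolding fifth_root_near_1_def[abs_def] using np fifth_root_near_1(3)[OF z]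
      by (auto intro!: derivative_eq_intros simp del: distrib_left_numeral mult_numeral_left)
         (simp add: inverse_eq_divide)
    have "1/2 \<le> norm (1 + z)" using z norm_diff_ineq[of 1 z] by simp
    then have "norm (fifth_root_near_1 z) \<le> 1 * norm (5 * (1 + z))"
      using fifth_root_near_1(2)[OF z] unfolding norm_mult by simp
    then show "norm (fifth_root_near_1 z / (5 * (1 + z))) \<le> 1"
      unfolding norm_divide using fifth_root_near_1(3)[OF z]
      by (subst pos_divide_le_eq) (simp_all add: norm_mult del: distrib_left_numeral)
  qed (use assms in auto)
  then show ?thesis by simp
qed

section \<open>Moving away from the axes\<close>

lemma surface0_iff: "(x, y, z) \<in> surface 0 \<longleftrightarrow> x ^ 5 + z ^ 15 + y ^ 7 * z = 0"
  by (simp add: surface_def)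

text \<open>On this surface \<open>y\<close> and \<open>z\<close> control \<open>x\<close>, so a
  point at distance of order r from the origin has \<open>y\<close> or \<open>z\<close> of order
  r.\<close>

lemma surface0_x_bound:
  assumes "(x, y, z) \<in> surface 0" "norm y \<le> \<mu>" "norm z \<le> \<mu>" "\<mu> \<le> 1"
  shows "norm x \<le> 2 * \<mu>"
proof -
  have \<mu>: "\<mu> \<ge> 0" using assms(2) norm_ge_zero order_trans by blast
  have "x ^ 5 = - (z ^ 15 + y ^ 7 * z)" using assms(1) unfolding surface0_iff by algebra
  then have "norm x ^ 5 = norm (z ^ 15 + y ^ 7 * z)" by (metis norm_minus_cancel norm_power)
  also have "\<dots> \<le> norm z ^ 15 + norm y ^ 7 * norm z"
    by (rule order_trans[OF norm_triangle_ineq]) (simp add: norm_mult norm_power)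
  also have "\<dots> \<le> \<mu> ^ 15 + \<mu> ^ 7 * \<mu>"
    using assms \<mu> by (intro add_mono mult_mono power_mono) auto
  also have "\<dots> = \<mu> ^ 15 + \<mu> ^ 8" by algebra
  also have "\<dots> \<le> \<mu> ^ 5 + \<mu> ^ 5" using assms(4) \<mu> by (intro add_mono power_decreasing) auto
  also have "\<dots> \<le> (2 * \<mu>) ^ 5" using \<mu> by (simp add: power_mult_distrib)
  finally show ?thesis by (rule power_le_imp_le_base[of _ 4, simplified]) (use \<mu> in simp)
qed

lemma inner_dist_surface0_origin_le:
  assumes "(x, y, z) \<in> surface 0" "norm y \<le> \<mu>" "norm z \<le> \<mu>" "\<mu> \<le> 1"
  shows "inner_dist (surface 0) 0 (x, y, z) \<le> 9 * \<mu>"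
  using inner_dist_origin_le[OF assms(1)] surface0_x_bound[OF assms] assms(2,3) by linarith

text \<open>
  With \<open>m = - x\<^sup>5 / z\<^sup>1\<^sup>5\<close> the section at constant \<open>z\<close> is \<open>y\<^sup>7 = z\<^sup>1\<^sup>4 (m - 1)\<close>. Moving \<open>m\<close>
  vertically away from the real axis keeps clear of the branch points 0 and 1, and the time
  parameter \<open>s\<^sup>3\<^sup>5\<close> makes both roots Lipschitz.
\<close>

lemma surface0_move_y:
  assumes S: "(x, y, z) \<in> surface 0" and z: "z \<noteq> 0" "norm z \<le> 1" and e: "0 < e" "e \<le> 1"
  obtains x' y' where "(x', y', z) \<in> surface 0" "e \<le> norm y'"
    "inner_dist (surface 0) (x, y, z) (x', y', z) \<le> 12 * e"
proof -
  define m where "m = - (x ^ 5) / z ^ 15"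
  \<comment> \<open>The path takes \<open>m\<close> to \<open>m + j * s^35\<close>. With this sign
    both \<open>- j * m\<close> and \<open>- j * (m - 1)\<close> have nonnegative real part, so the
    roots for \<open>x\<close> and \<open>y\<close> can be lifted together.\<close>
  define j where "j = (if Im m \<ge> 0 then \<i> else - \<i>)"
  have j: "j * j = -1" "norm j = 1" by (auto simp: j_def)
  have xm: "x ^ 5 = - (z ^ 15) * m" using z by (simp add: m_def)
  have ym: "y ^ 7 = z ^ 14 * (m - 1)"
  proof -
    have "z * y ^ 7 = z * (z ^ 14 * (m - 1))"
      using S xm unfolding surface0_iff by algebra
    then show ?thesis using z by simp
  qed
  \<comment> \<open>At this time \<open>norm z ^ 14 * \<tau> ^ 35\<close> equals
    \<open>e ^ 7\<close>, the size that \<open>Y ^ 7\<close> has to reach.\<close>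
  define \<tau> where "\<tau> = root 5 (e / norm z ^ 2)"
  have \<tau>0: "\<tau> \<ge> 0" using e by (simp add: \<tau>_def)
  have \<tau>: "norm z ^ 2 * \<tau> ^ 5 = e" using e z by (simp add: \<tau>_def)
  obtain X where X: "X 0 = x" "\<And>s. s \<ge> 0 \<Longrightarrow> X s ^ 5 = (- (z ^ 15) * j) * (- j * m + of_real s ^ (5 * 7))"
    "(norm z ^ 3 * (real 7 * \<tau> ^ (7 - 1)))-lipschitz_on {0..\<tau>} X"
  proof (rule lift_nth_root[of 5 7 "- j * m" x "- (z ^ 15) * j" "norm z ^ 3" \<tau>])
    have "x ^ 5 = - (z ^ 15) * j * (- j * m)" using xm j(1) by algebra
    then show "x ^ 5 = - (z ^ 15) * j * (- j * m)" .
  qed (use \<tau>0 j in \<open>auto simp: j_def norm_mult norm_power power_mult[symmetric]\<close>)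
  obtain Y where Y: "Y 0 = y" "\<And>s. s \<ge> 0 \<Longrightarrow> Y s ^ 7 = (z ^ 14 * j) * (- j * (m - 1) + of_real s ^ (7 * 5))"
    "(norm z ^ 2 * (real 5 * \<tau> ^ (5 - 1)))-lipschitz_on {0..\<tau>} Y"
  proof (rule lift_nth_root[of 7 5 "- j * (m - 1)" y "z ^ 14 * j" "norm z ^ 2" \<tau>])
    show "y ^ 7 = z ^ 14 * j * (- j * (m - 1))" using ym j(1) by algebra
  qed (use \<tau>0 j in \<open>auto simp: j_def norm_mult norm_power power_mult[symmetric]\<close>)
  have inS: "(X s, Y s, z) \<in> surface 0" if "s \<ge> 0" for s
  proof -
    have "X s ^ 5 + z ^ 15 + Y s ^ 7 * z = 0"
      unfolding X(2)[OF that] Y(2)[OF that] using j(1) by simp algebra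
    then show ?thesis by (simp add: surface0_iff)
  qed
  have "norm z ^ 14 * \<tau> ^ 35 \<le> norm z ^ 14 * norm (- j * (m - 1) + of_real \<tau> ^ 35)"
  proof (rule mult_left_mono)
    have "Re (- j * (m - 1)) \<ge> 0" by (auto simp: j_def)
    then have "\<tau> ^ 35 \<le> Re (- j * (m - 1) + of_real \<tau> ^ 35)" by (simp flip: of_real_power)
    also have "\<dots> \<le> norm (- j * (m - 1) + of_real \<tau> ^ 35)" by (rule complex_Re_le_cmod)
    finally show "\<tau> ^ 35 \<le> norm (- j * (m - 1) + of_real \<tau> ^ 35)" .
  qed auto
  also have "\<dots> = norm (Y \<tau> ^ 7)" unfolding Y(2)[OF \<tau>0] by (simp add: norm_mult norm_power j)
  also have "norm z ^ 14 * \<tau> ^ 35 = e ^ 7"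
    by (simp add: \<tau>[symmetric] power_mult_distrib power_mult[symmetric])
  finally have "e ^ 7 \<le> norm (Y \<tau>) ^ 7" by (simp add: norm_power)
  then have Ye: "e \<le> norm (Y \<tau>)" by (rule power_le_imp_le_base[of _ 6, simplified]) simp
  \<comment> \<open>The \<open>x\<close>-part of the length is
    \<open>7 * norm z ^ 3 * \<tau> ^ 7\<close>, that is \<open>7 * e\<close> times
    \<open>norm z * \<tau>^2\<close>; the latter factor has to be bounded by 1.\<close>
  have "(norm z * \<tau> ^ 2) ^ 5 = norm z * (norm z ^ 2 * \<tau> ^ 5) ^ 2" by algebra
  also have "\<dots> \<le> 1 * 1 ^ 2" unfolding \<tau> using z e by (intro mult_mono power_mono) auto
  finally have "(norm z * \<tau> ^ 2) ^ 5 \<le> 1 ^ 5" by simp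
  then have small: "norm z * \<tau> ^ 2 \<le> 1" by (rule power_le_imp_le_base[of _ 4, simplified]) simp
  have "inner_dist (surface 0) (X 0, Y 0, z) (X \<tau>, Y \<tau>, z)
    \<le> (norm z ^ 3 * (real 7 * \<tau> ^ (7 - 1)) + norm z ^ 2 * (real 5 * \<tau> ^ (5 - 1)) + 0) * (\<tau> - 0)"
    by (rule inner_dist_le_lipschitz_interval[OF X(3) Y(3)])
       (use \<tau>0 inS in \<open>auto intro!: lipschitz_onI\<close>)
  also have "\<dots> = 7 * (norm z * \<tau> ^ 2) * (norm z ^ 2 * \<tau> ^ 5) + 5 * (norm z ^ 2 * \<tau> ^ 5)"
    by simp algebra
  also have "\<dots> \<le> 7 * 1 * e + 5 * e"
    unfolding \<tau> using small e by (intro add_mono mult_right_mono mult_left_mono) auto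
  finally show ?thesis using inS[OF \<tau>0] Ye X(1) Y(1) by (intro that[of "X \<tau>" "Y \<tau>"]) auto
qed

text \<open>Push \<open>z\<close> outward on its ray as \<open>s^5 * c\<close>. Then
  \<open>x\<close> is a fifth root of \<open>- y^7 * c\<close> times \<open>s\<close> and a
  correction factor, hence Lipschitz even at \<open>z = 0\<close>. The bound
  \<open>2 * e^14 \<le> norm y ^ 7\<close> keeps that factor on its branch;
  \<open>norm y ^ 7 \<le> e^4\<close> keeps the motion of \<open>x\<close> of order
  \<open>e\<close>.\<close>

lemma surface0_move_z:
  assumes S: "(x, y, z) \<in> surface 0" and y: "y \<noteq> 0" and e: "0 < e" "norm z \<le> e"
    "2 * e ^ 14 \<le> norm y ^ 7" "norm y ^ 7 \<le> e ^ 4"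
  obtains x' z' where "(x', y, z') \<in> surface 0" "norm z' = e"
    "inner_dist (surface 0) (x, y, z) (x', y, z') \<le> 42 * e"
proof -
  define c where "c = (if z = 0 then 1 else sgn z)"
  have c: "norm c = 1" "z = c * of_real (norm z)"
    by (simp add: c_def norm_sgn, simp add: c_def sgn_div_norm scaleR_conv_of_real)
  define s0 s1 where "s0 = root 5 (norm z)" and "s1 = root 5 e"
  have s0: "s0 \<ge> 0" "s0 ^ 5 = norm z" and s1: "s1 > 0" "s1 ^ 5 = e" and s01: "s0 \<le> s1"
    using e by (auto simp: s0_def s1_def)
  define Z where "Z s = complex_of_real s ^ 5 * c" for s
  define w where "w s = complex_of_real s ^ 70 * (c ^ 14 / y ^ 7)" for s
  have w_le: "norm (w s) \<le> 1/2" if "s \<in> {0..s1}" for s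
  proof -
    have "norm (w s) = s ^ 70 / norm y ^ 7"
      using that by (simp add: w_def norm_mult norm_divide norm_power c)
    also have "\<dots> \<le> s1 ^ 70 / norm y ^ 7"
      using that by (intro divide_right_mono power_mono) auto
    also have "s1 ^ 70 = e ^ 14" by (simp add: s1(2)[symmetric] power_mult[symmetric])
    also have "e ^ 14 / norm y ^ 7 \<le> 1/2" using e(3) y by (simp add: divide_le_eq)
    finally show ?thesis .
  qed
  let ?E = "\<lambda>s. fifth_root_near_1 (w s)"
  have w_eq: "Z s ^ 14 = y ^ 7 * w s" for s
    using y by (simp add: Z_def w_def power_mult_distrib power_mult[symmetric])
  have Zs0: "Z s0 = z" using c(2) s0 by (simp add: Z_def mult.commute flip: of_real_power)
  have x5: "x ^ 5 = - (y ^ 7 * z * (1 + w s0))"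
    using S w_eq[of s0] unfolding surface0_iff Zs0 by algebra
  \<comment> \<open>The root is chosen to fit the given \<open>x\<close>. For \<open>z = 0\<close>
    also \<open>x = 0\<close>, and any root fits.\<close>
  obtain c2 where c2: "c2 ^ 5 = - (y ^ 7 * c)" "c2 * of_real s0 * ?E s0 = x"
  proof (cases "z = 0")
    case True
    obtain b where "- (y ^ 7 * c) = b ^ 5" using exists_complex_root[of 5] by auto
    moreover have "x = 0" using S True by (simp add: surface0_iff)
    ultimately show ?thesis using True by (intro that[of b]) (auto simp: s0_def)
  next
    case False
    then have "s0 \<noteq> 0" by (simp add: s0_def)
    have ws: "norm (w s0) \<le> 1/2" using w_le[of s0] s0 s01 by auto
    then have E: "?E s0 ^ 5 = 1 + w s0" "1 + w s0 \<noteq> 0" using fifth_root_near_1 by auto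
    then have Enz: "?E s0 \<noteq> 0" by auto
    have zc: "z = complex_of_real s0 ^ 5 * c" using Zs0 by (simp add: Z_def)
    show ?thesis
    proof (rule that[of "x / (of_real s0 * ?E s0)"])
      show "(x / (of_real s0 * ?E s0)) ^ 5 = - (y ^ 7 * c)"
        using E \<open>s0 \<noteq> 0\<close> by (simp add: power_divide power_mult_distrib x5 zc)
    qed (use Enz \<open>s0 \<noteq> 0\<close> in auto)
  qed
  define X where "X s = c2 * (of_real s * ?E s)" for s
  have sub: "s \<in> {0..s1}" if "s \<in> {s0..s1}" for s using that s0 by auto
  have inS: "(X s, y, Z s) \<in> surface 0" if "s \<in> {s0..s1}" for s
  proof -
    have "X s ^ 5 = - (y ^ 7 * c) * of_real s ^ 5 * (1 + w s)"
      using fifth_root_near_1(1)[OF w_le[OF sub[OF that]]] by (simp add: X_def power_mult_distrib c2)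
    then have "X s ^ 5 = - (y ^ 7 * Z s * (1 + w s))" by (simp add: Z_def)
    then show ?thesis using w_eq[of s] unfolding surface0_iff by algebra
  qed
  have lip_w: "(of_nat 70 * s1 ^ (70 - 1) * norm (c ^ 14 / y ^ 7))-lipschitz_on {0..s1} w"
    unfolding w_def[abs_def] by (rule lipschitz_on_power_scaled) (use s1 in auto)
  have lip_Z: "(of_nat 5 * s1 ^ (5 - 1) * norm c)-lipschitz_on {s0..s1} Z"
    unfolding Z_def[abs_def]
    by (rule lipschitz_on_subset[OF lipschitz_on_power_scaled]) (use s1 s0 in auto)
  \<comment> \<open>37 is 2, for the size of the correction factor, plus 35 for its variation:
    \<open>s1\<close> times the Lipschitz constant of \<open>w\<close> is
    \<open>70 * norm (w s1)\<close>, at most 35.\<close>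
  have lip_X: "(norm c2 * 37)-lipschitz_on {s0..s1} X"
  proof (rule lipschitz_onI)
    fix s s' assume "s \<in> {s0..s1}" "s' \<in> {s0..s1}"
    then have s: "s \<in> {0..s1}" "s' \<in> {0..s1}" using sub by auto
    have "norm (w s - w s') \<le> 70 * s1 ^ 69 * norm (c ^ 14 / y ^ 7) * norm (s - s')"
      using lipschitz_onD[OF lip_w s] by (simp add: dist_norm)
    then have "s1 * norm (w s - w s') \<le> s1 * (70 * s1 ^ 69 * norm (c ^ 14 / y ^ 7) * norm (s - s'))"
      by (rule mult_left_mono) (use s1 in simp)
    also have "\<dots> = 70 * norm (w s1) * norm (s - s')"
      using s1 by (simp add: w_def norm_mult norm_divide norm_power flip: power_Suc)
    also have "\<dots> \<le> 70 * (1/2) * norm (s - s')"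
      using w_le[of s1] s1 by (intro mult_right_mono mult_left_mono) auto
    finally have w: "s1 * norm (w s - w s') \<le> 35 * norm (s - s')" by simp
    have "of_real s * ?E s - of_real s' * ?E s'
        = of_real (s - s') * ?E s + of_real s' * (?E s - ?E s')"
      by (simp add: algebra_simps)
    also have "norm \<dots> \<le> norm (s - s') * norm (?E s) + s' * norm (?E s - ?E s')"
      using s by (intro norm_triangle_le) (simp add: norm_mult del: of_real_diff)
    also have "\<dots> \<le> norm (s - s') * 2 + s1 * norm (w s - w s')"
      using s w_le by (intro add_mono mult_mono fifth_root_near_1 fifth_root_near_1_lipschitz) auto
    also have "\<dots> \<le> 37 * norm (s - s')" using w by simp
    finally have "norm (c2 * (of_real s * ?E s - of_real s' * ?E s')) \<le> norm c2 * (37 * norm (s - s'))"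
      unfolding norm_mult[of c2] by (rule mult_left_mono) simp
    then show "dist (X s) (X s') \<le> norm c2 * 37 * dist s s'"
      by (simp only: X_def dist_norm right_diff_distrib mult.assoc)
  qed simp
  have "inner_dist (surface 0) (X s0, y, Z s0) (X s1, y, Z s1)
      \<le> (norm c2 * 37 + 0 + of_nat 5 * s1 ^ (5 - 1) * norm c) * (s1 - s0)"
    by (rule inner_dist_le_lipschitz_interval[OF lip_X _ lip_Z])
       (use inS s01 in \<open>auto intro!: lipschitz_onI\<close>)
  also have "\<dots> \<le> (norm c2 * 37 + 0 + of_nat 5 * s1 ^ (5 - 1) * norm c) * s1"
    using s0 s1 by (intro mult_left_mono) auto
  also have "\<dots> = 37 * (norm c2 * s1) + 5 * s1 ^ 5"
    by (simp add: c) algebra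
  also have "\<dots> \<le> 37 * e + 5 * e"
  proof -
    have "norm c2 ^ 5 = norm y ^ 7"
      using c2(1) by (metis c(1) mult.right_neutral norm_minus_cancel norm_mult norm_power)
    then have "(norm c2 * s1) ^ 5 = norm y ^ 7 * e" using s1 by (simp add: power_mult_distrib)
    also have "\<dots> \<le> e ^ 4 * e" using e by (intro mult_right_mono) auto
    also have "\<dots> = e ^ 5" by algebra
    finally have "norm c2 * s1 \<le> e" by (rule power_le_imp_le_base[of _ 4, simplified]) (use e in simp)
    then show ?thesis by (simp add: s1(2))
  qed
  finally have d: "inner_dist (surface 0) (X s0, y, Z s0) (X s1, y, Z s1) \<le> 42 * e"
    by simp
  have "X s0 = x" using c2(2) by (simp only: X_def mult.assoc)
  moreover have "norm (Z s1) = e"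
    using s1 by (simp add: Z_def norm_mult norm_power c(1))
  moreover have "(X s1, y, Z s1) \<in> surface 0" by (rule inS) (use s01 in simp)
  ultimately show ?thesis using d Zs0 that by metis
qed

lemma eventually_monomial_less:
  fixes C c :: real
  assumes "c > 0" "n > 0"
  shows "\<forall>\<^sub>F r in at_right 0. C * r ^ n < c"
proof -
  have "((\<lambda>r. C * r ^ n) \<longlongrightarrow> C * 0 ^ n) (at_right 0)" by (intro tendsto_intros)
  moreover have "C * 0 ^ n < c" using assms by (simp add: power_0_left)
  ultimately show ?thesis by (rule order_tendstoD(2))
qed

text \<open>The logarithmic chart needs both \<open>y\<close> and \<open>z\<close> of order r. If
  \<open>z\<close> is large already, \<open>y\<close> is moved at constant \<open>z\<close>;
  otherwise \<open>y\<close> is large and \<open>z\<close> is moved at constant \<open>y\<close>,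
  where small r ensures the power inequalities of that move. The 42 in \<nu> is the larger of the
  two costs.\<close>

lemma surface0_move_off_axes:
  assumes \<kappa>: "\<kappa> > 0" and "\<tau> > 0"
  obtains \<nu> where "\<nu> > 0"
    "\<forall>\<^sub>F r in at_right 0. \<forall>x y z. (x, y, z) \<in> surface 0 \<longrightarrow> norm y \<le> \<Lambda> * r \<longrightarrow> norm z \<le> \<Lambda> * r \<longrightarrow>
       \<kappa> * r \<le> norm y \<or> \<kappa> * r \<le> norm z \<longrightarrow>
       (\<exists>x' y' z'. (x', y', z') \<in> surface 0 \<and> \<nu> * r \<le> norm y' \<and> \<nu> * r \<le> norm z' \<and>
          inner_dist (surface 0) (x, y, z) (x', y', z') \<le> \<tau> * r)"
proof -
  define \<nu> where "\<nu> = min \<kappa> (\<tau> / 42)"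
  have \<nu>: "\<nu> > 0" "\<nu> \<le> \<kappa>" "42 * \<nu> \<le> \<tau>" using assms by (auto simp: \<nu>_def)
  have "\<forall>\<^sub>F r::real in at_right 0. r > 0" by (rule eventually_at_right_less)
  moreover have "\<forall>\<^sub>F r in at_right 0. \<Lambda> * r ^ 1 < 1" "\<forall>\<^sub>F r in at_right 0. \<nu> * r ^ 1 < 1"
    by (intro eventually_monomial_less; simp)+
  moreover have "\<forall>\<^sub>F r in at_right 0. (2 * \<nu> ^ 14) * r ^ 7 < \<kappa> ^ 7" "\<forall>\<^sub>F r in at_right 0. \<Lambda> ^ 7 * r ^ 3 < \<nu> ^ 4"
    using \<nu> \<kappa> by (intro eventually_monomial_less; simp)+
  ultimately have "\<forall>\<^sub>F r in at_right 0. \<forall>x y z. (x, y, z) \<in> surface 0 \<longrightarrow> norm y \<le> \<Lambda> * r \<longrightarrow> norm z \<le> \<Lambda> * r \<longrightarrow>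
       \<kappa> * r \<le> norm y \<or> \<kappa> * r \<le> norm z \<longrightarrow>
       (\<exists>x' y' z'. (x', y', z') \<in> surface 0 \<and> \<nu> * r \<le> norm y' \<and> \<nu> * r \<le> norm z' \<and>
          inner_dist (surface 0) (x, y, z) (x', y', z') \<le> \<tau> * r)"
  proof eventually_elim
    case (elim r)
    have e: "\<nu> * r > 0" "\<nu> * r \<le> 1" "12 * (\<nu> * r) \<le> \<tau> * r" "42 * (\<nu> * r) \<le> \<tau> * r"
      using elim \<nu> mult_right_mono[of "42 * \<nu>" \<tau> r] by auto
    show ?case
    proof (intro allI impI)
      fix x y z
      assume S: "(x, y, z) \<in> surface 0" and le: "norm y \<le> \<Lambda> * r" "norm z \<le> \<Lambda> * r"
        and ge: "\<kappa> * r \<le> norm y \<or> \<kappa> * r \<le> norm z"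
      show "\<exists>x' y' z'. (x', y', z') \<in> surface 0 \<and> \<nu> * r \<le> norm y' \<and> \<nu> * r \<le> norm z' \<and>
          inner_dist (surface 0) (x, y, z) (x', y', z') \<le> \<tau> * r"
      proof (cases "\<nu> * r \<le> norm z")
        case True
        have "z \<noteq> 0" "norm z \<le> 1" using True e le elim by auto
        then obtain x' y' where "(x', y', z) \<in> surface 0" "\<nu> * r \<le> norm y'"
          "inner_dist (surface 0) (x, y, z) (x', y', z) \<le> 12 * (\<nu> * r)"
          using surface0_move_y[OF S] e by metis
        then show ?thesis using True e(3) by (meson order_trans)
      next
        case False
        have "\<nu> * r \<le> \<kappa> * r" using \<nu> elim by (intro mult_right_mono) auto
        then have y: "\<kappa> * r \<le> norm y" "\<nu> * r \<le> norm y" "y \<noteq> 0" using False ge e by auto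
        have "2 * (\<nu> * r) ^ 14 = (2 * \<nu> ^ 14) * r ^ 7 * r ^ 7"
          by (simp add: power_mult_distrib flip: power_add)
        also have "\<dots> \<le> \<kappa> ^ 7 * r ^ 7" using elim by (intro mult_right_mono) auto
        also have "\<dots> \<le> norm y ^ 7"
          unfolding power_mult_distrib[symmetric] using y \<kappa> elim by (intro power_mono) auto
        finally have 1: "2 * (\<nu> * r) ^ 14 \<le> norm y ^ 7" .
        have "norm y ^ 7 \<le> (\<Lambda> * r) ^ 7" using le by (intro power_mono) auto
        also have "\<dots> = (\<Lambda> ^ 7 * r ^ 3) * r ^ 4" by (simp add: power_mult_distrib flip: power_add)
        also have "\<dots> \<le> \<nu> ^ 4 * r ^ 4" using elim by (intro mult_right_mono) auto
        finally have 2: "norm y ^ 7 \<le> (\<nu> * r) ^ 4" by (simp add: power_mult_distrib)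
        have "norm z \<le> \<nu> * r" using False by simp
        from surface0_move_z[OF S y(3) e(1) this 1 2] obtain x' z' where
          "(x', y, z') \<in> surface 0" "norm z' = \<nu> * r"
          "inner_dist (surface 0) (x, y, z) (x', y, z') \<le> 42 * (\<nu> * r)" .
        then show ?thesis using y(2) e(4) by (metis order_refl order_trans)
      qed
    qed
  qed
  then show ?thesis using \<nu>(1) that by blast
qed

section \<open>Logarithmic charts\<close>

text \<open>With \<open>y = r * exp u\<close> and \<open>z = r * exp v\<close> this solves
  \<open>x^5 = - y^7 * z * (1 + z^14 / y^7)\<close>: \<open>root 5 r ^ 8\<close> is r^(8/5), and
  \<open>r^7 * exp (14 * v - 7 * u)\<close> is \<open>z^14 / y^7\<close>. Logarithms make the fifth
  root of \<open>y^7 * z\<close> single-valued.\<close>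

definition chart :: "real \<Rightarrow> complex \<Rightarrow> complex \<Rightarrow> complex \<times> complex \<times> complex" where
  "chart r u v =
     (- (of_real (root 5 r) ^ 8 * exp ((v + 7 * u) / 5)
          * fifth_root_near_1 (of_real r ^ 7 * exp (14 * v - 7 * u))),
      of_real r * exp u, of_real r * exp v)"

lemma chart_x_power:
  assumes "r > 0" "norm (of_real r ^ 7 * exp (14 * v - 7 * u)) \<le> 1/2"
  shows "fst (chart r u v) ^ 5 = - ((of_real r * exp u) ^ 7 * (of_real r * exp v)
     * (1 + of_real r ^ 7 * exp (14 * v - 7 * u)))"
proof -
  have "complex_of_real (root 5 r) ^ 40 = of_real ((root 5 r ^ 5) ^ 8)"
    by (simp flip: power_mult)
  also have "root 5 r ^ 5 = r" using assms(1) by simp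
  finally have r: "complex_of_real (root 5 r) ^ 40 = of_real r ^ 8" by simp
  have "exp ((v + 7 * u) / 5) ^ 5 = exp (of_nat 5 * ((v + 7 * u) / 5))"
    by (rule exp_of_nat_mult[symmetric])
  also have "of_nat 5 * ((v + 7 * u) / 5) = v + of_nat 7 * u" by simp
  also have "exp \<dots> = exp v * exp u ^ 7" by (simp only: exp_add exp_of_nat_mult)
  finally have ex: "exp ((v + 7 * u) / 5) ^ 5 = exp v * exp u ^ 7" .
  have "fst (chart r u v) ^ 5 = - ((of_real (root 5 r) ^ 8) ^ 5 * exp ((v + 7 * u) / 5) ^ 5
       * fifth_root_near_1 (of_real r ^ 7 * exp (14 * v - 7 * u)) ^ 5)"
    by (simp add: chart_def power_mult_distrib)
  also have "(complex_of_real (root 5 r) ^ 8) ^ 5 = of_real r ^ 8"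
    using r by (simp flip: power_mult)
  finally show ?thesis
    unfolding ex fifth_root_near_1(1)[OF assms(2)] by algebra
qed

lemma chart_in_surface0:
  assumes "r > 0" "norm (of_real r ^ 7 * exp (14 * v - 7 * u)) \<le> 1/2"
  shows "chart r u v \<in> surface 0"
proof -
  obtain x where x: "chart r u v = (x, of_real r * exp u, of_real r * exp v)"
    by (simp add: chart_def)
  have "exp (14 * v - 7 * u) * exp u ^ 7 = exp v ^ 14"
    by (simp flip: exp_of_nat_mult exp_add)
  moreover have "x ^ 5 = - ((of_real r * exp u) ^ 7 * (of_real r * exp v)
     * (1 + of_real r ^ 7 * exp (14 * v - 7 * u)))"
    using chart_x_power[OF assms] by (simp add: x)
  ultimately show ?thesis unfolding x surface0_iff by algebra
qed

text \<open>\<open>y\<close> and \<open>z\<close> fix \<open>u\<close> and \<open>v\<close> up to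
  periods, and \<open>x\<close> up to a fifth root of unity. Adding \<open>2 * pi * k * \<i>\<close>
  to \<open>v\<close> multiplies \<open>x\<close> by \<open>exp (2 * pi * \<i> * k / 5)\<close>, so
  the shifts with \<open>k < 5\<close> reach all five sheets; hence the wider range of
  \<open>Im v\<close>.\<close>

lemma chart_surj:
  assumes r: "r > 0" and S: "(x, y, z) \<in> surface 0" and y: "y \<noteq> 0" and z: "z \<noteq> 0"
    and small: "2 * norm z ^ 14 \<le> norm y ^ 7"
  obtains u v where "chart r u v = (x, y, z)"
    "Re u = ln (norm y / r)" "Re v = ln (norm z / r)" "\<bar>Im u\<bar> \<le> pi" "\<bar>Im v\<bar> \<le> 10 * pi"
proof -
  define u where "u = Ln (y / of_real r)"
  define v where "v k = Ln (z / of_real r) + of_real (2 * pi * real k) * \<i>" for k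
  have eu: "of_real r * exp u = y" using r y by (simp add: u_def)
  have e2: "exp (of_real (2 * pi * real k) * \<i>) = 1" for k
    by (metis exp_two_pi_i' mult.assoc mult.commute exp_of_nat_mult of_real_mult of_real_of_nat_eq
        of_real_numeral power_one)
  have ev: "of_real r * exp (v k) = z" for k using r z by (simp add: v_def exp_add e2 del: of_real_mult)
  have w: "of_real r ^ 7 * exp (14 * v k - 7 * u) = z ^ 14 / y ^ 7" for k
  proof -
    have "exp (14 * v k - 7 * u) * exp u ^ 7 = exp (v k) ^ 14"
      by (simp flip: exp_of_nat_mult exp_add)
    then have "of_real r ^ 7 * exp (14 * v k - 7 * u) * y ^ 7 = z ^ 14"
      unfolding eu[symmetric] ev[of k, symmetric] by algebra
    then show ?thesis using y by (simp add: eq_divide_eq)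
  qed
  have wle: "norm (z ^ 14 / y ^ 7) \<le> 1/2"
    using small y by (simp add: norm_divide norm_power divide_le_eq)
  define X where "X k = fst (chart r u (v k))" for k
  have chart: "chart r u (v k) = (X k, y, z)" for k
    by (simp add: X_def prod_eq_iff chart_def eu ev)
  have X5: "X k ^ 5 = - (y ^ 7 * z * (1 + z ^ 14 / y ^ 7))" for k
    unfolding X_def using chart_x_power[OF r, of "v k" u] wle by (simp add: w eu ev)
  have "X 0 ^ 5 \<noteq> 0" using y z fifth_root_near_1(3)[OF wle] by (simp add: X5)
  then have X0: "X 0 \<noteq> 0" by auto
  have "x ^ 5 = X 0 ^ 5"
  proof -
    have "y ^ 7 * z * (1 + z ^ 14 / y ^ 7) = z ^ 15 + y ^ 7 * z"
      using y by (simp add: field_simps flip: power_Suc)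
    then show ?thesis using S unfolding X5 surface0_iff by algebra
  qed
  then have "(x / X 0) ^ 5 = 1" using X0 by (simp add: power_divide)
  then have "x / X 0 \<in> (\<lambda>j. exp (2 * of_real pi * \<i> * of_nat j / of_nat 5)) ` {..<5}"
    using complex_roots_unity[of 5] by (simp add: lessThan_def image_def) blast
  then obtain k where k: "k < 5" "x = X 0 * exp (2 * of_real pi * \<i> * of_nat k / of_nat 5)"
    using X0 by (auto simp: field_simps)
  have "X k = X 0 * exp (2 * of_real pi * \<i> * of_nat k / of_nat 5)"
  proof -
    have "(v k + 7 * u) / 5 = (v 0 + 7 * u) / 5 + 2 * of_real pi * \<i> * of_nat k / of_nat 5"
      by (simp add: v_def field_simps)
    then have "exp ((v k + 7 * u) / 5) = exp ((v 0 + 7 * u) / 5) * exp (2 * of_real pi * \<i> * of_nat k / of_nat 5)"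
      by (simp only: exp_add)
    then show ?thesis unfolding X_def chart_def w by simp
  qed
  then have "chart r u (v k) = (x, y, z)" using k chart by simp
  moreover have "Re u = ln (norm y / r)" "\<bar>Im u\<bar> \<le> pi"
    using y r Im_Ln_le_pi[of "y / of_real r"] mpi_less_Im_Ln[of "y / of_real r"]
    by (auto simp: u_def Re_Ln norm_divide abs_le_iff)
  moreover have "Re (v k) = ln (norm z / r)" using z r by (simp add: v_def Re_Ln norm_divide)
  moreover have "\<bar>Im (v k)\<bar> \<le> 10 * pi"
  proof -
    have "\<bar>Im (Ln (z / of_real r))\<bar> \<le> pi"
      using z r Im_Ln_le_pi[of "z / of_real r"] mpi_less_Im_Ln[of "z / of_real r"] by (auto simp: abs_le_iff)
    moreover have "0 \<le> 2 * pi * real k" "2 * pi * real k \<le> 2 * pi * 4"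
      using k(1) by (auto intro!: mult_left_mono)
    moreover have "Im (v k) = Im (Ln (z / of_real r)) + 2 * pi * real k" by (simp add: v_def)
    ultimately show ?thesis by linarith
  qed
  ultimately show ?thesis using that by blast
qed

section \<open>Lipschitz bounds for the chart\<close>

lemma exp_lipschitz_left_half_plane:
  fixes a b :: complex
  assumes "Re a \<le> M" "Re b \<le> M"
  shows "norm (exp a - exp b) \<le> exp M * norm (a - b)"
proof (rule field_differentiable_bound)
  show "convex {z. Re z \<le> M}" by (rule convex_halfspace_Re_le)
  show "(exp has_field_derivative exp z) (at z within {z. Re z \<le> M})" for z :: complex
    by (rule DERIV_subset[OF DERIV_exp]) simp
qed (use assms in auto)

text \<open>\<open>exp\<close> is injective only locally. For differences of norm at most 1/4 the
  derivative of \<open>exp z - z\<close> has norm at most 1/2, so at least half of the difference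
  survives, up to the factor \<open>exp (Re b)\<close>.\<close>

lemma exp_lower_lipschitz:
  fixes a b :: complex
  assumes "norm (a - b) \<le> 1/4" "- L \<le> Re b"
  shows "norm (a - b) \<le> 2 * exp L * norm (exp a - exp b)"
proof -
  let ?d = "a - b"
  have e1: "norm (exp z - 1) \<le> 1/2" if "z \<in> cball 0 (1/4)" for z :: complex
  proof -
    have z: "norm z \<le> 1/4" using that by simp
    have "norm (exp z - exp 0) \<le> exp (1/4) * norm (z - 0)"
      using z complex_Re_le_cmod[of z] by (intro exp_lipschitz_left_half_plane) auto
    also have "\<dots> \<le> (1 + 2 * (1/4)) * (1/4)"
      using z exp_bound[of "1/4"] by (intro mult_mono) (auto simp: power2_eq_square)
    finally show ?thesis by simp
  qed
  have "norm ((exp ?d - ?d) - (exp 0 - 0)) \<le> 1/2 * norm (?d - 0)"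
  proof (rule field_differentiable_bound)
    show "((\<lambda>z. exp z - z) has_field_derivative exp z - 1) (at z within cball 0 (1/4))" for z :: complex
      by (auto intro!: derivative_eq_intros)
  qed (use e1 assms in auto)
  then have "norm ?d / 2 \<le> norm (exp ?d - 1)"
    using norm_triangle_ineq2[of ?d "exp ?d - 1"] by (simp add: norm_minus_commute algebra_simps)
  then have "exp (- L) * (norm ?d / 2) \<le> norm (exp b) * norm (exp ?d - 1)"
    using assms(2) by (intro mult_mono) auto
  also have "\<dots> = norm (exp b * (exp ?d - 1))" by (simp only: norm_mult)
  also have "exp b * (exp ?d - 1) = exp a - exp b" by (simp add: right_diff_distrib flip: exp_add)
  finally have "exp L * (exp (- L) * (norm ?d / 2)) \<le> exp L * norm (exp a - exp b)"
    by (intro mult_left_mono) auto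
  also have "exp L * (exp (- L) * (norm ?d / 2)) = norm ?d / 2"
    by (simp add: exp_minus)
  finally show ?thesis by simp
qed

text \<open>21 is 14 + 7. For fixed \<open>L\<close> the correction \<open>z^14 / y^7\<close> tends
  to 0 with r.\<close>

lemma chart_box_bounds:
  assumes r: "0 < r" and L: "r ^ 7 * exp (21 * L) \<le> 1/2" and u: "\<bar>Re u\<bar> \<le> L" and v: "\<bar>Re v\<bar> \<le> L"
  shows "norm (of_real r ^ 7 * exp (14 * v - 7 * u)) \<le> r ^ 7 * exp (21 * L)"
    and "norm (of_real r ^ 7 * exp (14 * v - 7 * u)) \<le> 1/2"
proof -
  have "norm (of_real r ^ 7 * exp (14 * v - 7 * u)) = r ^ 7 * exp (Re (14 * v - 7 * u))"
    using r by (simp add: norm_mult norm_power)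
  also have "\<dots> \<le> r ^ 7 * exp (21 * L)"
    using u v r by (intro mult_left_mono) (auto simp: abs_le_iff)
  finally show "norm (of_real r ^ 7 * exp (14 * v - 7 * u)) \<le> r ^ 7 * exp (21 * L)" .
  then show "norm (of_real r ^ 7 * exp (14 * v - 7 * u)) \<le> 1/2" using L by simp
qed

lemma root5_power8_le:
  assumes "0 < r" "r \<le> 1"
  shows "0 \<le> root 5 r ^ 8" "root 5 r ^ 8 \<le> r"
proof -
  show "0 \<le> root 5 r ^ 8" using assms by simp
  have "root 5 r ^ 8 \<le> root 5 r ^ 5" using assms by (intro power_decreasing) auto
  also have "\<dots> = r" using assms by simp
  finally show "root 5 r ^ 8 \<le> r" .
qed

text \<open>Product rule for the exponential and the correction factor, with 11 = 2 * 2 + 7. The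
  prefactor r^(8/5) is estimated by r.\<close>

lemma chart_x_lipschitz:
  assumes r: "0 < r" "r \<le> 1" and L: "r ^ 7 * exp (21 * L) \<le> 1/2"
    and u: "\<bar>Re u\<bar> \<le> L" "\<bar>Re u'\<bar> \<le> L" and v: "\<bar>Re v\<bar> \<le> L" "\<bar>Re v'\<bar> \<le> L"
  shows "norm (fst (chart r u v) - fst (chart r u' v'))
    \<le> 11 * r * exp (2 * L) * (norm (u - u') + norm (v - v'))"
    and "norm (fst (chart r u v)) \<le> 2 * r * exp (2 * L)"
proof -
  let ?D = "norm (u - u') + norm (v - v')"
  define E where "E u v = exp ((v + 7 * u) / 5)" for u v :: complex
  define w where "w u v = of_real r ^ 7 * exp (14 * v - 7 * u)" for u v :: complex
  let ?F = "\<lambda>u v. fifth_root_near_1 (w u v)"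
  have w: "norm (w u v) \<le> 1/2" "norm (w u' v') \<le> 1/2"
    unfolding w_def using chart_box_bounds(2)[OF r(1) L] u v by auto
  have ReE: "Re ((v + 7 * u) / 5) \<le> 2 * L" "Re ((v' + 7 * u') / 5) \<le> 2 * L"
    using u v by (auto simp: abs_le_iff)
  have E: "norm (E u v) \<le> exp (2 * L)" "norm (E u' v') \<le> exp (2 * L)"
    using ReE by (simp_all add: E_def)
  have dE: "norm (E u v - E u' v') \<le> exp (2 * L) * (2 * ?D)"
  proof -
    have "norm (E u v - E u' v') \<le> exp (2 * L) * norm ((v + 7 * u) / 5 - (v' + 7 * u') / 5)"
      unfolding E_def by (rule exp_lipschitz_left_half_plane[OF ReE])
    also have "(v + 7 * u) / 5 - (v' + 7 * u') / 5 = ((v - v') + 7 * (u - u')) / 5"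
      by (simp add: field_simps)
    also have "norm \<dots> \<le> (norm (v - v') + 7 * norm (u - u')) / 5"
      using norm_triangle_ineq[of "v - v'" "7 * (u - u')"]
      by (simp add: norm_divide norm_mult del: distrib_left_numeral right_diff_distrib_numeral)
    also have "\<dots> \<le> 2 * ?D" by (simp add: divide_le_eq)
    finally show ?thesis by simp
  qed
  have dF: "norm (?F u v - ?F u' v') \<le> 7 * ?D"
  proof -
    have "norm (?F u v - ?F u' v') \<le> norm (w u v - w u' v')"
      by (rule fifth_root_near_1_lipschitz[OF w])
    also have "\<dots> = r ^ 7 * norm (exp (14 * v - 7 * u) - exp (14 * v' - 7 * u'))"
      using r by (simp add: w_def norm_mult norm_power flip: right_diff_distrib)
    also have "\<dots> \<le> r ^ 7 * (exp (21 * L) * norm ((14 * v - 7 * u) - (14 * v' - 7 * u')))"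
      using r u v by (intro mult_left_mono exp_lipschitz_left_half_plane) (auto simp: abs_le_iff)
    also have "\<dots> = (r ^ 7 * exp (21 * L)) * norm ((14 * v - 7 * u) - (14 * v' - 7 * u'))" by simp
    also have "\<dots> \<le> 1/2 * norm ((14 * v - 7 * u) - (14 * v' - 7 * u'))"
      by (rule mult_right_mono[OF L]) simp
    also have "(14 * v - 7 * u) - (14 * v' - 7 * u') = 14 * (v - v') - 7 * (u - u')"
      by (simp add: algebra_simps)
    also have "norm \<dots> \<le> 14 * norm (v - v') + 7 * norm (u - u')"
      using norm_triangle_ineq4[of "14 * (v - v')" "7 * (u - u')"]
      by (simp add: norm_mult del: right_diff_distrib_numeral)
    finally show ?thesis using norm_ge_zero[of "u - u'"] unfolding distrib_left by linarith
  qed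
  let ?R = "complex_of_real (root 5 r) ^ 8"
  have R: "norm ?R \<le> r" using root5_power8_le[OF r] r by (simp add: norm_power)
  have x: "fst (chart r u v) = - (?R * (E u v * ?F u v))" for u v
    by (simp add: chart_def E_def w_def mult.assoc)
  have "E u v * ?F u v - E u' v' * ?F u' v' = (E u v - E u' v') * ?F u v + E u' v' * (?F u v - ?F u' v')"
    by (simp add: algebra_simps)
  also have "norm \<dots> \<le> norm (E u v - E u' v') * norm (?F u v) + norm (E u' v') * norm (?F u v - ?F u' v')"
    by (rule order_trans[OF norm_triangle_ineq]) (simp add: norm_mult)
  also have "\<dots> \<le> exp (2 * L) * (2 * ?D) * 2 + exp (2 * L) * (7 * ?D)"
    by (intro add_mono mult_mono dE dF E fifth_root_near_1(2) w) auto
  finally have d: "norm (E u v * ?F u v - E u' v' * ?F u' v') \<le> 11 * exp (2 * L) * ?D"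
    by (simp add: algebra_simps)
  have "norm (fst (chart r u v) - fst (chart r u' v'))
      = norm ?R * norm (E u v * ?F u v - E u' v' * ?F u' v')"
    unfolding x norm_mult[symmetric] by (simp add: right_diff_distrib norm_minus_commute)
  also have "\<dots> \<le> r * (11 * exp (2 * L) * ?D)"
    using r by (intro mult_mono R d) auto
  finally show "norm (fst (chart r u v) - fst (chart r u' v')) \<le> 11 * r * exp (2 * L) * ?D"
    by (simp add: mult_ac)
  have "norm (fst (chart r u v)) = norm ?R * (norm (E u v) * norm (?F u v))"
    unfolding x by (simp add: norm_mult)
  also have "\<dots> \<le> r * (exp (2 * L) * 2)"
    using r by (intro mult_mono R E fifth_root_near_1(2) w) auto
  finally show "norm (fst (chart r u v)) \<le> 2 * r * exp (2 * L)" by (simp add: mult_ac)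
qed

lemma inner_dist_chart_origin_le:
  assumes r: "0 < r" "r \<le> 1" and L: "r ^ 7 * exp (21 * L) \<le> 1/2"
    and u: "\<bar>Re u\<bar> \<le> L" and v: "\<bar>Re v\<bar> \<le> L"
  shows "inner_dist (surface 0) 0 (chart r u v) \<le> 9 * exp (2 * L) * r"
proof -
  obtain x where x: "chart r u v = (x, of_real r * exp u, of_real r * exp v)"
    by (simp add: chart_def)
  have S: "(x, of_real r * exp u, of_real r * exp v) \<in> surface 0"
    using chart_in_surface0[OF r(1) chart_box_bounds(2)[OF r(1) L u v]] x by simp
  have "norm x \<le> 2 * r * exp (2 * L)"
    using chart_x_lipschitz(2)[OF r L u u v v] x by simp
  moreover have "norm (of_real r * exp u) \<le> r * exp (2 * L)" "norm (of_real r * exp v) \<le> r * exp (2 * L)"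
    using r u v by (auto simp: norm_mult abs_le_iff)
  ultimately show ?thesis
    using inner_dist_origin_le[OF S] x by (simp add: mult_ac)
qed

text \<open>The box is convex, so the segment in logarithmic coordinates stays in it, and its image
  is a curve on the surface whose length carries the factor r.\<close>

lemma inner_dist_chart_le:
  assumes r: "0 < r" "r \<le> 1" and L: "r ^ 7 * exp (21 * L) \<le> 1/2"
    and u: "\<bar>Re u\<bar> \<le> L" "\<bar>Re u'\<bar> \<le> L" and v: "\<bar>Re v\<bar> \<le> L" "\<bar>Re v'\<bar> \<le> L"
  shows "inner_dist (surface 0) (chart r u v) (chart r u' v')
    \<le> 13 * exp (2 * L) * r * (norm (u - u') + norm (v - v'))"
proof -
  let ?D = "norm (u - u') + norm (v - v')"
  define U where "U s = u + of_real s * (u' - u)" for s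
  define V where "V s = v + of_real s * (v' - v)" for s
  have convex_le: "\<bar>a + s * (b - a)\<bar> \<le> L" if "\<bar>a\<bar> \<le> L" "\<bar>b\<bar> \<le> L" "s \<in> {0..1}" for a b s :: real
  proof -
    have "a + s * (b - a) = (1 - s) * a + s * b" by (simp add: algebra_simps)
    moreover have "\<bar>\<dots>\<bar> \<le> (1 - s) * \<bar>a\<bar> + s * \<bar>b\<bar>"
      using that by (intro order_trans[OF abs_triangle_ineq]) (simp add: abs_mult)
    moreover have "\<dots> \<le> (1 - s) * L + s * L"
      using that by (intro add_mono mult_left_mono) auto
    ultimately show ?thesis by (simp add: algebra_simps)
  qed
  have UL: "\<bar>Re (U s)\<bar> \<le> L" and VL: "\<bar>Re (V s)\<bar> \<le> L" if "s \<in> {0..1}" for s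
    using convex_le[of "Re u" "Re u'" s] convex_le[of "Re v" "Re v'" s] that u v
    by (simp_all add: U_def V_def)
  have dU: "norm (U s - U s') = norm (s - s') * norm (u - u')" for s s'
  proof -
    have "U s - U s' = of_real (s - s') * (u' - u)" by (simp add: U_def algebra_simps)
    then show ?thesis by (simp add: norm_mult norm_minus_commute del: of_real_diff)
  qed
  have dV: "norm (V s - V s') = norm (s - s') * norm (v - v')" for s s'
  proof -
    have "V s - V s' = of_real (s - s') * (v' - v)" by (simp add: V_def algebra_simps)
    then show ?thesis by (simp add: norm_mult norm_minus_commute del: of_real_diff)
  qed
  let ?X = "\<lambda>s. fst (chart r (U s) (V s))"
  have ex: "norm (exp a - exp b) \<le> exp (2 * L) * norm (a - b)" if "\<bar>Re a\<bar> \<le> L" "\<bar>Re b\<bar> \<le> L" for a b :: complex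
    using that by (intro exp_lipschitz_left_half_plane) (auto simp: abs_le_iff)
  have chart: "chart r (U s) (V s) = (?X s, of_real r * exp (U s), of_real r * exp (V s))" for s
    by (simp add: chart_def)
  have "inner_dist (surface 0) (?X 0, of_real r * exp (U 0), of_real r * exp (V 0))
      (?X 1, of_real r * exp (U 1), of_real r * exp (V 1))
    \<le> (11 * r * exp (2 * L) * ?D + r * exp (2 * L) * norm (u - u') + r * exp (2 * L) * norm (v - v')) * (1 - 0)"
  proof (rule inner_dist_le_lipschitz_interval)
    show "(11 * r * exp (2 * L) * ?D)-lipschitz_on {0..1} ?X"
    proof (rule lipschitz_onI)
      fix s s' :: real assume s: "s \<in> {0..1}" "s' \<in> {0..1}"
      have "norm (?X s - ?X s') \<le> 11 * r * exp (2 * L) * (norm (U s - U s') + norm (V s - V s'))"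
        by (rule chart_x_lipschitz(1)[OF r L UL UL VL VL]) (use s in auto)
      then show "dist (?X s) (?X s') \<le> 11 * r * exp (2 * L) * ?D * dist s s'"
        by (simp add: dist_norm dU dV algebra_simps)
    qed (use r in simp)
    show "(r * exp (2 * L) * norm (u - u'))-lipschitz_on {0..1} (\<lambda>s. of_real r * exp (U s))"
    proof (rule lipschitz_onI)
      fix s s' :: real assume s: "s \<in> {0..1}" "s' \<in> {0..1}"
      show "dist (of_real r * exp (U s)) (of_real r * exp (U s')) \<le> r * exp (2 * L) * norm (u - u') * dist s s'"
        using mult_left_mono[OF ex[OF UL[OF s(1)] UL[OF s(2)]], of r] r
        by (simp add: dist_norm dU norm_mult mult_ac flip: right_diff_distrib)
    qed (use r in simp)
    show "(r * exp (2 * L) * norm (v - v'))-lipschitz_on {0..1} (\<lambda>s. of_real r * exp (V s))"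
    proof (rule lipschitz_onI)
      fix s s' :: real assume s: "s \<in> {0..1}" "s' \<in> {0..1}"
      show "dist (of_real r * exp (V s)) (of_real r * exp (V s')) \<le> r * exp (2 * L) * norm (v - v') * dist s s'"
        using mult_left_mono[OF ex[OF VL[OF s(1)] VL[OF s(2)]], of r] r
        by (simp add: dist_norm dV norm_mult mult_ac flip: right_diff_distrib)
    qed (use r in simp)
    show "(?X s, of_real r * exp (U s), of_real r * exp (V s)) \<in> surface 0" if "s \<in> {0..1}" for s
      using chart_in_surface0[OF r(1) chart_box_bounds(2)[OF r(1) L UL[OF that] VL[OF that]]]
      by (simp only: chart[symmetric])
  qed simp
  also have "\<dots> = 12 * exp (2 * L) * r * ?D" by (simp add: algebra_simps)
  also have "\<dots> \<le> 13 * exp (2 * L) * r * ?D" using r by (intro mult_right_mono) auto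
  finally show ?thesis unfolding chart[symmetric] by (simp add: U_def V_def)
qed

section \<open>The contradiction\<close>

lemma neighborhood_in_ball:
  assumes "neighborhood_in m p U"
  obtains R where "R > 0" "\<And>q. q \<in> mspace m \<Longrightarrow> mdist m p q < R \<Longrightarrow> q \<in> U"
proof -
  interpret Metric_space "mspace m" "mdist m" by (rule Metric_space_mspace_mdist)
  obtain W where W: "openin (mtopology_of m) W" "p \<in> W" "W \<subseteq> U"
    using assms by (auto simp: neighborhood_in_def)
  then have "openin mtopology W" by (simp add: mtopology_of_def)
  then have "W \<subseteq> mspace m" "\<exists>R>0. mball p R \<subseteq> W"
    using W(2) unfolding openin_mtopology by blast+
  then obtain R where "R > 0" "mball p R \<subseteq> W" "p \<in> mspace m"
    using W(2) by blast
  then show ?thesis using W(3) by (intro that[of R]) auto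
qed

lemma bilipschitz_homeomorphic_germsE:
  assumes "bilipschitz_homeomorphic_germs m p m' q"
  obtains U V f g K R where "1 \<le> K" "0 < R" "U \<subseteq> mspace m" "V \<subseteq> mspace m'" "p \<in> U" "f p = q"
    "\<And>a. a \<in> U \<Longrightarrow> f a \<in> V \<and> g (f a) = a" "\<And>b. b \<in> V \<Longrightarrow> g b \<in> U \<and> f (g b) = b"
    "\<And>a a'. a \<in> U \<Longrightarrow> a' \<in> U \<Longrightarrow> mdist m' (f a) (f a') \<le> K * mdist m a a'"
    "\<And>b b'. b \<in> V \<Longrightarrow> b' \<in> V \<Longrightarrow> mdist m (g b) (g b') \<le> K * mdist m' b b'"
    "\<And>a. a \<in> mspace m \<Longrightarrow> mdist m p a < R \<Longrightarrow> a \<in> U"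
    "\<And>b. b \<in> mspace m' \<Longrightarrow> mdist m' q b < R \<Longrightarrow> b \<in> V"
proof -
  obtain U V f where U: "neighborhood_in m p U" and V: "neighborhood_in m' q V"
    and f: "bilipschitz_homeomorphism (submetric m U) (submetric m' V) f" and fp: "f p = q"
    using assms by (auto simp: bilipschitz_homeomorphic_germs_def)
  have sub: "U \<subseteq> mspace m" "V \<subseteq> mspace m'" "p \<in> U" using U V by (auto simp: neighborhood_in_def)
  then have mU: "mspace (submetric m U) = U" and mV: "mspace (submetric m' V) = V"
    by auto
  obtain g where hom: "homeomorphic_maps (mtopology_of (submetric m U)) (mtopology_of (submetric m' V)) f g"
    and lf: "Lipschitz_continuous_map (submetric m U) (submetric m' V) f"
    and lg: "Lipschitz_continuous_map (submetric m' V) (submetric m U) g"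
    using f by (auto simp: bilipschitz_homeomorphism_def)
  obtain B1 where B1: "\<And>a a'. a \<in> U \<Longrightarrow> a' \<in> U \<Longrightarrow> mdist m' (f a) (f a') \<le> B1 * mdist m a a'"
    and fU: "f \<in> U \<rightarrow> V"
    using lf by (auto simp: Lipschitz_continuous_map_def mU mV simp del: mspace_submetric)
  obtain B2 where B2: "\<And>b b'. b \<in> V \<Longrightarrow> b' \<in> V \<Longrightarrow> mdist m (g b) (g b') \<le> B2 * mdist m' b b'"
    and gV: "g \<in> V \<rightarrow> U"
    using lg by (auto simp: Lipschitz_continuous_map_def mU mV simp del: mspace_submetric)
  have inv: "a \<in> U \<Longrightarrow> g (f a) = a" "b \<in> V \<Longrightarrow> f (g b) = b" for a b
    using hom by (auto simp: homeomorphic_maps_def mU mV simp del: mspace_submetric)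
  obtain R1 where R1: "R1 > 0" "\<And>a. a \<in> mspace m \<Longrightarrow> mdist m p a < R1 \<Longrightarrow> a \<in> U"
    using neighborhood_in_ball[OF U] by metis
  obtain R2 where R2: "R2 > 0" "\<And>b. b \<in> mspace m' \<Longrightarrow> mdist m' q b < R2 \<Longrightarrow> b \<in> V"
    using neighborhood_in_ball[OF V] by metis
  define K where "K = max 1 (max B1 B2)"
  have K: "B1 \<le> K" "B2 \<le> K" "1 \<le> K" by (auto simp: K_def)
  show ?thesis
  proof (rule that[of K "min R1 R2" U V f g])
    show "mdist m' (f a) (f a') \<le> K * mdist m a a'" if "a \<in> U" "a' \<in> U" for a a'
      using B1[OF that] mult_right_mono[OF K(1) mdist_nonneg[of m a a']] by linarith
    show "mdist m (g b) (g b') \<le> K * mdist m' b b'" if "b \<in> V" "b' \<in> V" for b b'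
      using B2[OF that] mult_right_mono[OF K(2) mdist_nonneg[of m' b b']] by linarith
  qed (use K sub fp fU gV inv R1 R2 in auto)
qed

abbreviation real4_chart :: "real \<Rightarrow> real^4 \<Rightarrow> complex \<times> complex \<times> complex" where
  "real4_chart r c \<equiv> chart r (Complex (c $ 1) (c $ 2)) (Complex (c $ 3) (c $ 4))"

lemma inner_dist_real4_chart_le:
  assumes r: "0 < r" "r \<le> 1" and L: "r ^ 7 * exp (21 * L) \<le> 1/2"
    and c: "\<And>i. \<bar>c $ i\<bar> \<le> L" "\<And>i. \<bar>c' $ i\<bar> \<le> L" and h: "\<And>i. \<bar>c $ i - c' $ i\<bar> \<le> h"
  shows "inner_dist (surface 0) (real4_chart r c) (real4_chart r c') \<le> 52 * exp (2 * L) * r * h"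
proof -
  have d: "norm (Complex (c $ i) (c $ j) - Complex (c' $ i) (c' $ j)) \<le> 2 * h" for i j
    using cmod_le[of "Complex (c $ i) (c $ j) - Complex (c' $ i) (c' $ j)"] h[of i] h[of j] by simp
  have "inner_dist (surface 0) (real4_chart r c) (real4_chart r c') \<le> 13 * exp (2 * L) * r *
     (norm (Complex (c $ 1) (c $ 2) - Complex (c' $ 1) (c' $ 2))
      + norm (Complex (c $ 3) (c $ 4) - Complex (c' $ 3) (c' $ 4)))"
    by (rule inner_dist_chart_le[OF r L]) (use c in auto)
  also have "\<dots> \<le> 13 * exp (2 * L) * r * (2 * h + 2 * h)"
    using r by (intro mult_left_mono add_mono d) auto
  finally show ?thesis by simp
qed

text \<open>The coordinates \<open>y\<close> and \<open>z\<close> alone bound the distance from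
  below. Differences of 1/8 per real coordinate give at most 1/4 per complex one, the range of
  \<open>exp_lower_lipschitz\<close>.\<close>

lemma real4_chart_lower_lipschitz:
  assumes r: "0 < r" and L: "r ^ 7 * exp (21 * L) \<le> 1/2"
    and c: "\<And>i. \<bar>c $ i\<bar> \<le> L" "\<And>i. \<bar>c' $ i\<bar> \<le> L" and h: "\<And>i. \<bar>c $ i - c' $ i\<bar> \<le> 1/8"
  shows "r * \<bar>c $ i - c' $ i\<bar> \<le> 2 * exp L * inner_dist (surface 0) (real4_chart r c) (real4_chart r c')"
proof -
  let ?d = "inner_dist (surface 0) (real4_chart r c) (real4_chart r c')"
  let ?u = "Complex (c $ 1) (c $ 2)" and ?u' = "Complex (c' $ 1) (c' $ 2)"
  let ?v = "Complex (c $ 3) (c $ 4)" and ?v' = "Complex (c' $ 3) (c' $ 4)"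
  have S: "real4_chart r b \<in> surface 0" if "\<And>i. \<bar>b $ i\<bar> \<le> L" for b
    using chart_in_surface0[OF r chart_box_bounds(2)[OF r L]] that by simp
  have "norm (real4_chart r c - real4_chart r c') \<le> ?d"
    using dist_le_inner_dist[OF S[OF c(1)] S[OF c(2)]] by (simp add: dist_norm)
  then have "norm (of_real r * (exp ?u - exp ?u')) \<le> ?d" "norm (of_real r * (exp ?v - exp ?v')) \<le> ?d"
    using norm_triple_ge(2,3)[where x = "fst (real4_chart r c) - fst (real4_chart r c')"
        and y = "of_real r * (exp ?u - exp ?u')" and z = "of_real r * (exp ?v - exp ?v')"]
    by (auto simp: chart_def right_diff_distrib elim!: order_trans[rotated])
  then have e: "r * norm (exp ?u - exp ?u') \<le> ?d" "r * norm (exp ?v - exp ?v') \<le> ?d"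
    using r by (simp_all add: norm_mult)
  have quarter: "norm (Complex (c $ i) (c $ j) - Complex (c' $ i) (c' $ j)) \<le> 1/4" for i j
    using cmod_le[of "Complex (c $ i) (c $ j) - Complex (c' $ i) (c' $ j)"] h[of i] h[of j] by simp
  have lower: "r * norm (Complex (c $ i) (c $ j) - Complex (c' $ i) (c' $ j))
      \<le> 2 * exp L * (r * norm (exp (Complex (c $ i) (c $ j)) - exp (Complex (c' $ i) (c' $ j))))" for i j
    using mult_left_mono[OF exp_lower_lipschitz[OF quarter, of L i j], of r] c(2)[of i] r
    by (auto simp: mult_ac abs_le_iff)
  have u: "r * norm (?u - ?u') \<le> 2 * exp L * ?d" and v: "r * norm (?v - ?v') \<le> 2 * exp L * ?d"
    by (rule order_trans[OF lower mult_left_mono[OF e(1)]], simp)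
       (rule order_trans[OF lower mult_left_mono[OF e(2)]], simp)
  have comp1: "r * \<bar>c $ i - c' $ i\<bar> \<le> r * norm (Complex (c $ i) (c $ j) - Complex (c' $ i) (c' $ j))" for i j
    using abs_Re_le_cmod[of "Complex (c $ i) (c $ j) - Complex (c' $ i) (c' $ j)"] r
    by (intro mult_left_mono) auto
  have comp2: "r * \<bar>c $ j - c' $ j\<bar> \<le> r * norm (Complex (c $ i) (c $ j) - Complex (c' $ i) (c' $ j))" for i j
    using abs_Im_le_cmod[of "Complex (c $ i) (c $ j) - Complex (c' $ i) (c' $ j)"] r
    by (intro mult_left_mono) auto
  consider "i = 1" | "i = 2" | "i = 3" | "i = 4" using exhaust_4[of i] by blast
  then show ?thesis
    using order_trans[OF comp1 u] order_trans[OF comp2 u] order_trans[OF comp1 v] order_trans[OF comp2 v]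
    by cases simp_all
qed

text \<open>The bound on the coordinates is free of r, which makes one count serve at all small
  scales.\<close>

lemma real4_chart_surj:
  assumes r: "r > 0" and S: "(x, y, z) \<in> surface 0" and \<nu>: "\<nu> > 0"
    and y: "\<nu> * r \<le> norm y" "norm y \<le> \<Lambda> * r" and z: "\<nu> * r \<le> norm z" "norm z \<le> \<Lambda> * r"
    and small: "2 * \<Lambda> ^ 14 * r ^ 7 \<le> \<nu> ^ 7"
  obtains c where "real4_chart r c = (x, y, z)" "\<And>i. \<bar>c $ i\<bar> \<le> \<bar>ln \<nu>\<bar> + \<bar>ln \<Lambda>\<bar> + 10 * pi"
proof -
  have "2 * norm z ^ 14 \<le> 2 * (\<Lambda> * r) ^ 14" using z by (intro mult_left_mono power_mono) auto
  also have "\<dots> = (2 * \<Lambda> ^ 14 * r ^ 7) * r ^ 7" by (simp add: power_mult_distrib flip: power_add)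
  also have "\<dots> \<le> \<nu> ^ 7 * r ^ 7" using small r by (intro mult_right_mono) auto
  also have "\<dots> \<le> norm y ^ 7"
    unfolding power_mult_distrib[symmetric] using y r \<nu> by (intro power_mono) auto
  finally have yz: "2 * norm z ^ 14 \<le> norm y ^ 7" .
  have "\<nu> * r > 0" using \<nu> r by simp
  then have "y \<noteq> 0" "z \<noteq> 0" using y(1) z(1) by auto
  then obtain u v where uv: "chart r u v = (x, y, z)" "Re u = ln (norm y / r)" "Re v = ln (norm z / r)"
    "\<bar>Im u\<bar> \<le> pi" "\<bar>Im v\<bar> \<le> 10 * pi"
    using chart_surj[OF r S _ _ yz] by metis
  have ln_le: "\<bar>ln (a / r)\<bar> \<le> \<bar>ln \<nu>\<bar> + \<bar>ln \<Lambda>\<bar>" if "\<nu> * r \<le> a" "a \<le> \<Lambda> * r" for a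
  proof -
    have "\<nu> \<le> a / r" "a / r \<le> \<Lambda>" using that r by (auto simp: field_simps)
    then have "ln \<nu> \<le> ln (a / r)" "ln (a / r) \<le> ln \<Lambda>" using \<nu> by auto
    then show ?thesis by linarith
  qed
  have ln: "\<bar>Re u\<bar> \<le> \<bar>ln \<nu>\<bar> + \<bar>ln \<Lambda>\<bar>" "\<bar>Re v\<bar> \<le> \<bar>ln \<nu>\<bar> + \<bar>ln \<Lambda>\<bar>"
    unfolding uv by (intro ln_le y z)+
  define c :: "real^4" where "c = (\<chi> i. if i = 1 then Re u else if i = 2 then Im u else if i = 3 then Re v else Im v)"
  have c: "c $ 1 = Re u" "c $ 2 = Im u" "c $ 3 = Re v" "c $ 4 = Im v"
    by (simp_all add: c_def)
  have "\<bar>c $ 1\<bar> \<le> \<bar>ln \<nu>\<bar> + \<bar>ln \<Lambda>\<bar> + 10 * pi" "\<bar>c $ 2\<bar> \<le> \<bar>ln \<nu>\<bar> + \<bar>ln \<Lambda>\<bar> + 10 * pi"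
    "\<bar>c $ 3\<bar> \<le> \<bar>ln \<nu>\<bar> + \<bar>ln \<Lambda>\<bar> + 10 * pi" "\<bar>c $ 4\<bar> \<le> \<bar>ln \<nu>\<bar> + \<bar>ln \<Lambda>\<bar> + 10 * pi"
    unfolding c using ln uv(4,5) pi_gt_zero by linarith+
  then have "\<bar>c $ i\<bar> \<le> \<bar>ln \<nu>\<bar> + \<bar>ln \<Lambda>\<bar> + 10 * pi" for i
    using exhaust_4[of i] by metis
  then show ?thesis using uv(1) by (intro that[of c]) (simp_all add: c)
qed

theorem mainTheorem1:
  fixes t :: complex
  assumes "t \<noteq> 0"
  shows "\<not> bilipschitz_homeomorphic_germs
           (inner_metric (surface 0)) 0 (inner_metric (surface t)) 0"
proof
  assume germs: "bilipschitz_homeomorphic_germs (inner_metric (surface 0)) 0 (inner_metric (surface t)) 0"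
  show False
  proof (rule bilipschitz_homeomorphic_germsE[OF germs], unfold inner_metric_surface)
    fix U V f g K R
    assume KR: "1 \<le> K" "0 < R" and US: "U \<subseteq> surface 0" and Vt: "V \<subseteq> surface t" and zU: "0 \<in> U"
      and f0: "f 0 = 0"
      and fU: "\<And>a. a \<in> U \<Longrightarrow> f a \<in> V \<and> g (f a) = a" and gV: "\<And>b. b \<in> V \<Longrightarrow> g b \<in> U \<and> f (g b) = b"
      and flip: "\<And>a a'. a \<in> U \<Longrightarrow> a' \<in> U \<Longrightarrow>
        inner_dist (surface t) (f a) (f a') \<le> K * inner_dist (surface 0) a a'"
      and glip: "\<And>b b'. b \<in> V \<Longrightarrow> b' \<in> V \<Longrightarrow>
        inner_dist (surface 0) (g b) (g b') \<le> K * inner_dist (surface t) b b'"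
      and ballU: "\<And>a. a \<in> surface 0 \<Longrightarrow> inner_dist (surface 0) 0 a < R \<Longrightarrow> a \<in> U"
      and ballV: "\<And>b. b \<in> surface t \<Longrightarrow> inner_dist (surface t) 0 b < R \<Longrightarrow> b \<in> V"
    note U0 = US zU
    have lower: "inner_dist (surface 0) a a' \<le> K * inner_dist (surface t) (f a) (f a')"
      if "a \<in> U" "a' \<in> U" for a a'
      using glip[of "f a" "f a'"] fU that by simp
    obtain \<delta> \<rho> where "thin_wall t \<delta> \<rho>" using thin_wall_exists[OF assms] .
    then interpret thin_wall t \<delta> \<rho> .
    obtain M where M: "M > 0" "\<And>x y z x' y' z'. \<lbrakk>(x, y, z) \<in> wall; (x', y', z') \<in> wall; norm z \<le> 1; norm z' \<le> 1\<rbrakk>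
        \<Longrightarrow> inner_dist (surface t) (x, y, z) (x', y', z') \<le> M * (norm (z - z') + norm z' ^ 2)"
      using inner_dist_wall_le by metis
    \<comment> \<open>On \<open>z = 0\<close> the surface is \<open>x * (x^4 + t * y^6) = 0\<close>,
      with branches \<open>x = 0\<close> and \<open>x = a * y^(3/2)\<close>; each supplies one test
      point with \<open>y = r\<close>.\<close>
    obtain a where a: "- t = a ^ 4" using exists_complex_root[of 4 "- t"] by auto

    \<comment> \<open>The test points lie within \<open>C * r\<close> of the origin, their preimages
      within \<open>\<Lambda> * r\<close>. With \<open>y\<close> and \<open>z\<close> both below
      \<open>\<kappa> * r\<close>, a point is closer to the origin than
      \<open>9 * \<kappa> * r = r / K\<close>, too close for a preimage. A displacement
      \<open>\<tau> * r\<close> becomes at most \<open>r / 8\<close> under \<open>f\<close>.\<close>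
    define C where "C = 3 * norm a + 2"
    define \<kappa> where "\<kappa> = 1 / (9 * K)"
    define \<Lambda> where "\<Lambda> = K * C"
    define \<tau> where "\<tau> = 1 / (8 * K)"
    have C: "C \<ge> 2" by (simp add: C_def)
    have pos: "K > 0" "\<kappa> > 0" "\<Lambda> > 0" "\<tau> > 0" using KR C by (auto simp: \<kappa>_def \<Lambda>_def \<tau>_def)
    obtain \<nu> where \<nu>: "\<nu> > 0"
      "\<forall>\<^sub>F r in at_right 0. \<forall>x y z. (x, y, z) \<in> surface 0 \<longrightarrow> norm y \<le> \<Lambda> * r \<longrightarrow> norm z \<le> \<Lambda> * r \<longrightarrow>
         \<kappa> * r \<le> norm y \<or> \<kappa> * r \<le> norm z \<longrightarrow>
         (\<exists>x' y' z'. (x', y', z') \<in> surface 0 \<and> \<nu> * r \<le> norm y' \<and> \<nu> * r \<le> norm z' \<and>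
            inner_dist (surface 0) (x, y, z) (x', y', z') \<le> \<tau> * r)"
      using surface0_move_off_axes[OF pos(2,4)] by blast
    \<comment> \<open>\<open>L0\<close> bounds the coordinates of the endpoints, with
      \<open>\<Lambda> + \<tau>\<close> because the preimages get moved; the extra 1 in
      \<open>L\<close> leaves room for shifts by \<eta>.\<close>
    define L0 where "L0 = \<bar>ln \<nu>\<bar> + \<bar>ln (\<Lambda> + \<tau>)\<bar> + 10 * pi"
    define L where "L = L0 + 1"
    have L0: "L0 > 0" using pi_gt_zero by (auto simp: L0_def intro!: add_nonneg_pos)
    define Q where "Q = 52 * exp (2 * L)"
    have Q: "Q > 0" by (simp add: Q_def)
    define \<eta> where "\<eta> = min 1 (1 / (8 * K * Q))"
    have \<eta>: "\<eta> > 0" "\<eta> \<le> 1" "K * (Q * \<eta>) \<le> 1 / 8"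
    proof -
      show "\<eta> > 0" "\<eta> \<le> 1" using pos Q by (auto simp: \<eta>_def)
      have "K * (Q * \<eta>) \<le> K * (Q * (1 / (8 * K * Q)))"
        using pos Q by (intro mult_left_mono) (auto simp: \<eta>_def)
      then show "K * (Q * \<eta>) \<le> 1 / 8" using pos Q by simp
    qed
    \<comment> \<open>\<open>Z * r\<close> bounds the image of the box. \<open>D\<close> collects
      the constants of the final comparison: \<open>2 * exp L\<close> from the chart,
      \<open>K\<close> from the inverse map, \<open>M\<close> from the wall, and 2 for two terms
      \<open>\<epsilon> * r\<close>.\<close>
    define Z where "Z = K * (9 * exp (2 * L))"
    define D where "D = 4 * K * M * exp L"
    have ZD: "Z > 0" "D > 0" using pos M by (auto simp: Z_def D_def)
    \<comment> \<open>None of \<open>L0\<close>, \<open>Z\<close>, \<eta>, \<open>D\<close> involves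
      the scale, so r can still be taken small against \<epsilon>;
      \<open>Z^2 * r \<le> \<epsilon>\<close> will absorb the rotation term of the wall
      estimate.\<close>
    obtain \<epsilon> where \<epsilon>: "\<epsilon> > 0" and pigeonhole:
      "\<And>(a::real^4) b (s::real^4 \<Rightarrow> real) (\<zeta>::real^4 \<Rightarrow> complex).
         \<lbrakk>\<And>i. \<bar>a $ i\<bar> \<le> L0; \<And>i. \<bar>b $ i\<bar> \<le> L0;
          \<And>w. (\<And>i. \<bar>w $ i\<bar> \<le> \<eta>) \<Longrightarrow> s w \<in> {0..1} \<and> norm (\<zeta> w) \<le> Z\<rbrakk> \<Longrightarrow>
         \<exists>w w'. (\<forall>i. \<bar>w $ i\<bar> \<le> \<eta>) \<and> (\<forall>i. \<bar>w' $ i\<bar> \<le> \<eta>) \<and> norm (\<zeta> w - \<zeta> w') \<le> \<epsilon> \<and>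
           (\<forall>i. \<bar>(a + w + s w *\<^sub>R (b - a)) $ i - (a + w' + s w' *\<^sub>R (b - a)) $ i\<bar> \<le> 1/8) \<and>
           (\<exists>i. \<bar>(a + w + s w *\<^sub>R (b - a)) $ i - (a + w' + s w' *\<^sub>R (b - a)) $ i\<bar> > D * \<epsilon>)"
      using parallel_segments_pigeonhole[OF L0 ZD(1) \<eta>(1) ZD(2)] by metis

    have "\<forall>\<^sub>F r::real in at_right 0. r > 0" by (rule eventually_at_right_less)
    moreover have "\<forall>\<^sub>F r::real in at_right 0. 1 * r ^ 1 < min 1 (2 * \<rho>\<^sup>2)"
      "\<forall>\<^sub>F r in at_right 0. exp (21 * L) * r ^ 7 < 1/2"
      "\<forall>\<^sub>F r in at_right 0. Z\<^sup>2 * r ^ 1 < \<epsilon>" "\<forall>\<^sub>F r in at_right 0. Z * r ^ 1 < min 1 R"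
      "\<forall>\<^sub>F r in at_right 0. C * r ^ 1 < R"
      "\<forall>\<^sub>F r in at_right 0. (2 * (\<Lambda> + \<tau>) ^ 14) * r ^ 7 < \<nu> ^ 7"
      by (intro eventually_monomial_less; use \<rho> \<epsilon> KR \<nu> in simp)+
    ultimately have "\<forall>\<^sub>F r in at_right 0. r > 0 \<and> r < 1 \<and> r \<le> 2 * \<rho>\<^sup>2 \<and> r ^ 7 * exp (21 * L) \<le> 1/2 \<and>
        Z\<^sup>2 * r \<le> \<epsilon> \<and> Z * r \<le> 1 \<and> Z * r < R \<and> C * r < R \<and> 2 * (\<Lambda> + \<tau>) ^ 14 * r ^ 7 \<le> \<nu> ^ 7 \<and>
        (\<forall>x y z. (x, y, z) \<in> surface 0 \<longrightarrow> norm y \<le> \<Lambda> * r \<longrightarrow> norm z \<le> \<Lambda> * r \<longrightarrow>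
         \<kappa> * r \<le> norm y \<or> \<kappa> * r \<le> norm z \<longrightarrow>
         (\<exists>x' y' z'. (x', y', z') \<in> surface 0 \<and> \<nu> * r \<le> norm y' \<and> \<nu> * r \<le> norm z' \<and>
            inner_dist (surface 0) (x, y, z) (x', y', z') \<le> \<tau> * r))"
      using \<nu>(2) by eventually_elim (auto simp: mult.commute)
    then obtain r where r: "r > 0" "r < 1" "r \<le> 2 * \<rho>\<^sup>2" "r ^ 7 * exp (21 * L) \<le> 1/2"
        "Z\<^sup>2 * r \<le> \<epsilon>" "Z * r \<le> 1" "Z * r < R" "C * r < R" "2 * (\<Lambda> + \<tau>) ^ 14 * r ^ 7 \<le> \<nu> ^ 7"
      and move: "\<forall>x y z. (x, y, z) \<in> surface 0 \<longrightarrow> norm y \<le> \<Lambda> * r \<longrightarrow> norm z \<le> \<Lambda> * r \<longrightarrow>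
         \<kappa> * r \<le> norm y \<or> \<kappa> * r \<le> norm z \<longrightarrow>
         (\<exists>x' y' z'. (x', y', z') \<in> surface 0 \<and> \<nu> * r \<le> norm y' \<and> \<nu> * r \<le> norm z' \<and>
            inner_dist (surface 0) (x, y, z) (x', y', z') \<le> \<tau> * r)"
      using eventually_happens'[OF trivial_limit_at_right_real] by blast

    let ?d0 = "inner_dist (surface 0)" and ?dt = "inner_dist (surface t)"
    let ?\<phi> = "real4_chart r"
    have \<phi>_S: "?\<phi> c \<in> surface 0" and \<phi>_origin: "?d0 0 (?\<phi> c) \<le> 9 * exp (2 * L) * r"
      and \<phi>_nz: "?\<phi> c \<noteq> 0" if "\<And>i. \<bar>c $ i\<bar> \<le> L" for c
    proof -
      show "?\<phi> c \<in> surface 0"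
        using chart_in_surface0[OF r(1) chart_box_bounds(2)[OF r(1) r(4)]] that by simp
      show "?d0 0 (?\<phi> c) \<le> 9 * exp (2 * L) * r"
        using inner_dist_chart_origin_le[OF r(1) _ r(4)] r(2) that by simp
      show "?\<phi> c \<noteq> 0" using r(1) by (simp add: chart_def zero_prod_def)
    qed
    have KZ: "9 * exp (2 * L) * r \<le> Z * r"
      using KR r(1) by (simp add: Z_def)
    have \<phi>_U: "?\<phi> c \<in> U" if "\<And>i. \<bar>c $ i\<bar> \<le> L" for c
      by (rule ballU[OF \<phi>_S[OF that]]) (use \<phi>_origin[OF that] KZ r(7) in linarith)
    have f\<phi>_origin: "?dt 0 (f (?\<phi> c)) \<le> Z * r" if "\<And>i. \<bar>c $ i\<bar> \<le> L" for c
    proof -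
      have "?dt 0 (f (?\<phi> c)) \<le> K * ?d0 0 (?\<phi> c)"
        using flip[OF U0(2) \<phi>_U[OF that]] by (simp add: f0)
      also have "\<dots> \<le> K * (9 * exp (2 * L) * r)" using \<phi>_origin[OF that] pos by (intro mult_left_mono) auto
      finally show ?thesis by (simp add: Z_def mult_ac)
    qed
    have \<phi>_lip: "?d0 (?\<phi> c) (?\<phi> c') \<le> Q * r * h"
      if "\<And>i. \<bar>c $ i\<bar> \<le> L" "\<And>i. \<bar>c' $ i\<bar> \<le> L" "\<And>i. \<bar>c $ i - c' $ i\<bar> \<le> h" for c c' h
      unfolding Q_def using inner_dist_real4_chart_le[OF r(1) _ r(4)] r(2) that by simp

    \<comment> \<open>The preimage of a test point may lie near an axis, outside the box. It is
      moved into the chart and then shifted by \<open>w\<close>; under \<open>f\<close> the two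
      displacements cost at most \<open>r / 8\<close> each, which stays below the
      \<open>r / 2\<close> allowed by \<open>inner_ball_same_side\<close>.\<close>
    have endpoint: "\<exists>c. (\<forall>i. \<bar>c $ i\<bar> \<le> L0) \<and>
        (\<forall>w. (\<forall>i. \<bar>w $ i\<bar> \<le> \<eta>) \<longrightarrow> ?dt (x0, of_real r, 0) (f (?\<phi> (c + w))) < r / 2)"
      if P: "(x0, of_real r, 0) \<in> surface t" and dP: "?dt 0 (x0, of_real r, 0) \<le> C * r" for x0
    proof -
      let ?P = "(x0, complex_of_real r, 0 :: complex)"
      have PV: "?P \<in> V" using ballV[OF P] dP r(8) by simp
      obtain x y z where xyz: "g ?P = (x, y, z)" by (cases "g ?P")
      have gU: "(x, y, z) \<in> U" and fxyz: "f (x, y, z) = ?P" using gV[OF PV] by (auto simp: xyz)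
      then have S: "(x, y, z) \<in> surface 0" using U0 by auto
      have "g 0 = 0" using fU[OF U0(2)] f0 by simp
      then have "?d0 0 (x, y, z) \<le> K * ?dt 0 ?P"
        using glip[of 0 ?P] PV fU[OF U0(2)] by (simp add: f0 xyz)
      also have "\<dots> \<le> \<Lambda> * r" using dP pos by (simp add: \<Lambda>_def mult.assoc mult_left_mono)
      finally have "norm (x, y, z) \<le> \<Lambda> * r"
        using dist_le_inner_dist[OF zero_in_surface S] by simp
      then have yz: "norm y \<le> \<Lambda> * r" "norm z \<le> \<Lambda> * r"
        using norm_triple_ge(2,3)[where x = x and y = y and z = z] by linarith+
      have "norm ?P \<le> ?dt 0 ?P" using dist_le_inner_dist[OF zero_in_surface P] by simp
      moreover have "r \<le> norm ?P" using norm_triple_ge(2)[of "complex_of_real r" x0 "0 :: complex"] r(1) by simp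
      moreover have "?dt 0 ?P \<le> K * ?d0 0 (x, y, z)"
        using flip[OF U0(2) gU] by (simp add: f0 fxyz)
      ultimately have far: "r \<le> K * ?d0 0 (x, y, z)" by linarith
      have "\<kappa> * r \<le> norm y \<or> \<kappa> * r \<le> norm z"
      proof (rule ccontr)
        assume *: "\<not> ?thesis"
        let ?\<mu> = "max (norm y) (norm z)"
        have \<mu>: "?\<mu> < \<kappa> * r" using * by simp
        have "\<kappa> * r \<le> 1 * 1" using KR r(1,2) by (intro mult_mono) (auto simp: \<kappa>_def)
        then have "?d0 0 (x, y, z) \<le> 9 * ?\<mu>"
          using \<mu> by (intro inner_dist_surface0_origin_le[OF S]) auto
        then have "?d0 0 (x, y, z) < 9 * (\<kappa> * r)" using \<mu> by linarith
        then have "K * ?d0 0 (x, y, z) < K * (9 * (\<kappa> * r))" using pos(1) by simp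
        also have "\<dots> = r" using pos(1) by (simp add: \<kappa>_def)
        finally show False using far by simp
      qed
      then obtain x' y' z' where S': "(x', y', z') \<in> surface 0" and ge: "\<nu> * r \<le> norm y'" "\<nu> * r \<le> norm z'"
        and d': "?d0 (x, y, z) (x', y', z') \<le> \<tau> * r"
        using move[rule_format, OF S yz] by metis
      have "norm (x - x', y - y', z - z') \<le> \<tau> * r"
        using dist_le_inner_dist[OF S S'] d' by (simp add: dist_norm)
      then have "norm (y - y') \<le> \<tau> * r" "norm (z - z') \<le> \<tau> * r"
        using norm_triple_ge(2,3)[where x = "x - x'" and y = "y - y'" and z = "z - z'"] by linarith+
      then have le: "norm y' \<le> (\<Lambda> + \<tau>) * r" "norm z' \<le> (\<Lambda> + \<tau>) * r"
        using yz norm_triangle_ineq2[of y' y] norm_triangle_ineq2[of z' z]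
        by (simp_all add: norm_minus_commute distrib_right)
      obtain c where c: "?\<phi> c = (x', y', z')" "\<And>i. \<bar>c $ i\<bar> \<le> L0"
        using real4_chart_surj[OF r(1) S' \<nu>(1) ge(1) le(1) ge(2) le(2) r(9)] unfolding L0_def by metis
      have "?dt ?P (f (?\<phi> (c + w))) < r / 2" if w: "\<And>i. \<bar>w $ i\<bar> \<le> \<eta>" for w
      proof -
        have cL: "\<bar>c $ i\<bar> \<le> L" for i using c(2)[of i] by (simp add: L_def)
        have cwL: "\<bar>(c + w) $ i\<bar> \<le> L" for i
          using c(2)[of i] w[of i] \<eta>(2) by (simp add: L_def)
        have "?d0 (x, y, z) (?\<phi> (c + w)) \<le> ?d0 (x, y, z) (?\<phi> c) + ?d0 (?\<phi> c) (?\<phi> (c + w))"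
          by (intro inner_dist_surface_triangle S \<phi>_S cL cwL)
        also have "\<dots> \<le> \<tau> * r + Q * r * \<eta>"
          by (intro add_mono \<phi>_lip cL cwL) (use d' c(1) w in auto)
        finally have *: "?d0 (x, y, z) (?\<phi> (c + w)) \<le> \<tau> * r + Q * r * \<eta>" .
        have "?dt ?P (f (?\<phi> (c + w))) \<le> K * ?d0 (x, y, z) (?\<phi> (c + w))"
          using flip[OF gU \<phi>_U[OF cwL]] by (simp add: fxyz)
        also have "\<dots> \<le> K * (\<tau> * r + Q * r * \<eta>)" using * pos(1) by (intro mult_left_mono) auto
        also have "\<dots> = (K * \<tau> + K * (Q * \<eta>)) * r" by (simp add: algebra_simps)
        also have "\<dots> \<le> (1/8 + 1/8) * r"
          using \<eta>(3) pos(1) r(1) by (intro mult_right_mono add_mono) (auto simp: \<tau>_def)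
        also have "\<dots> < r / 2" using r(1) by simp
        finally show ?thesis .
      qed
      then show ?thesis using c(2) by blast
    qed

    let ?P = "(0 :: complex, complex_of_real r, 0 :: complex)"
    have P: "?P \<in> surface t" by (simp add: surface_def)
    have dP: "?dt 0 ?P \<le> C * r"
    proof -
      have "?dt 0 ?P \<le> 2 * r" using inner_dist_origin_le[OF P] r(1) by simp
      also have "\<dots> \<le> C * r" using C r(1) by (intro mult_right_mono) auto
      finally show ?thesis .
    qed
    have P_region: "?P \<in> region" using P r(1) \<delta> \<rho> by (simp add: region_def)
    define x1 where "x1 = a * of_real (sqrt r ^ 3)"
    let ?P' = "(x1, complex_of_real r, 0 :: complex)"
    have P': "?P' \<in> surface t"
    proof -
      define \<sigma> where "\<sigma> = complex_of_real (sqrt r)"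
      have \<sigma>: "\<sigma> ^ 2 = of_real r" using r(1) by (simp add: \<sigma>_def flip: of_real_power)
      have "x1 ^ 4 = a ^ 4 * (\<sigma> ^ 2) ^ 6"
        by (simp add: x1_def \<sigma>_def power_mult_distrib flip: power_mult)
      then have "x1 * (x1 ^ 4 + t * of_real r ^ 6) = 0" by (simp add: \<sigma> flip: a)
      moreover have "x1 ^ 5 + t * x1 * of_real r ^ 6 = x1 * (x1 ^ 4 + t * of_real r ^ 6)" by algebra
      ultimately show ?thesis by (simp add: surface_def)
    qed
    have nx1: "norm x1 = norm a * sqrt r ^ 3" using r(1) by (simp add: x1_def norm_mult norm_power)
    have dP': "?dt 0 ?P' \<le> C * r"
    proof -
      have "sqrt r ^ 3 \<le> sqrt r ^ 2" using r(1,2) by (intro power_decreasing) auto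
      then have "norm x1 \<le> norm a * r" using r(1) unfolding nx1 by (intro mult_left_mono) auto
      moreover have "?dt 0 ?P' \<le> 3 * norm x1 + 2 * r"
        using inner_dist_origin_le[OF P'] r(1) by simp
      ultimately show ?thesis by (simp add: C_def algebra_simps)
    qed
    have P'_region: "?P' \<notin> region"
    proof -
      \<comment> \<open>On this branch \<open>norm \<xi>\<close> is \<open>norm a\<close>, so it is
        enough that \<open>\<delta> \<le> norm a\<close>.\<close>
      have "norm a ^ 4 = norm t" using a by (metis norm_minus_cancel norm_power)
      then have "\<delta> ^ 4 \<le> norm a ^ 4" using \<delta>_power_le[of 4] \<delta> zero_le_power[of \<delta> 4] by linarith
      then have "\<delta> \<le> norm a" by (rule power_le_imp_le_base[of _ 3, simplified]) simp
      then have "\<delta>\<^sup>2 * r ^ 3 \<le> norm a ^ 2 * r ^ 3"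
        using \<delta> r(1) by (intro mult_right_mono power_mono) auto
      also have "\<dots> = norm x1 ^ 2"
      proof -
        have "(sqrt r ^ 3) ^ 2 = (sqrt r ^ 2) ^ 3" by (simp flip: power_mult)
        then show ?thesis using r(1) by (simp add: nx1 power_mult_distrib)
      qed
      finally show ?thesis using r(1) by (simp add: region_def)
    qed

    obtain b where b: "\<And>i. \<bar>b $ i\<bar> \<le> L0"
      "\<And>w. (\<And>i. \<bar>w $ i\<bar> \<le> \<eta>) \<Longrightarrow> ?dt ?P (f (?\<phi> (b + w))) < r / 2"
      using endpoint[OF P dP] by blast
    obtain b' where b': "\<And>i. \<bar>b' $ i\<bar> \<le> L0"
      "\<And>w. (\<And>i. \<bar>w $ i\<bar> \<le> \<eta>) \<Longrightarrow> ?dt ?P' (f (?\<phi> (b' + w))) < r / 2"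
      using endpoint[OF P' dP'] by blast
    have box: "\<bar>(b + w + s *\<^sub>R (b' - b)) $ i\<bar> \<le> L" if "\<And>i. \<bar>w $ i\<bar> \<le> \<eta>" "s \<in> {0..1}" for w s i
    proof -
      have "(b + w + s *\<^sub>R (b' - b)) $ i = ((1 - s) * b $ i + s * b' $ i) + w $ i" by (simp add: algebra_simps)
      moreover have "\<bar>(1 - s) * b $ i + s * b' $ i\<bar> \<le> (1 - s) * \<bar>b $ i\<bar> + s * \<bar>b' $ i\<bar>"
        using that by (intro order_trans[OF abs_triangle_ineq]) (simp add: abs_mult)
      moreover have "\<dots> \<le> (1 - s) * L0 + s * L0"
        using that b(1) b'(1) by (intro add_mono mult_left_mono) auto
      moreover have "(1 - s) * L0 + s * L0 = L0" by (simp add: algebra_simps)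
      ultimately show ?thesis using that(1)[of i] \<eta>(2) unfolding L_def by linarith
    qed
    have fS: "f (?\<phi> c) \<in> surface t" if "\<And>i. \<bar>c $ i\<bar> \<le> L" for c using fU[OF \<phi>_U[OF that]] Vt by auto

    \<comment> \<open>The image of each shifted segment starts inside the region and ends outside,
      since its ends are close to the two test points; injectivity of \<open>f\<close> keeps it off
      the origin.\<close>
    have "\<exists>s. s \<in> {0..1} \<and> f (?\<phi> (b + w + s *\<^sub>R (b' - b))) \<in> wall" if w: "\<And>i. \<bar>w $ i\<bar> \<le> \<eta>" for w
    proof -
      define \<gamma> where "\<gamma> s = f (?\<phi> (b + w + s *\<^sub>R (b' - b)))" for s
      note bx = box[OF w]
      have "(K * (Q * r * (2 * L0)))-lipschitz_on {0..1} \<gamma>"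
      proof (rule lipschitz_onI)
        fix s s' :: real assume s: "s \<in> {0..1}" "s' \<in> {0..1}"
        have "dist (\<gamma> s) (\<gamma> s') \<le> ?dt (\<gamma> s) (\<gamma> s')"
          unfolding \<gamma>_def by (intro dist_le_inner_dist fS bx s)
        also have "\<dots> \<le> K * ?d0 (?\<phi> (b + w + s *\<^sub>R (b' - b))) (?\<phi> (b + w + s' *\<^sub>R (b' - b)))"
          unfolding \<gamma>_def by (intro flip \<phi>_U bx s)
        also have "\<dots> \<le> K * (Q * r * (\<bar>s - s'\<bar> * (2 * L0)))"
        proof (intro mult_left_mono \<phi>_lip bx s)
          fix i
          have "(b + w + s *\<^sub>R (b' - b)) $ i - (b + w + s' *\<^sub>R (b' - b)) $ i = (s - s') * (b' $ i - b $ i)"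
            by (simp add: algebra_simps)
          moreover have "\<bar>b' $ i - b $ i\<bar> \<le> 2 * L0" using b(1)[of i] b'(1)[of i] by linarith
          ultimately show "\<bar>(b + w + s *\<^sub>R (b' - b)) $ i - (b + w + s' *\<^sub>R (b' - b)) $ i\<bar> \<le> \<bar>s - s'\<bar> * (2 * L0)"
            by (simp only: abs_mult mult_left_mono abs_ge_zero)
        qed (use pos in auto)
        finally show "dist (\<gamma> s) (\<gamma> s') \<le> K * (Q * r * (2 * L0)) * dist s s'"
          by (simp add: dist_real_def mult_ac)
      qed (use pos Q r L0 in simp)
      then have cont: "continuous_on {0..1} \<gamma>" by (rule lipschitz_on_continuous_on)
      have \<gamma>S: "\<gamma> s \<in> surface t - {0}" if s: "s \<in> {0..1}" for s
      proof -
        have "f (?\<phi> (b + w + s *\<^sub>R (b' - b))) \<noteq> 0"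
        proof
          assume "f (?\<phi> (b + w + s *\<^sub>R (b' - b))) = 0"
          then have "?\<phi> (b + w + s *\<^sub>R (b' - b)) = g (f 0)"
            using fU[OF \<phi>_U[OF bx[OF s]]] f0 by simp
          then show False using \<phi>_nz[OF bx[OF s]] fU[OF U0(2)] by simp
        qed
        then show ?thesis using fS[OF bx[OF s]] by (simp add: \<gamma>_def)
      qed
      have "\<gamma> 0 \<in> region"
        using inner_ball_same_side[OF r(1,3) P, of "\<gamma> 0"] P_region b(2)[OF w] \<gamma>S[of 0] by (simp add: \<gamma>_def)
      moreover have "\<gamma> 1 = f (?\<phi> (b' + w))" by (simp add: \<gamma>_def algebra_simps)
      then have "\<gamma> 1 \<notin> region"
        using inner_ball_same_side[OF r(1,3) P', of "\<gamma> 1"] P'_region b'(2)[OF w] \<gamma>S[of 1] by simp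
      ultimately obtain s where "s \<in> {0..1}" "\<gamma> s \<in> wall"
        using path_crosses_wall[OF cont \<gamma>S] by metis
      then show ?thesis unfolding \<gamma>_def by blast
    qed
    then obtain s where s: "\<And>w. (\<And>i. \<bar>w $ i\<bar> \<le> \<eta>) \<Longrightarrow> s w \<in> {0..1}"
      "\<And>w. (\<And>i. \<bar>w $ i\<bar> \<le> \<eta>) \<Longrightarrow> f (?\<phi> (b + w + s w *\<^sub>R (b' - b))) \<in> wall"
      by metis
    define c where "c w = b + w + s w *\<^sub>R (b' - b)" for w
    define \<zeta> where "\<zeta> w = snd (snd (f (?\<phi> (c w))))" for w
    have cL: "\<bar>c w $ i\<bar> \<le> L" if "\<And>i. \<bar>w $ i\<bar> \<le> \<eta>" for w i
      unfolding c_def by (rule box[OF that s(1)[OF that]])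
    have \<zeta>_le: "norm (\<zeta> w) \<le> Z * r" if w: "\<And>i. \<bar>w $ i\<bar> \<le> \<eta>" for w
    proof -
      have "norm (f (?\<phi> (c w))) \<le> Z * r"
        using dist_le_inner_dist[OF zero_in_surface fS[OF cL[OF w]]] f\<phi>_origin[OF cL[OF w]] by simp
      then show ?thesis
        using norm_triple_ge(3)[where x = "fst (f (?\<phi> (c w)))" and y = "fst (snd (f (?\<phi> (c w))))" and z = "\<zeta> w"]
        by (simp add: \<zeta>_def)
    qed
    \<comment> \<open>Division by r puts the crossing positions into the fixed disc of radius
      \<open>Z\<close> for which \<epsilon> was chosen.\<close>
    have "s w \<in> {0..1} \<and> norm (\<zeta> w / of_real r) \<le> Z" if "\<And>i. \<bar>w $ i\<bar> \<le> \<eta>" for w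
      using s(1)[OF that] \<zeta>_le[OF that] r(1) by (simp add: norm_divide divide_le_eq)
    note crossing = this
    have "\<exists>w w'. (\<forall>i. \<bar>w $ i\<bar> \<le> \<eta>) \<and> (\<forall>i. \<bar>w' $ i\<bar> \<le> \<eta>) \<and>
        norm (\<zeta> w / of_real r - \<zeta> w' / of_real r) \<le> \<epsilon> \<and>
        (\<forall>i. \<bar>c w $ i - c w' $ i\<bar> \<le> 1/8) \<and> (\<exists>i. \<bar>c w $ i - c w' $ i\<bar> > D * \<epsilon>)"
      unfolding c_def by (rule pigeonhole[OF b(1) b'(1)]) (use crossing in blast)
    then obtain w w' i where w: "\<And>i. \<bar>w $ i\<bar> \<le> \<eta>" "\<And>i. \<bar>w' $ i\<bar> \<le> \<eta>"
      and close: "norm (\<zeta> w / of_real r - \<zeta> w' / of_real r) \<le> \<epsilon>"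
      and near: "\<And>i. \<bar>c w $ i - c w' $ i\<bar> \<le> 1/8" and apart: "\<bar>c w $ i - c w' $ i\<bar> > D * \<epsilon>"
      by blast
    have "norm (\<zeta> w - \<zeta> w') \<le> \<epsilon> * r"
      using close r(1) by (simp add: norm_divide divide_le_eq flip: diff_divide_distrib)
    moreover have "norm (\<zeta> w') ^ 2 \<le> \<epsilon> * r"
    proof -
      have "norm (\<zeta> w') ^ 2 \<le> (Z * r) ^ 2" using \<zeta>_le[OF w(2)] by (intro power_mono) auto
      also have "\<dots> = (Z\<^sup>2 * r) * r" by algebra
      also have "\<dots> \<le> \<epsilon> * r" using r(1,5) by (intro mult_right_mono) auto
      finally show ?thesis .
    qed
    moreover have "?dt (f (?\<phi> (c w))) (f (?\<phi> (c w'))) \<le> M * (norm (\<zeta> w - \<zeta> w') + norm (\<zeta> w') ^ 2)"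
    proof -
      have "norm (\<zeta> w) \<le> 1" "norm (\<zeta> w') \<le> 1" using \<zeta>_le w r(6) order_trans by blast+
      then show ?thesis
        using M(2)[of "fst (f (?\<phi> (c w)))" "fst (snd (f (?\<phi> (c w))))" "\<zeta> w"
            "fst (f (?\<phi> (c w')))" "fst (snd (f (?\<phi> (c w'))))" "\<zeta> w'"] s(2)[OF w(1)] s(2)[OF w(2)]
        by (simp add: \<zeta>_def c_def)
    qed
    \<comment> \<open>Two crossings at inner distance at most \<open>2 * M * \<epsilon> * r\<close>
      pull back to chart coordinates differing by at most \<open>D * \<epsilon>\<close>, contrary to
      \<open>apart\<close>.\<close>
    ultimately have "?dt (f (?\<phi> (c w))) (f (?\<phi> (c w'))) \<le> M * (\<epsilon> * r + \<epsilon> * r)"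
      using M(1) by (smt (verit, best) mult_left_mono)
    then have "K * ?dt (f (?\<phi> (c w))) (f (?\<phi> (c w'))) \<le> K * (M * (\<epsilon> * r + \<epsilon> * r))"
      using pos(1) by (intro mult_left_mono) auto
    then have "?d0 (?\<phi> (c w)) (?\<phi> (c w')) \<le> K * (M * (\<epsilon> * r + \<epsilon> * r))"
      using lower[OF \<phi>_U[OF cL[OF w(1)]] \<phi>_U[OF cL[OF w(2)]]] by linarith
    then have "2 * exp L * ?d0 (?\<phi> (c w)) (?\<phi> (c w')) \<le> 2 * exp L * (K * (M * (\<epsilon> * r + \<epsilon> * r)))"
      by (intro mult_left_mono) auto
    moreover have "r * \<bar>c w $ i - c w' $ i\<bar> \<le> 2 * exp L * ?d0 (?\<phi> (c w)) (?\<phi> (c w'))"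
      by (rule real4_chart_lower_lipschitz[OF r(1,4) cL[OF w(1)] cL[OF w(2)] near])
    moreover have "2 * exp L * (K * (M * (\<epsilon> * r + \<epsilon> * r))) = r * (D * \<epsilon>)"
      by (simp add: D_def algebra_simps)
    ultimately have "r * \<bar>c w $ i - c w' $ i\<bar> \<le> r * (D * \<epsilon>)" by linarith
    then show False using apart r(1) by simp
  qed
qed

end
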